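(* Let $\Phi:\mathcal{A}^{\mathbb{Z}^D}\to\mathcal{A}^{\mathbb{Z}^D}$ be a cellular automaton with radius $R>0$ and let $\mathfrak{A}\subset\mathcal{A}^{\mathbb{Z}^D}$ be a subshift with $\Phi(\mathfrak A)\subseteq\mathfrak A$. Let $\mathcal G$ be a discrete group. Let $\mathbf a\in\widetilde{\mathfrak{A}}$ and let $\mathbf b=\Phi(\mathbf a)$. (a) If $C$ is a $\mathcal G$-valued cocycle on $\mathfrak A$ which is locally determined with radius $r>0$, then the residues of $C$ at $\mathbf b$ and of $\Phi_*C$ at $\mathbf a$ agree: $C(\zeta,\mathbf b)=(\Phi_*C)(\zeta,\mathbf a)$ for every closed trail $\zeta$ in $\mathbb{G}_{R+r}(\mathbf a)$. (b) If $\Phi_*:\mathcal{H}^1_{\mathrm{dy}}(\mathfrak A,\mathcal G)\to\mathcal{H}^1_{\mathrm{dy}}(\mathfrak A,\mathcal G)$ is surjective, then every $\mathcal G$-pole is $\Phi$-persistent. Suppose in addition that $\mathfrak A$ has a fundamental cocycle $C^*$ with values in an abelian group $\mathcal G^*$, and define $\mathrm{Res}^*_{\mathbf a}:\pi_1(\mathbb{G}_\infty(\mathbf a))\to\mathcal G^*$ by $\mathrm{Res}^*_{\mathbf a}(\underline\zeta)=C^*(\zeta,\mathbf a)$. (c) If $(\mathcal H,\cdot)$ is any abelian group and $\mathbf a$ has an $\mathcal H$-pole, then $\mathrm{Res}^*_{\mathbf a}$ is nontrivial. (d) Let $\varphi\in\mathrm{End}(\mathcal G^* )$ be such that $\Phi_*(\epsilon\circ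 C^* )\approx\epsilon\circ\varphi\circ C^*$ for all $\epsilon\in\mathrm{End}(\mathcal G^* )$. If $\mathbf b=\Phi(\mathbf a)$, then $\mathrm{Res}^*_{\mathbf b}=\varphi\circ\mathrm{Res}^*_{\mathbf a}$, i.e. $C^*(\zeta,\mathbf b)=\varphi(C^*(\zeta,\mathbf a))$ for all $\underline\zeta\in\pi_1(\mathbb{G}_\infty(\mathbf a))$. Hence, if $\varphi^n\circ\mathrm{Res}^*_{\mathbf a}$ is nontrivial for all $n\in\mathbb N$, then the defect of $\mathbf a$ is $\Phi$-persistent. (e) If $\varphi$ (as in (d)) is a monomorphism, then every pole (i.e. every $\mathcal H$-pole, for any group $\mathcal H$) is $\Phi$-persistent.
   Context: **Subshifts.** $\mathcal{A}$ is a finite alphabet, $D\ge1$; $\mathcal{A}^{\mathbb{Z}^D}$ carries the product topology; $\sigma^{\mathsf v}(\mathbf a)_{\mathsf z}=a_{\mathsf z+\mathsf v}$. A subshift is a closed shift-invariant subset. $\mathbb{B}(r)=\{-r,\dots,r\}^D$, $\mathbb{B}(\mathsf z,r)=\mathsf z+\mathbb{B}(r)$; patterns on translates of a set are identified with patterns on the set; $\mathfrak{A}_{(r)}=\{\mathbf a_{\mathbb{B}(r)}:\mathbf a\in\mathfrak{A}\}$. A cellular automaton (CA) is a continuous, shift-commuting self-map; it has radius $R$ if $\Phi(\mathbf a)_{\mathsf z}=\phi(\mathbf a_{\mathbb B(\mathsf z,R)})$ for some local rule $\phi:\mathcal A^{\mathbb B(R)}\to\mathcal A$. **Defects.** $\mathcal{F}_{\mathbf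 a}(\mathsf z)=\max\{r\in\mathbb N:\mathbf a_{\mathbb{B}(\mathsf z,r)}\in\mathfrak{A}_{(r)}\}\in\mathbb N\cup\{\infty\}$; $\widetilde{\mathfrak{A}}=\{\mathbf a:\sup_{\mathsf z}\mathcal{F}_{\mathbf a}(\mathsf z)=\infty\}$; $\mathbb{G}_r(\mathbf a)=\{\mathsf z:\mathcal{F}_{\mathbf a}(\mathsf z)\ge r\}$. One has $\mathbb G_{r+R}(\mathbf a)\subseteq\mathbb G_r(\Phi(\mathbf a))$. $\mathbf a$ is defective if $\mathbf a\in\widetilde{\mathfrak A}\setminus\mathfrak A$. The defect of $\mathbf a$ is $\Phi$-persistent if $\Phi^t(\mathbf a)$ is defective for all $t\in\mathbb N$. **Proper fundamental group.** A trail is a finite sequence $\zeta=(\mathsf z_0,\dots,\mathsf z_N)$ in $\mathbb{Z}^D$ with $\mathsf z_n-\mathsf z_{n-1}\in\mathbb E:=\{\pm\mathsf e_1,\dots,\pm\mathsf e_D\}$; closed if $\mathsf z_N=\mathsf z_0$. Connectedness in $\mathbb Z^D$ is via trails. For $\mathbb Y\subset\mathbb{Z}^D$, $\mathbf Y$ is the union of all unit cubes $\mathsf z+[0,1]^D$ all of whose corners lie in $\mathbb Y$. A component $\mathbb Y$ of $\mathbb{G}_{r}(\mathbf a)$ is projective if $\mathbb Y\cap\mathbb{G}_R(\mathbf a)\ne\emptyset$ for all $R\ge r$. Whenever $\pi_1(\mathbb G_\infty(\mathbf a))$ is used it is assumed that for some $r_0$, $\mathbb{G}_{r_0}(\mathbf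 a)$ has a unique projective component $\mathbb Y$, and that $\mathbb Y_r:=\mathbb Y\cap\mathbb{G}_r(\mathbf a)$ is the unique projective component of $\mathbb{G}_r(\mathbf a)$ for $r>r_0$; a proper base ray $\omega:[0,\infty)\to\mathbf Y_{r_0}$ (continuous, $|\omega(t)|\to\infty$, lying in $\mathbf Y_r$ for all large $t$, for each $r$) is fixed; $\pi_1(\mathbb Y_r,\omega):=\pi_1(\mathbf Y_r,\omega(t))$ for $t$ large (different $t$ identified along $\omega$), and $\pi_1(\mathbb{G}_\infty(\mathbf a))=\pi_1(\mathbb{G}_\infty(\mathbf a),\omega):=\varprojlim_r\pi_1(\mathbb Y_r,\omega)$ with respect to the maps induced by inclusions $\mathbb Y_{r+1}\subset\mathbb Y_r$. **Cocycles.** A $\mathcal G$-valued (dynamical) cocycle on $\mathfrak A$ is a continuous $C:\mathbb{Z}^D\times\mathfrak{A}\to\mathcal{G}$ with $C(\mathsf y+\mathsf z,\mathbf a)=C(\mathsf y,\sigma^{\mathsf z}(\mathbf a))\cdot C(\mathsf z,\mathbf a)$. $C\approx C'$ if there is a continuous $b:\mathfrak A\to\mathcal G$ with $C'(\mathsf z,\mathbf a)=b(\sigma^{\mathsf z}(\mathbf a))\,C(\mathsf z,\mathbf a)\,b(\mathbf a)^{-1}$. $\underline C$ is the class of $C$. $C$ is trivial if it is cohomologous to $(\mathsf z,\mathbf a)\mapsto h(\mathsf z)$ for some homomorphism $h:\mathbb{Z}^D\to\mathcal G$. If $\mathcal G$ is abelian, $\mathcal{H}^1_{\mathrm{dy}}(\mathfrak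 A,\mathcal G)$ is the group of cocycles modulo the subgroup of trivial cocycles; if $\mathcal G$ is nonabelian it is the set of cohomology classes. $(\Phi_*C)(\mathsf z,\mathbf a):=C(\mathsf z,\Phi(\mathbf a))$; this induces $\Phi_*$ on $\mathcal{H}^1_{\mathrm{dy}}$. All groups of coefficients are discrete. A cocycle $C^*:\mathbb Z^D\times\mathfrak A\to\mathcal G^*$ is fundamental if for every group $\mathcal H$ and every $\mathcal H$-valued cocycle $C$ on $\mathfrak A$ there is a homomorphism $\psi:\mathcal G^*\to\mathcal H$ with $C\approx\psi\circ C^*$. **The value $C(\zeta,\mathbf a)$, poles.** $C$ is locally determined with radius $r$ if there is a local rule $c:\mathbb E\times\mathfrak{A}_{(r)}\to\mathcal G$ with $C(\mathsf e,\mathbf x)=c(\mathsf e,\mathbf x_{\mathbb B(r)})$ for $\mathbf x\in\mathfrak A$, $\mathsf e\in\mathbb E$ (automatic for some $r$ when $\mathcal G$ is discrete; then $\Phi_*C$ is locally determined with radius $r+R$). For a trail $\zeta=(\mathsf z_0,\dots,\mathsf z_N)$ in $\mathbb{G}_r(\mathbf a)$, with $\mathsf z'_n=\mathsf z_n-\mathsf z_{n-1}$, $$C(\zeta,\mathbf a):=c(\mathsf z'_N,\mathbf a_{\mathbb B(\mathsf z_{N-1},r)})\cdots c(\mathsf z'_1,\mathbf a_{\mathbb B(\mathsf z_0,r)}).$$ For $\underline\zeta\in\pi_1(\mathbb{G}_\infty(\mathbf a))$, $C(\zeta,\mathbf a)$ and $C(\zeta,\Phi(\mathbf a))$ mean the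 values on a closed trail $\zeta_s$ in $\mathbb Y_s$ representing (up to change of base point) the component of $\underline\zeta$ in $\pi_1(\mathbb Y_s,\omega)$, $s$ sufficiently large; they are well defined for abelian $\mathcal G$ and well defined up to conjugacy in general. $\mathbf a$ has a (projective) $\mathcal G$-pole if $C(\zeta,\mathbf a)\ne e_{\mathcal G}$ for some $\mathcal G$-valued cocycle $C$ and some $\underline\zeta\in\pi_1(\mathbb{G}_\infty(\mathbf a))$. "A $\mathcal G$-pole is $\Phi$-persistent" means that the defect of any $\mathbf a\in\widetilde{\mathfrak A}$ having a $\mathcal G$-pole is $\Phi$-persistent. A homomorphism is nontrivial if it is not constantly the identity. *)

theory Defs
  imports "HOL-Analysis.Analysis" "HOL-Algebra.Coset" "HOL-Library.Extended_Nat"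
begin

section \<open>Subshifts, cellular automata and defects\<close>

text \<open>Configurations are functions \<^typ>\<open>int ^ 'd \<Rightarrow> 'a\<close> with a finite alphabet \<^typ>\<open>'a::finite\<close>;
  the dimension \<open>D \<ge> 1\<close> is \<^term>\<open>CARD('d::finite)\<close>.\<close>

definition config_topology :: "(int ^ 'd \<Rightarrow> 'a) topology" where
  "config_topology = product_topology (\<lambda>_. discrete_topology UNIV) UNIV"

definition shift :: "int ^ 'd \<Rightarrow> (int ^ 'd \<Rightarrow> 'a) \<Rightarrow> int ^ 'd \<Rightarrow> 'a" where
  "shift v a = (\<lambda>z. a (z + v))"

definition subshift :: "(int ^ 'd \<Rightarrow> 'a) set \<Rightarrow> bool" where
  "subshift A \<longleftrightarrow> closedin config_topology A \<and> (\<forall>v. \<forall>a\<in>A. shift v a \<in> A)"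

definition box_ball :: "nat \<Rightarrow> (int ^ 'd) set" where
  "box_ball r = {v. \<forall>i. \<bar>v $ i\<bar> \<le> int r}"

text \<open>The pattern of \<open>a\<close> on \<open>z + box_ball r\<close>, translated back to \<open>box_ball r\<close>.\<close>

definition pattern :: "(int ^ 'd \<Rightarrow> 'a) \<Rightarrow> int ^ 'd \<Rightarrow> nat \<Rightarrow> int ^ 'd \<Rightarrow> 'a" where
  "pattern a z r = (\<lambda>v\<in>box_ball r. a (z + v))"

definition admissible :: "(int ^ 'd \<Rightarrow> 'a) set \<Rightarrow> nat \<Rightarrow> (int ^ 'd \<Rightarrow> 'a) set" where
  "admissible A r = (\<lambda>x. pattern x 0 r) ` A"

definition cellular_automaton :: "((int ^ 'd \<Rightarrow> 'a) \<Rightarrow> int ^ 'd \<Rightarrow> 'a) \<Rightarrow> bool" where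
  "cellular_automaton \<Phi> \<longleftrightarrow>
     continuous_map config_topology config_topology \<Phi> \<and>
     (\<forall>v a. \<Phi> (shift v a) = shift v (\<Phi> a))"

definition has_radius :: "((int ^ 'd \<Rightarrow> 'a) \<Rightarrow> int ^ 'd \<Rightarrow> 'a) \<Rightarrow> nat \<Rightarrow> bool" where
  "has_radius \<Phi> R \<longleftrightarrow> (\<exists>f. \<forall>a z. \<Phi> a z = f (pattern a z R))"

text \<open>The supremum in \<^typ>\<open>enat\<close> is the maximum when the set is finite and nonempty, and \<open>\<infinity>\<close>
  when it is infinite. The set is empty if the letter \<open>a z\<close> does not occur in \<open>A\<close>; the value
  is then \<open>0\<close>.\<close>

definition admissibility :: "(int ^ 'd \<Rightarrow> 'a) set \<Rightarrow> (int ^ 'd \<Rightarrow> 'a) \<Rightarrow> int ^ 'd \<Rightarrow> enat" where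
  "admissibility A a z = Sup {enat r | r. pattern a z r \<in> admissible A r}"

definition tilde :: "(int ^ 'd \<Rightarrow> 'a) set \<Rightarrow> (int ^ 'd \<Rightarrow> 'a) set" where
  "tilde A = {a. (SUP z. admissibility A a z) = \<infinity>}"

definition good_set :: "(int ^ 'd \<Rightarrow> 'a) set \<Rightarrow> (int ^ 'd \<Rightarrow> 'a) \<Rightarrow> nat \<Rightarrow> (int ^ 'd) set" where
  "good_set A a r = {z. admissibility A a z \<ge> enat r}"

definition defective :: "(int ^ 'd \<Rightarrow> 'a) set \<Rightarrow> (int ^ 'd \<Rightarrow> 'a) \<Rightarrow> bool" where
  "defective A a \<longleftrightarrow> a \<in> tilde A - A"

definition persistent ::
    "(int ^ 'd \<Rightarrow> 'a) set \<Rightarrow> ((int ^ 'd \<Rightarrow> 'a) \<Rightarrow> int ^ 'd \<Rightarrow> 'a) \<Rightarrow> (int ^ 'd \<Rightarrow> 'a) \<Rightarrow> bool" where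
  "persistent A \<Phi> a \<longleftrightarrow> (\<forall>t. defective A ((\<Phi> ^^ t) a))"


section \<open>Trails and components\<close>

definition steps :: "(int ^ 'd) set" where
  "steps = (\<Union>i. {axis i 1, - axis i 1})"

definition trail :: "(int ^ 'd) list \<Rightarrow> bool" where
  "trail \<zeta> \<longleftrightarrow> \<zeta> \<noteq> [] \<and> successively (\<lambda>u v. v - u \<in> steps) \<zeta>"

definition closed_trail_in :: "(int ^ 'd) set \<Rightarrow> (int ^ 'd) list \<Rightarrow> bool" where
  "closed_trail_in S \<zeta> \<longleftrightarrow> trail \<zeta> \<and> last \<zeta> = hd \<zeta> \<and> set \<zeta> \<subseteq> S"

definition trail_components :: "(int ^ 'd) set \<Rightarrow> (int ^ 'd) set set" where
  "trail_components S =
     (\<lambda>u. {v. \<exists>\<zeta>. trail \<zeta> \<and> set \<zeta> \<subseteq> S \<and> hd \<zeta> = u \<and> last \<zeta> = v}) ` S"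

definition projective_component ::
    "(int ^ 'd \<Rightarrow> 'a) set \<Rightarrow> (int ^ 'd \<Rightarrow> 'a) \<Rightarrow> nat \<Rightarrow> (int ^ 'd) set \<Rightarrow> bool" where
  "projective_component A a r Y \<longleftrightarrow>
     Y \<in> trail_components (good_set A a r) \<and> (\<forall>R\<ge>r. Y \<inter> good_set A a R \<noteq> {})"

definition unique_projective_component ::
    "(int ^ 'd \<Rightarrow> 'a) set \<Rightarrow> (int ^ 'd \<Rightarrow> 'a) \<Rightarrow> nat \<Rightarrow> (int ^ 'd) set \<Rightarrow> bool" where
  "unique_projective_component A a r Y \<longleftrightarrow>
     projective_component A a r Y \<and> (\<forall>Y'. projective_component A a r Y' \<longrightarrow> Y' = Y)"

definition real_point :: "int ^ 'd \<Rightarrow> real ^ 'd" where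
  "real_point z = (\<chi> i. of_int (z $ i))"

text \<open>The union of the unit cubes all of whose corners lie in \<open>Y\<close>.\<close>

definition cubes :: "(int ^ 'd) set \<Rightarrow> (real ^ 'd) set" where
  "cubes Y = (\<Union>z\<in>{z. \<forall>e. (\<forall>i. e $ i \<in> {0, 1}) \<longrightarrow> z + e \<in> Y}.
                cbox (real_point z) (real_point z + (\<chi> i. 1)))"


section \<open>The proper fundamental group\<close>

definition based_loops :: "'p::topological_space set \<Rightarrow> 'p \<Rightarrow> (real \<Rightarrow> 'p) set" where
  "based_loops S x = {p. path p \<and> path_image p \<subseteq> S \<and> pathstart p = x \<and> pathfinish p = x}"

text \<open>Path-homotopy class in \<open>S\<close> generated by a set of mutually homotopic paths; applied to a
  class in a subset of \<open>S\<close>, this is the map induced by the inclusion.\<close>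

definition homotopy_saturation ::
    "'p::topological_space set \<Rightarrow> (real \<Rightarrow> 'p) set \<Rightarrow> (real \<Rightarrow> 'p) set" where
  "homotopy_saturation S K = {q. \<exists>p\<in>K. homotopic_paths S p q}"

definition pi1 :: "'p::real_normed_vector set \<Rightarrow> 'p \<Rightarrow> (real \<Rightarrow> 'p) set monoid" where
  "pi1 S x =
     \<lparr>carrier = (\<lambda>p. homotopy_saturation S {p}) ` based_loops S x,
      monoid.mult = (\<lambda>K L. homotopy_saturation S {k +++ l | k l. k \<in> K \<and> l \<in> L}),
      one = homotopy_saturation S {linepath x x}\<rparr>"

text \<open>Change of base point along a path \<open>p\<close> in \<open>S\<close>.\<close>

definition pi1_transport ::
    "'p::topological_space set \<Rightarrow> (real \<Rightarrow> 'p) \<Rightarrow> (real \<Rightarrow> 'p) set \<Rightarrow> (real \<Rightarrow> 'p) set" where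
  "pi1_transport S p K = homotopy_saturation S {reversepath p +++ (k +++ p) | k. k \<in> K}"

definition ray_times :: "'p set \<Rightarrow> (real \<Rightarrow> 'p) \<Rightarrow> real set" where
  "ray_times S \<omega> = {t. 0 \<le> t \<and> \<omega> ` {t..} \<subseteq> S}"

text \<open>The groups \<open>pi1 S (\<omega> t)\<close> for large \<open>t\<close>, identified along \<open>\<omega>\<close>: an element is a family
  of classes, one for each base point \<open>\<omega> t\<close>, which correspond to each other under transport
  along \<open>\<omega>\<close>.\<close>

definition pi1_ray ::
    "'p::real_normed_vector set \<Rightarrow> (real \<Rightarrow> 'p) \<Rightarrow> (real \<Rightarrow> (real \<Rightarrow> 'p) set) monoid" where
  "pi1_ray S \<omega> =
     \<lparr>carrier = {g \<in> (\<Pi>\<^sub>E t\<in>ray_times S \<omega>. carrier (pi1 S (\<omega> t))).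
                  \<forall>t\<in>ray_times S \<omega>. \<forall>t'\<ge>t. g t' = pi1_transport S (subpath t t' \<omega>) (g t)},
      monoid.mult = (\<lambda>g h. \<lambda>t\<in>ray_times S \<omega>. g t \<otimes>\<^bsub>pi1 S (\<omega> t)\<^esub> h t),
      one = (\<lambda>t\<in>ray_times S \<omega>. \<one>\<^bsub>pi1 S (\<omega> t)\<^esub>)\<rparr>"

text \<open>The standing assumption on \<open>a\<close>, with the data \<open>r0\<close>, \<open>Y\<close> and the proper base ray \<open>\<omega>\<close>.\<close>

definition proper_base ::
    "(int ^ 'd \<Rightarrow> 'a) set \<Rightarrow> (int ^ 'd \<Rightarrow> 'a) \<Rightarrow> nat \<Rightarrow> (int ^ 'd) set \<Rightarrow> (real \<Rightarrow> real ^ 'd) \<Rightarrow> bool"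
  where
  "proper_base A a r0 Y \<omega> \<longleftrightarrow>
     unique_projective_component A a r0 Y \<and>
     (\<forall>r>r0. unique_projective_component A a r (Y \<inter> good_set A a r)) \<and>
     continuous_on {0..} \<omega> \<and> \<omega> ` {0..} \<subseteq> cubes Y \<and>
     filterlim (\<lambda>t. norm (\<omega> t)) at_top at_top \<and>
     (\<forall>r\<ge>r0. \<forall>\<^sub>F t in at_top. \<omega> t \<in> cubes (Y \<inter> good_set A a r))"

text \<open>The inverse limit over \<open>r \<ge> r0\<close>. An element of \<open>pi1_ray S \<omega>\<close> is determined by its value
  at any one time, so compatibility need only be required at the times where the finer
  component is defined.\<close>

definition pi1_infty ::
    "(int ^ 'd \<Rightarrow> 'a) set \<Rightarrow> (int ^ 'd \<Rightarrow> 'a) \<Rightarrow> nat \<Rightarrow> (int ^ 'd) set \<Rightarrow> (real \<Rightarrow> real ^ 'd)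
      \<Rightarrow> (nat \<Rightarrow> real \<Rightarrow> (real \<Rightarrow> real ^ 'd) set) monoid" where
  "pi1_infty A a r0 Y \<omega> =
     (let S = (\<lambda>r. cubes (Y \<inter> good_set A a r)) in
      \<lparr>carrier = {\<gamma> \<in> (\<Pi>\<^sub>E r\<in>{r0..}. carrier (pi1_ray (S r) \<omega>)).
                   \<forall>r\<ge>r0. \<forall>t\<in>ray_times (S (Suc r)) \<omega>.
                     \<gamma> r t = homotopy_saturation (S r) (\<gamma> (Suc r) t)},
       monoid.mult = (\<lambda>\<gamma> \<delta>. \<lambda>r\<in>{r0..}. \<gamma> r \<otimes>\<^bsub>pi1_ray (S r) \<omega>\<^esub> \<delta> r),
       one = (\<lambda>r\<in>{r0..}. \<one>\<^bsub>pi1_ray (S r) \<omega>\<^esub>)\<rparr>)"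

fun trail_path :: "(int ^ 'd) list \<Rightarrow> real \<Rightarrow> real ^ 'd" where
  "trail_path [] = linepath 0 0"
| "trail_path [z] = linepath (real_point z) (real_point z)"
| "trail_path (z # w # \<zeta>) = linepath (real_point z) (real_point w) +++ trail_path (w # \<zeta>)"

text \<open>Representing an element \<open>g\<close> of \<open>pi1_ray (cubes Y) \<omega>\<close> up to change of base point means free
  homotopy in \<open>cubes Y\<close>.\<close>

definition represents ::
    "(int ^ 'd) set \<Rightarrow> (real \<Rightarrow> real ^ 'd) \<Rightarrow> (real \<Rightarrow> (real \<Rightarrow> real ^ 'd) set)
      \<Rightarrow> (int ^ 'd) list \<Rightarrow> bool" where
  "represents Y \<omega> g \<zeta> \<longleftrightarrow>
     closed_trail_in Y \<zeta> \<and>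
     (\<exists>t\<in>ray_times (cubes Y) \<omega>. \<exists>p\<in>g t. homotopic_loops (cubes Y) (trail_path \<zeta>) p)"


section \<open>Cocycles\<close>

text \<open>A cocycle is a function on \<open>\<int>\<^sup>D \<times> A\<close>; values off \<open>A\<close> are irrelevant, and are normalised only
  in the set \<open>cocycles\<close> below.\<close>

definition cocycle ::
    "('g, 'm) monoid_scheme \<Rightarrow> (int ^ 'd \<Rightarrow> 'a) set \<Rightarrow> (int ^ 'd \<Rightarrow> (int ^ 'd \<Rightarrow> 'a) \<Rightarrow> 'g) \<Rightarrow> bool"
  where
  "cocycle G A C \<longleftrightarrow>
     continuous_map (prod_topology (discrete_topology UNIV) (subtopology config_topology A))
       (discrete_topology (carrier G)) (\<lambda>(z, a). C z a) \<and>
     (\<forall>y z. \<forall>a\<in>A. C (y + z) a = C y (shift z a) \<otimes>\<^bsub>G\<^esub> C z a)"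

definition cohomologous ::
    "('g, 'm) monoid_scheme \<Rightarrow> (int ^ 'd \<Rightarrow> 'a) set \<Rightarrow> (int ^ 'd \<Rightarrow> (int ^ 'd \<Rightarrow> 'a) \<Rightarrow> 'g)
      \<Rightarrow> (int ^ 'd \<Rightarrow> (int ^ 'd \<Rightarrow> 'a) \<Rightarrow> 'g) \<Rightarrow> bool" where
  "cohomologous G A C C' \<longleftrightarrow>
     (\<exists>b. continuous_map (subtopology config_topology A) (discrete_topology (carrier G)) b \<and>
          (\<forall>z. \<forall>a\<in>A. C' z a = b (shift z a) \<otimes>\<^bsub>G\<^esub> C z a \<otimes>\<^bsub>G\<^esub> inv\<^bsub>G\<^esub> (b a)))"

definition lattice_group :: "(int ^ 'd) monoid" where
  "lattice_group = \<lparr>carrier = UNIV, monoid.mult = (+), one = 0\<rparr>"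

definition trivial_cocycle ::
    "('g, 'm) monoid_scheme \<Rightarrow> (int ^ 'd \<Rightarrow> 'a) set \<Rightarrow> (int ^ 'd \<Rightarrow> (int ^ 'd \<Rightarrow> 'a) \<Rightarrow> 'g) \<Rightarrow> bool"
  where
  "trivial_cocycle G A C \<longleftrightarrow> (\<exists>h\<in>hom lattice_group G. cohomologous G A C (\<lambda>z a. h z))"

definition pull ::
    "(int ^ 'd \<Rightarrow> 'a) set \<Rightarrow> ((int ^ 'd \<Rightarrow> 'a) \<Rightarrow> int ^ 'd \<Rightarrow> 'a)
      \<Rightarrow> (int ^ 'd \<Rightarrow> (int ^ 'd \<Rightarrow> 'a) \<Rightarrow> 'g) \<Rightarrow> int ^ 'd \<Rightarrow> (int ^ 'd \<Rightarrow> 'a) \<Rightarrow> 'g" where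
  "pull A \<Phi> C = (\<lambda>z. \<lambda>a\<in>A. C z (\<Phi> a))"

definition cocycles ::
    "('g, 'm) monoid_scheme \<Rightarrow> (int ^ 'd \<Rightarrow> 'a) set \<Rightarrow> (int ^ 'd \<Rightarrow> (int ^ 'd \<Rightarrow> 'a) \<Rightarrow> 'g) set" where
  "cocycles G A = {C. cocycle G A C \<and> (\<forall>z. C z \<in> extensional A)}"

text \<open>The group of cocycles under pointwise multiplication, for abelian \<open>G\<close>.\<close>

definition cocycle_group ::
    "('g, 'm) monoid_scheme \<Rightarrow> (int ^ 'd \<Rightarrow> 'a) set
      \<Rightarrow> (int ^ 'd \<Rightarrow> (int ^ 'd \<Rightarrow> 'a) \<Rightarrow> 'g) monoid" where
  "cocycle_group G A =
     \<lparr>carrier = cocycles G A,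
      monoid.mult = (\<lambda>C C' z. \<lambda>a\<in>A. C z a \<otimes>\<^bsub>G\<^esub> C' z a),
      one = (\<lambda>z. \<lambda>a\<in>A. \<one>\<^bsub>G\<^esub>)\<rparr>"

text \<open>For abelian \<open>G\<close> this is the carrier of a group; otherwise it is only a set of classes.\<close>

definition H1_dy ::
    "('g, 'm) monoid_scheme \<Rightarrow> (int ^ 'd \<Rightarrow> 'a) set
      \<Rightarrow> (int ^ 'd \<Rightarrow> (int ^ 'd \<Rightarrow> 'a) \<Rightarrow> 'g) set set" where
  "H1_dy G A =
     (if comm_group G
      then carrier (cocycle_group G A Mod {C \<in> cocycles G A. trivial_cocycle G A C})
      else cocycles G A //
             {(C, C'). C \<in> cocycles G A \<and> C' \<in> cocycles G A \<and> cohomologous G A C C'})"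

text \<open>The induced map sends a class \<open>K\<close> to the class containing the image of \<open>K\<close>.\<close>

definition H1_pull ::
    "('g, 'm) monoid_scheme \<Rightarrow> (int ^ 'd \<Rightarrow> 'a) set \<Rightarrow> ((int ^ 'd \<Rightarrow> 'a) \<Rightarrow> int ^ 'd \<Rightarrow> 'a)
      \<Rightarrow> (int ^ 'd \<Rightarrow> (int ^ 'd \<Rightarrow> 'a) \<Rightarrow> 'g) set \<Rightarrow> (int ^ 'd \<Rightarrow> (int ^ 'd \<Rightarrow> 'a) \<Rightarrow> 'g) set" where
  "H1_pull G A \<Phi> K = (THE L. L \<in> H1_dy G A \<and> pull A \<Phi> ` K \<subseteq> L)"

text \<open>HOL cannot quantify over types inside a formula, so the universal property is relative to a
  type \<^typ>\<open>'h\<close> in which the test groups live. A statement that assumes it for a type variable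
  \<^typ>\<open>'h\<close> uses only an instance of the full universal property.\<close>

definition fundamental_cocycle ::
    "'h itself \<Rightarrow> ('g, 'm) monoid_scheme \<Rightarrow> (int ^ 'd \<Rightarrow> 'a) set
      \<Rightarrow> (int ^ 'd \<Rightarrow> (int ^ 'd \<Rightarrow> 'a) \<Rightarrow> 'g) \<Rightarrow> bool" where
  "fundamental_cocycle _ G A C \<longleftrightarrow>
     cocycle G A C \<and>
     (\<forall>(H :: 'h monoid) C'. group H \<and> cocycle H A C' \<longrightarrow>
        (\<exists>\<psi>\<in>hom G H. cohomologous H A C' (\<lambda>z a. \<psi> (C z a))))"


section \<open>Values on trails, residues and poles\<close>

definition is_local_rule ::
    "(int ^ 'd \<Rightarrow> 'a) set \<Rightarrow> nat \<Rightarrow> (int ^ 'd \<Rightarrow> (int ^ 'd \<Rightarrow> 'a) \<Rightarrow> 'g)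
      \<Rightarrow> (int ^ 'd \<Rightarrow> (int ^ 'd \<Rightarrow> 'a) \<Rightarrow> 'g) \<Rightarrow> bool" where
  "is_local_rule A r C c \<longleftrightarrow> (\<forall>e\<in>steps. \<forall>x\<in>A. C e x = c e (pattern x 0 r))"

definition locally_determined ::
    "(int ^ 'd \<Rightarrow> 'a) set \<Rightarrow> nat \<Rightarrow> (int ^ 'd \<Rightarrow> (int ^ 'd \<Rightarrow> 'a) \<Rightarrow> 'g) \<Rightarrow> bool" where
  "locally_determined A r C \<longleftrightarrow> (\<exists>c. is_local_rule A r C c)"

text \<open>The choice is harmless: if \<open>C\<close> is locally determined with radius \<open>r\<close>, any two local rules
  agree on \<open>steps \<times> admissible A r\<close>.\<close>

definition local_rule ::
    "(int ^ 'd \<Rightarrow> 'a) set \<Rightarrow> nat \<Rightarrow> (int ^ 'd \<Rightarrow> (int ^ 'd \<Rightarrow> 'a) \<Rightarrow> 'g)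
      \<Rightarrow> int ^ 'd \<Rightarrow> (int ^ 'd \<Rightarrow> 'a) \<Rightarrow> 'g" where
  "local_rule A r C = (SOME c. is_local_rule A r C c)"

fun rule_value ::
    "('g, 'm) monoid_scheme \<Rightarrow> nat \<Rightarrow> (int ^ 'd \<Rightarrow> (int ^ 'd \<Rightarrow> 'a) \<Rightarrow> 'g)
      \<Rightarrow> (int ^ 'd) list \<Rightarrow> (int ^ 'd \<Rightarrow> 'a) \<Rightarrow> 'g" where
  "rule_value G r c (z # w # \<zeta>) x =
     rule_value G r c (w # \<zeta>) x \<otimes>\<^bsub>G\<^esub> c (w - z) (pattern x z r)"
| "rule_value G r c _ x = \<one>\<^bsub>G\<^esub>"

text \<open>\<open>C(\<zeta>, x)\<close>, for \<open>C\<close> locally determined with radius \<open>r\<close> and \<open>\<zeta>\<close> a trail in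
  \<open>good_set A x r\<close>.\<close>

definition trail_value ::
    "('g, 'm) monoid_scheme \<Rightarrow> (int ^ 'd \<Rightarrow> 'a) set \<Rightarrow> nat
      \<Rightarrow> (int ^ 'd \<Rightarrow> (int ^ 'd \<Rightarrow> 'a) \<Rightarrow> 'g) \<Rightarrow> (int ^ 'd) list \<Rightarrow> (int ^ 'd \<Rightarrow> 'a) \<Rightarrow> 'g" where
  "trail_value G A r C \<zeta> x = rule_value G r (local_rule A r C) \<zeta> x"

text \<open>For \<open>\<gamma>\<close> in \<open>pi1_infty A a r0 Y \<omega>\<close>: the value \<open>C(\<gamma>, x)\<close> is \<open>v\<close>, up to conjugacy. The
  configuration \<open>x\<close> is \<open>a\<close> itself or its image under the cellular automaton.\<close>

definition has_residue ::
    "('g, 'm) monoid_scheme \<Rightarrow> (int ^ 'd \<Rightarrow> 'a) set \<Rightarrow> (int ^ 'd \<Rightarrow> 'a) \<Rightarrow> (int ^ 'd) set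
      \<Rightarrow> (real \<Rightarrow> real ^ 'd) \<Rightarrow> (int ^ 'd \<Rightarrow> (int ^ 'd \<Rightarrow> 'a) \<Rightarrow> 'g)
      \<Rightarrow> (nat \<Rightarrow> real \<Rightarrow> (real \<Rightarrow> real ^ 'd) set) \<Rightarrow> (int ^ 'd \<Rightarrow> 'a) \<Rightarrow> 'g \<Rightarrow> bool" where
  "has_residue G A a Y \<omega> C \<gamma> x v \<longleftrightarrow>
     v \<in> carrier G \<and>
     (\<exists>r. locally_determined A r C \<and>
        (\<forall>\<^sub>F s in sequentially.
           (\<exists>\<zeta>. represents (Y \<inter> good_set A a s) \<omega> (\<gamma> s) \<zeta>) \<and>
           (\<forall>\<zeta>. represents (Y \<inter> good_set A a s) \<omega> (\<gamma> s) \<zeta> \<longrightarrow>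
              (\<exists>g\<in>carrier G. trail_value G A r C \<zeta> x = g \<otimes>\<^bsub>G\<^esub> v \<otimes>\<^bsub>G\<^esub> inv\<^bsub>G\<^esub> g))))"

definition has_pole ::
    "('g, 'm) monoid_scheme \<Rightarrow> (int ^ 'd \<Rightarrow> 'a) set \<Rightarrow> (int ^ 'd \<Rightarrow> 'a) \<Rightarrow> nat \<Rightarrow> (int ^ 'd) set
      \<Rightarrow> (real \<Rightarrow> real ^ 'd) \<Rightarrow> bool" where
  "has_pole G A a r0 Y \<omega> \<longleftrightarrow>
     (\<exists>C. cocycle G A C \<and>
       (\<exists>\<gamma>\<in>carrier (pi1_infty A a r0 Y \<omega>). \<exists>v. has_residue G A a Y \<omega> C \<gamma> a v \<and> v \<noteq> \<one>\<^bsub>G\<^esub>))"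

definition poles_persistent ::
    "('g, 'm) monoid_scheme \<Rightarrow> (int ^ 'd \<Rightarrow> 'a) set
      \<Rightarrow> ((int ^ 'd \<Rightarrow> 'a) \<Rightarrow> int ^ 'd \<Rightarrow> 'a) \<Rightarrow> bool" where
  "poles_persistent G A \<Phi> \<longleftrightarrow>
     (\<forall>a\<in>tilde A. \<forall>r0 Y \<omega>.
        proper_base A a r0 Y \<omega> \<and> has_pole G A a r0 Y \<omega> \<longrightarrow> persistent A \<Phi> a)"

text \<open>For abelian \<open>G\<close> the residue is an element of \<open>G\<close>.\<close>

definition residue ::
    "('g, 'm) monoid_scheme \<Rightarrow> (int ^ 'd \<Rightarrow> 'a) set \<Rightarrow> (int ^ 'd \<Rightarrow> 'a) \<Rightarrow> (int ^ 'd) set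
      \<Rightarrow> (real \<Rightarrow> real ^ 'd) \<Rightarrow> (int ^ 'd \<Rightarrow> (int ^ 'd \<Rightarrow> 'a) \<Rightarrow> 'g)
      \<Rightarrow> (int ^ 'd \<Rightarrow> 'a) \<Rightarrow> (nat \<Rightarrow> real \<Rightarrow> (real \<Rightarrow> real ^ 'd) set) \<Rightarrow> 'g" where
  "residue G A a Y \<omega> C x \<gamma> = (THE v. has_residue G A a Y \<omega> C \<gamma> x v)"

end

theory Submission
  imports Defs
begin

text \<open>Around a point of \<open>good_set A a s\<close> the configuration \<open>a\<close> agrees with some \<open>x \<in> A\<close> on a window of
  radius \<open>s\<close>, so the value of a cocycle along a trail is the product of the factors
  \<open>C (w - z) x\<^sub>z\<close> over the edges \<open>(z, w)\<close>. Applying \<open>\<Phi>\<close> to all the \<open>x\<^sub>z\<close> gives (a); cohomologous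
  cocycles have conjugate values on closed trails, and if \<open>a \<in> A\<close> the product telescopes to \<open>\<one>\<close>.
  Hence no pole survives once some \<open>\<Phi>\<^sup>t a\<close> lies in \<open>A\<close>, provided that the cocycle is, up to
  cohomology, a pullback (b) or an image of the fundamental cocycle (d, e).

  The residues in (c) and (d) exist because any loop in a union of unit cubes is homotopic to a trail
  (round the coordinates down), and because the factors \<open>C (w - z) x\<^sub>z\<close> are defined for all nearby
  \<open>z, w\<close> and form a flat connection, whose holonomy is invariant under free homotopy up to
  conjugation.\<close>


section \<open>Admissible windows\<close>

text \<open>The obstacle is that the witnesses in \<open>A\<close> chosen at neighbouring points are
  unrelated. They can be compared only after the window has shrunk by the length of the move, and
  each application of \<open>\<Phi>\<close> shrinks it by another \<open>R\<close>. So statements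
  are made for all closed trails in a good set of large radius, with thresholds that are sums of the
  radii involved.

  The configuration \<open>(\<Phi> ^^ t) a\<close> is not assumed to have a unique projective
  component or a base ray, so its proper fundamental group is never formed. To carry a contradiction
  back from \<open>(\<Phi> ^^ t) a\<close> to \<open>a\<close>, vanishing is tested on every closed
  trail in a good set, which involves neither \<open>Y\<close> nor \<open>\<omega>\<close>. Residues
  enter only at the end, over the fundamental group of \<open>a\<close> itself. In a nonabelian
  group they are conjugacy classes, but being \<open>\<one>\<close> is invariant under conjugation,
  and nothing more is needed for (b) and (e).

  The flat connection is obtained by rounding points to the lattice and is not continuous. Homotopy
  invariance rests only on its composition law at distances up to 1.\<close>

lemma box_ball_iff: "v \<in> box_ball r \<longleftrightarrow> (\<forall>i. \<bar>v $ i\<bar> \<le> int r)"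
  by (simp add: box_ball_def)

lemma box_ball_mono: "r \<le> s \<Longrightarrow> box_ball r \<subseteq> box_ball s"
  unfolding box_ball_def by (auto intro: order_trans)

lemma box_ball_add: "u \<in> box_ball r \<Longrightarrow> v \<in> box_ball s \<Longrightarrow> u + v \<in> box_ball (r + s)"
  unfolding box_ball_iff
  by (metis abs_triangle_ineq add_mono of_nat_add order_trans vector_add_component)

lemma finite_box_ball: "finite (box_ball r :: (int ^ 'd) set)"
proof -
  let ?F = "UNIV \<rightarrow>\<^sub>E {-int r..int r} :: ('d \<Rightarrow> int) set"
  have "(box_ball r :: (int ^ 'd) set) \<subseteq> vec_lambda ` ?F"
  proof
    fix v :: "int ^ 'd" assume "v \<in> box_ball r"
    then have "vec_nth v \<in> ?F" by (auto simp: box_ball_iff abs_le_iff minus_le_iff)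
    then show "v \<in> vec_lambda ` ?F" by (metis imageI vec_nth_inverse)
  qed
  moreover have "finite ?F" by (intro finite_PiE) auto
  ultimately show ?thesis by (meson finite_imageI finite_subset)
qed

lemma steps_subset_box_ball: "steps \<subseteq> (box_ball 1 :: (int ^ 'd) set)"
  by (auto simp: steps_def box_ball_iff axis_def)

lemma pattern_eq_iff: "pattern x w r = pattern a z r \<longleftrightarrow> (\<forall>v\<in>box_ball r. x (w + v) = a (z + v))"
  by (auto simp: pattern_def fun_eq_iff)

text \<open>The witness \<open>x\<close> is recentred at the origin, because a local rule reads the
  window of a configuration around \<open>0\<close>.\<close>

definition matches ::
    "(int ^ 'd \<Rightarrow> 'a) set \<Rightarrow> (int ^ 'd \<Rightarrow> 'a) \<Rightarrow> nat \<Rightarrow> int ^ 'd \<Rightarrow> (int ^ 'd \<Rightarrow> 'a) \<Rightarrow> bool" where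
  "matches A a s z x \<longleftrightarrow> x \<in> A \<and> (\<forall>v\<in>box_ball s. x v = a (z + v))"

text \<open>For maps into a discrete space, having some such \<open>s\<close> amounts to continuity
  on \<open>A\<close>; see \<open>continuous_map_iff_window\<close>.\<close>

definition window :: "(int ^ 'd \<Rightarrow> 'a) set \<Rightarrow> nat \<Rightarrow> ((int ^ 'd \<Rightarrow> 'a) \<Rightarrow> 'g) \<Rightarrow> bool" where
  "window A s f \<longleftrightarrow> (\<forall>x\<in>A. \<forall>y\<in>A. (\<forall>v\<in>box_ball s. x v = y v) \<longrightarrow> f x = f y)"

lemma matches_in: "matches A a s z x \<Longrightarrow> x \<in> A"
  by (simp add: matches_def)

lemma matches_mono: "matches A a s z x \<Longrightarrow> r \<le> s \<Longrightarrow> matches A a r z x"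
  using box_ball_mono by (auto simp: matches_def)

lemma matches_pattern: "matches A a s z x \<longleftrightarrow> x \<in> A \<and> pattern a z s = pattern x 0 s"
  by (force simp: matches_def pattern_eq_iff)

lemma windowD:
  "window A s f \<Longrightarrow> x \<in> A \<Longrightarrow> y \<in> A \<Longrightarrow> (\<And>v. v \<in> box_ball s \<Longrightarrow> x v = y v) \<Longrightarrow> f x = f y"
  unfolding window_def by blast

lemma window_mono: "window A r f \<Longrightarrow> r \<le> s \<Longrightarrow> window A s f"
  using box_ball_mono [of r s] unfolding window_def by blast

lemma window_matches: "window A s f \<Longrightarrow> matches A a s z x \<Longrightarrow> matches A a s z y \<Longrightarrow> f x = f y"
  by (simp add: window_def matches_def)

text \<open>Moving the centre by \<open>u\<close> costs \<open>k\<close> in the radius. This is how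
  witnesses at neighbouring points are compared later.\<close>

lemma matches_shift:
  assumes "subshift A" "matches A a (s + k) z x" "u \<in> box_ball k"
  shows "matches A a s (z + u) (shift u x)"
proof -
  have "x (v + u) = a (z + u + v)" if "v \<in> box_ball s" for v
    using box_ball_add [OF that assms(3)] assms(2) by (simp add: matches_def ac_simps)
  then show ?thesis using assms(1,2) by (simp add: matches_def subshift_def shift_def)
qed

lemma matches_self: "subshift A \<Longrightarrow> a \<in> A \<Longrightarrow> matches A a s z (shift z a)"
  by (auto simp: matches_def subshift_def shift_def add.commute [of z])

text \<open>The supremum is at least \<open>s\<close> only if some member is: otherwise
  \<open>s - 1\<close> would be an upper bound, and it is smaller than \<open>s\<close>. At
  \<open>s = 0\<close> the equivalence can fail, since a letter that does not occur in
  \<open>A\<close> has value 0 as well, and so lies in \<open>good_set A a 0\<close> without a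
  witness.\<close>

lemma good_set_iff:
  assumes "s > 0"
  shows "z \<in> good_set A a s \<longleftrightarrow> (\<exists>x. matches A a s z x)"
proof
  assume "z \<in> good_set A a s"
  then have le: "enat s \<le> Sup {enat r | r. pattern a z r \<in> admissible A r}"
    by (simp add: good_set_def admissibility_def)
  have "\<exists>r\<ge>s. pattern a z r \<in> admissible A r"
  proof (rule ccontr)
    assume "\<not> ?thesis"
    then have "r \<le> s - 1" if "pattern a z r \<in> admissible A r" for r
      using that \<open>\<not> (\<exists>r\<ge>s. pattern a z r \<in> admissible A r)\<close> by (cases "s \<le> r") auto
    then have "Sup {enat r | r. pattern a z r \<in> admissible A r} \<le> enat (s - 1)"
      by (intro Sup_least) auto
    with le have "enat s \<le> enat (s - 1)" by (rule order_trans)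
    with assms show False by simp
  qed
  then obtain r x where "r \<ge> s" "x \<in> A" "pattern a z r = pattern x 0 r"
    by (auto simp: admissible_def)
  then show "\<exists>x. matches A a s z x"
    using matches_mono matches_pattern by metis
next
  assume "\<exists>x. matches A a s z x"
  then have "pattern a z s \<in> admissible A s"
    by (auto simp: admissible_def matches_pattern)
  then show "z \<in> good_set A a s"
    by (auto simp: good_set_def admissibility_def intro!: Sup_upper)
qed

lemma good_set_mono: "r \<le> s \<Longrightarrow> good_set A a s \<subseteq> good_set A a r"
  by (auto simp: good_set_def) (meson enat_ord_simps(1) order_trans)

lemma tilde_iff: "a \<in> tilde A \<longleftrightarrow> (\<forall>s>0. good_set A a s \<noteq> {})"
proof
  assume "a \<in> tilde A"
  then have sup: "(SUP z. admissibility A a z) = \<infinity>" by (simp add: tilde_def)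
  show "\<forall>s>0. good_set A a s \<noteq> {}"
  proof (intro allI impI notI)
    fix s :: nat assume "good_set A a s = {}"
    then have "admissibility A a z \<le> enat s" for z
      by (auto simp: good_set_def not_le intro: less_imp_le)
    then have "(SUP z. admissibility A a z) \<le> enat s" by (intro SUP_least)
    with sup show False by simp
  qed
next
  assume good: "\<forall>s>0. good_set A a s \<noteq> {}"
  have "enat s \<le> (SUP z. admissibility A a z)" if "s > 0" for s
  proof -
    have "good_set A a s \<noteq> {}" using good that by simp
    then obtain z where "z \<in> good_set A a s" by auto
    then have "enat s \<le> admissibility A a z" by (simp add: good_set_def)
    also have "\<dots> \<le> (SUP z. admissibility A a z)" by (rule SUP_upper) simp
    finally show ?thesis .
  qed
  then have le: "enat (Suc n) \<le> (SUP z. admissibility A a z)" for n by blast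
  have "(SUP z. admissibility A a z) = \<infinity>"
  proof (cases "SUP z. admissibility A a z")
    case (enat n)
    with le [of n] show ?thesis by simp
  qed simp
  then show "a \<in> tilde A" by (simp add: tilde_def)
qed

text \<open>On \<open>box_ball s\<close> the image \<open>\<Phi> x\<close> reads \<open>x\<close>
  only on \<open>box_ball (R + s)\<close>, so the image of a witness for \<open>a\<close> is a
  witness for \<open>\<Phi> a\<close>.\<close>

lemma matches_image:
  assumes "cellular_automaton \<Phi>" "has_radius \<Phi> R" "\<Phi> ` A \<subseteq> A" "matches A a (R + s) z x"
  shows "matches A (\<Phi> a) s z (\<Phi> x)"
proof -
  obtain f where f: "\<And>a z. \<Phi> a z = f (pattern a z R)"
    using assms(2) by (auto simp: has_radius_def)
  have "\<Phi> x v = \<Phi> a (z + v)" if "v \<in> box_ball s" for v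
  proof -
    have "x (v + w) = a (z + v + w)" if "w \<in> box_ball R" for w
      using box_ball_add [OF that \<open>v \<in> box_ball s\<close>] assms(4)
      by (simp add: matches_def ac_simps)
    then have "pattern x v R = pattern a (z + v) R" by (simp add: pattern_eq_iff)
    then show ?thesis by (simp add: f)
  qed
  then show ?thesis using assms(3,4) by (auto simp: matches_def)
qed

lemma good_set_image:
  assumes "cellular_automaton \<Phi>" "has_radius \<Phi> R" "\<Phi> ` A \<subseteq> A" "s > 0"
  shows "good_set A a (R + s) \<subseteq> good_set A (\<Phi> a) s"
  using matches_image [OF assms(1-3)] assms(4) by (fastforce simp: good_set_iff)

lemma tilde_image:
  assumes "cellular_automaton \<Phi>" "has_radius \<Phi> R" "\<Phi> ` A \<subseteq> A" "a \<in> tilde A"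
  shows "\<Phi> a \<in> tilde A"
  unfolding tilde_iff
proof (intro allI impI)
  fix s :: nat assume "s > 0"
  then have "good_set A a (R + s) \<noteq> {}" using assms(4) by (simp add: tilde_iff)
  then show "good_set A (\<Phi> a) s \<noteq> {}" using good_set_image [OF assms(1-3) \<open>s > 0\<close>, of a] by blast
qed

lemma tilde_funpow:
  assumes "cellular_automaton \<Phi>" "has_radius \<Phi> R" "\<Phi> ` A \<subseteq> A" "a \<in> tilde A"
  shows "(\<Phi> ^^ t) a \<in> tilde A"
  using assms by (induction t) (auto intro: tilde_image)

section \<open>Continuity as dependence on a finite window\<close>

lemma topspace_config [simp]: "topspace config_topology = UNIV"
  by (simp add: config_topology_def)

lemma openin_agree: "openin config_topology {x. \<forall>v\<in>box_ball s. x v = a v}"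
proof -
  let ?X = "\<lambda>v. if v \<in> box_ball s then {a v} else UNIV"
  have "{v. ?X v \<noteq> UNIV} \<subseteq> box_ball s" by auto
  then have fin: "finite {v. ?X v \<noteq> UNIV}"
    using finite_box_ball finite_subset by blast
  have "openin config_topology (\<Pi>\<^sub>E v\<in>UNIV. ?X v)"
    unfolding config_topology_def
    by (rule product_topology_basis) (use fin in auto)
  moreover have "(\<Pi>\<^sub>E v\<in>UNIV. ?X v) = {x. \<forall>v\<in>box_ball s. x v = a v}"
    by (auto simp: PiE_iff split: if_splits)
  ultimately show ?thesis by simp
qed

lemma agree_subset_open:
  assumes "openin config_topology U" "a \<in> U"
  shows "\<exists>s. {x. \<forall>v\<in>box_ball s. x v = a v} \<subseteq> U"
proof -
  obtain X where X: "a \<in> (\<Pi>\<^sub>E v\<in>UNIV. X v)" "finite {v. X v \<noteq> UNIV}" "(\<Pi>\<^sub>E v\<in>UNIV. X v) \<subseteq> U"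
    using product_topology_open_contains_basis [OF assms(1) [unfolded config_topology_def] assms(2)]
    by auto
  \<comment> \<open>A crude radius for the finitely many positions that \<open>X\<close> constrains:
    the sum of all absolute values of their coordinates dominates each one.\<close>
  define s where "s = (\<Sum>v\<in>{v. X v \<noteq> UNIV}. \<Sum>i\<in>UNIV. nat \<bar>v $ i\<bar>)"
  have "v \<in> box_ball s" if "X v \<noteq> UNIV" for v
    unfolding box_ball_iff
  proof
    fix i
    have "nat \<bar>v $ i\<bar> \<le> (\<Sum>i\<in>UNIV. nat \<bar>v $ i\<bar>)" by (rule member_le_sum) auto
    also have "\<dots> \<le> s" unfolding s_def using X(2) that
      by (intro member_le_sum [where f = "\<lambda>v. \<Sum>i\<in>UNIV. nat \<bar>v $ i\<bar>"]) auto
    finally show "\<bar>v $ i\<bar> \<le> int s" by simp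
  qed
  then have "{x. \<forall>v\<in>box_ball s. x v = a v} \<subseteq> (\<Pi>\<^sub>E v\<in>UNIV. X v)"
    using X(1) by (fastforce simp: PiE_iff)
  with X(3) show ?thesis by blast
qed

lemma compact_config: "compact_space (config_topology :: (int ^ 'd \<Rightarrow> 'a::finite) topology)"
  by (simp add: config_topology_def compact_space_product_topology compact_space_discrete_topology)

text \<open>Continuity gives each point of \<open>A\<close> a window of its own. Compactness of
  \<open>A\<close> leaves finitely many of these cylinders, and the largest of their radii serves
  everywhere.\<close>

lemma continuous_map_iff_window:
  fixes A :: "(int ^ 'd \<Rightarrow> 'a::finite) set"
  assumes "subshift A"
  shows "continuous_map (subtopology config_topology A) (discrete_topology U) f \<longleftrightarrow>
    f \<in> A \<rightarrow> U \<and> (\<exists>s. window A s f)" (is "?L \<longleftrightarrow> ?R")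
proof
  assume L: ?L
  then have fU: "f \<in> A \<rightarrow> U"
    by (auto simp: continuous_map_def Pi_iff)
  have "\<exists>s. \<forall>y\<in>A. (\<forall>v\<in>box_ball s. y v = x v) \<longrightarrow> f y = f x" if "x \<in> A" for x
  proof -
    have "openin (subtopology config_topology A) {y \<in> topspace (subtopology config_topology A). f y \<in> {f x}}"
      using L fU that by (intro openin_continuous_map_preimage [OF L]) auto
    then obtain V where V: "openin config_topology V" "{y \<in> A. f y = f x} = V \<inter> A"
      by (auto simp: openin_subtopology)
    then have "x \<in> V" using that by auto
    from agree_subset_open [OF V(1) this] V(2) show ?thesis by blast
  qed
  then obtain s where s: "\<And>x y. x \<in> A \<Longrightarrow> y \<in> A \<Longrightarrow> (\<forall>v\<in>box_ball (s x). y v = x v) \<Longrightarrow> f y = f x"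
    by metis
  let ?N = "\<lambda>x. {y. \<forall>v\<in>box_ball (s x). y v = x v}"
  have "compactin config_topology A"
    using assms closedin_compact_space [OF compact_config] by (auto simp: subshift_def)
  moreover have "Ball (?N ` A) (openin config_topology)" using openin_agree by blast
  moreover have "A \<subseteq> \<Union> (?N ` A)" by auto
  ultimately obtain \<F> where \<F>: "finite \<F>" "\<F> \<subseteq> ?N ` A" "A \<subseteq> \<Union>\<F>"
    unfolding compactin_def by meson
  obtain B where B: "B \<subseteq> A" "finite B" "\<F> = ?N ` B"
    using finite_subset_image [OF \<F>(1,2)] by blast
  \<comment> \<open>The extra \<open>0\<close> keeps \<open>Max\<close> meaningful when
    \<open>A\<close>, and hence \<open>B\<close>, is empty.\<close>
  define m where "m = Max (insert 0 (s ` B))"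
  have "window A m f"
    unfolding window_def
  proof (intro ballI impI)
    fix x y assume xy: "x \<in> A" "y \<in> A" "\<forall>v\<in>box_ball m. x v = y v"
    have "x \<in> \<Union>\<F>" using \<F>(3) xy(1) by (rule subsetD)
    then obtain w where w: "w \<in> B" "x \<in> ?N w" unfolding B(3) by auto
    have "s w \<le> m" using B(2) w(1) by (simp add: m_def)
    then have "y \<in> ?N w" using w(2) xy(3) box_ball_mono by fastforce
    have "f x = f w" using s [of w x] w B(1) xy(1) by auto
    moreover have "f y = f w" using s [of w y] w(1) B(1) xy(2) \<open>y \<in> ?N w\<close> by auto
    ultimately show "f x = f y" by simp
  qed
  with fU show ?R by blast
next
  assume ?R
  then obtain s where fU: "f \<in> A \<rightarrow> U" and s: "window A s f" by blast
  have "openin (subtopology config_topology A) {x \<in> A. f x \<in> V}" for V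
  proof -
    let ?W = "\<Union>x\<in>{x \<in> A. f x \<in> V}. {y. \<forall>v\<in>box_ball s. y v = x v}"
    have "f y \<in> V" if "y \<in> A" "x \<in> A" "f x \<in> V" "\<forall>v\<in>box_ball s. y v = x v" for x y
      using s that unfolding window_def by metis
    then have "{x \<in> A. f x \<in> V} = ?W \<inter> A" by auto
    moreover have "openin config_topology ?W"
      using openin_agree by (intro openin_Union) blast
    ultimately show ?thesis by (auto simp: openin_subtopology)
  qed
  with fU show ?L by (auto simp: continuous_map_def)
qed

lemma continuous_map_prod_discrete:
  fixes C :: "'c \<Rightarrow> 'b \<Rightarrow> 'g"
  shows "continuous_map (prod_topology (discrete_topology UNIV) X) Y (\<lambda>(z, a). C z a) \<longleftrightarrow>
    (\<forall>z. continuous_map X Y (C z))" (is "?L \<longleftrightarrow> ?R")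
proof
  assume L: ?L
  show ?R
  proof
    fix z :: 'c
    have "continuous_map X (prod_topology (discrete_topology UNIV) X) (\<lambda>a. (z, a))"
      by (simp add: continuous_map_pairwise o_def)
    from continuous_map_compose [OF this L] show "continuous_map X Y (C z)"
      by (simp add: o_def)
  qed
next
  assume R: ?R
  have "openin (prod_topology (discrete_topology UNIV) X)
      {p \<in> UNIV \<times> topspace X. (case p of (z, a) \<Rightarrow> C z a) \<in> U}" if "openin Y U" for U
  proof -
    have "openin (prod_topology (discrete_topology UNIV) X) (\<Union>z. {z} \<times> {a \<in> topspace X. C z a \<in> U})"
      using R that by (intro openin_Union) (auto simp: openin_prod_Times_iff intro!: openin_continuous_map_preimage)
    moreover have "(\<Union>z. {z} \<times> {a \<in> topspace X. C z a \<in> U}) =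
        {p \<in> UNIV \<times> topspace X. (case p of (z, a) \<Rightarrow> C z a) \<in> U}" by auto
    ultimately show ?thesis by simp
  qed
  with R show ?L by (fastforce simp: continuous_map_def)
qed

lemma cocycle_iff:
  fixes A :: "(int ^ 'd \<Rightarrow> 'a::finite) set"
  assumes "subshift A"
  shows "cocycle G A C \<longleftrightarrow>
    (\<forall>z. \<forall>a\<in>A. C z a \<in> carrier G) \<and> (\<forall>z. \<exists>s. window A s (C z)) \<and>
    (\<forall>y z. \<forall>a\<in>A. C (y + z) a = C y (shift z a) \<otimes>\<^bsub>G\<^esub> C z a)"
  unfolding cocycle_def continuous_map_prod_discrete continuous_map_iff_window [OF assms]
  by (auto simp: Pi_iff)

lemma cohomologous_iff:
  fixes A :: "(int ^ 'd \<Rightarrow> 'a::finite) set"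
  assumes "subshift A"
  shows "cohomologous G A C C' \<longleftrightarrow>
    (\<exists>b s. (\<forall>a\<in>A. b a \<in> carrier G) \<and> window A s b \<and>
      (\<forall>z. \<forall>a\<in>A. C' z a = b (shift z a) \<otimes>\<^bsub>G\<^esub> C z a \<otimes>\<^bsub>G\<^esub> inv\<^bsub>G\<^esub> (b a)))"
  unfolding cohomologous_def continuous_map_iff_window [OF assms]
  by (auto simp: Pi_iff)

lemma shift_in: "subshift A \<Longrightarrow> a \<in> A \<Longrightarrow> shift v a \<in> A"
  by (simp add: subshift_def)

lemma window_combine:
  assumes "window A s f" "window A t g"
  shows "window A (max s t) (\<lambda>a. h (f a) (g a))"
  unfolding window_def
proof (intro ballI impI)
  fix x y assume xy: "x \<in> A" "y \<in> A" "\<forall>v\<in>box_ball (max s t). x v = y v"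
  have "f x = f y" by (rule windowD [OF window_mono [OF assms(1) max.cobounded1]]) (use xy in auto)
  moreover have "g x = g y"
    by (rule windowD [OF window_mono [OF assms(2) max.cobounded2]]) (use xy in auto)
  ultimately show "h (f x) (g x) = h (f y) (g y)" by simp
qed

lemma locally_determined_iff_window:
  fixes C :: "int ^ 'd \<Rightarrow> (int ^ 'd \<Rightarrow> 'a) \<Rightarrow> 'g"
  shows "locally_determined A r C \<longleftrightarrow> (\<forall>e\<in>steps. window A r (C e))" (is "?L \<longleftrightarrow> ?R")
proof
  assume ?L
  then obtain c where c: "\<And>e x. e \<in> steps \<Longrightarrow> x \<in> A \<Longrightarrow> C e x = c e (pattern x 0 r)"
    by (auto simp: locally_determined_def is_local_rule_def)
  show ?R
    unfolding window_def
  proof (intro ballI impI)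
    fix e :: "int ^ 'd" and x y
    assume "e \<in> steps" "x \<in> A" "y \<in> A" "\<forall>v\<in>box_ball r. x v = y v"
    moreover from this have "pattern x 0 r = pattern y 0 r" by (simp add: pattern_eq_iff)
    ultimately show "C e x = C e y" by (simp add: c)
  qed
next
  assume R: ?R
  \<comment> \<open>On an admissible pattern any representative gives the same value, by the window
    bound; on other patterns the value is arbitrary and never read.\<close>
  define c where "c = (\<lambda>e p. C e (SOME x. x \<in> A \<and> pattern x 0 r = p))"
  have "C e x = c e (pattern x 0 r)" if "e \<in> steps" "x \<in> A" for e x
  proof -
    let ?y = "SOME y. y \<in> A \<and> pattern y 0 r = pattern x 0 r"
    have "?y \<in> A \<and> pattern ?y 0 r = pattern x 0 r"
      by (rule someI [of _ x]) (simp add: that)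
    then have "\<forall>v\<in>box_ball r. x v = ?y v" "?y \<in> A"
      by (simp_all add: pattern_eq_iff)
    then show ?thesis
      unfolding c_def using windowD [of A r "C e" x ?y] R that by blast
  qed
  then show ?L unfolding locally_determined_def is_local_rule_def by blast
qed

text \<open>The radius is uniform over a whole box and not only over \<open>steps\<close>: in the
  homotopy argument two nearby points may round to lattice points that differ diagonally.\<close>

lemma cocycle_locally_determined:
  fixes A :: "(int ^ 'd \<Rightarrow> 'a::finite) set"
  assumes "subshift A" "cocycle G A C"
  shows "\<exists>r. \<forall>z\<in>box_ball k. window A r (C z)"
proof -
  obtain s where s: "\<And>z. window A (s z) (C z)"
    using assms by (auto simp: cocycle_iff choice_iff)
  have "window A (Max (s ` box_ball k)) (C z)" if "z \<in> box_ball k" for z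
    by (rule window_mono [OF s]) (simp add: that finite_box_ball)
  then show ?thesis by blast
qed

section \<open>Products along trails\<close>

text \<open>Later edges stand on the left, as in \<open>rule_value\<close>. Labels that depend on
  both ends of an edge cover local rules, cocycle factors and connections alike.\<close>

fun path_prod :: "('g, 'm) monoid_scheme \<Rightarrow> ('p \<Rightarrow> 'p \<Rightarrow> 'g) \<Rightarrow> 'p list \<Rightarrow> 'g" where
  "path_prod G T (z # w # \<zeta>) = path_prod G T (w # \<zeta>) \<otimes>\<^bsub>G\<^esub> T z w"
| "path_prod G T _ = \<one>\<^bsub>G\<^esub>"

lemma path_prod_closed:
  assumes "monoid G" "successively (\<lambda>z w. T z w \<in> carrier G) \<zeta>"
  shows "path_prod G T \<zeta> \<in> carrier G"
  using assms(2)
  by (induction \<zeta> rule: induct_list012)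
     (simp_all add: monoid.m_closed [OF assms(1)] monoid.one_closed [OF assms(1)])

lemma path_prod_cong:
  "successively (\<lambda>z w. T z w = T' z w) \<zeta> \<Longrightarrow> path_prod G T \<zeta> = path_prod G T' \<zeta>"
  by (induction G T \<zeta> rule: path_prod.induct) simp_all

text \<open>The inner factors \<open>\<beta> w\<close> cancel in pairs and only the two ends
  survive. With \<open>T\<close> constantly \<open>\<one>\<close> this is telescoping; on a closed
  trail it is conjugation.\<close>

lemma path_prod_gauge:
  fixes G (structure)
  assumes "group G" "\<zeta> \<noteq> []" "\<And>z. z \<in> set \<zeta> \<Longrightarrow> \<beta> z \<in> carrier G"
    and "successively (\<lambda>z w. T z w \<in> carrier G \<and> T' z w = \<beta> w \<otimes>\<^bsub>G\<^esub> T z w \<otimes>\<^bsub>G\<^esub> inv\<^bsub>G\<^esub> (\<beta> z)) \<zeta>"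
  shows "path_prod G T' \<zeta> = \<beta> (last \<zeta>) \<otimes>\<^bsub>G\<^esub> path_prod G T \<zeta> \<otimes>\<^bsub>G\<^esub> inv\<^bsub>G\<^esub> (\<beta> (hd \<zeta>))"
proof -
  interpret group G by fact
  show ?thesis using assms(2-)
  proof (induction \<zeta> rule: induct_list012)
    case (3 z w \<zeta>)
    let ?l = "\<beta> (last (w # \<zeta>))" and ?p = "path_prod G T (w # \<zeta>)"
    have IH: "path_prod G T' (w # \<zeta>) = ?l \<otimes> ?p \<otimes> inv (\<beta> w)"
      using "3.IH"(2) "3.prems" by simp
    have "successively (\<lambda>z w. T z w \<in> carrier G) (w # \<zeta>)"
      using "3.prems"(3) by (auto intro: successively_mono)
    then have p: "?p \<in> carrier G" by (intro path_prod_closed) (simp_all add: is_monoid)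
    have c: "\<beta> z \<in> carrier G" "\<beta> w \<in> carrier G" "?l \<in> carrier G" "T z w \<in> carrier G"
      using "3.prems" by simp_all
    have cancel: "inv (\<beta> w) \<otimes> (\<beta> w \<otimes> x) = x" if "x \<in> carrier G" for x
      using c that by (simp add: m_assoc [symmetric])
    have "path_prod G T' (z # w # \<zeta>) =
        (?l \<otimes> ?p \<otimes> inv (\<beta> w)) \<otimes> (\<beta> w \<otimes> T z w \<otimes> inv (\<beta> z))"
      using IH "3.prems"(3) by simp
    also have "\<dots> = ?l \<otimes> (?p \<otimes> T z w) \<otimes> inv (\<beta> z)"
      using c p by (simp add: m_assoc cancel)
    finally show ?case by simp
  qed simp_all
qed

lemma path_prod_hom:
  assumes "group G" "group H" "\<phi> \<in> hom G H" "successively (\<lambda>z w. T z w \<in> carrier G) \<zeta>"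
  shows "path_prod H (\<lambda>z w. \<phi> (T z w)) \<zeta> = \<phi> (path_prod G T \<zeta>)"
proof -
  interpret group_hom G H \<phi>
    using assms by (simp add: group_hom_def group_hom_axioms_def)
  show ?thesis using assms(4)
  proof (induction \<zeta> rule: induct_list012)
    case (3 z w \<zeta>)
    then have "path_prod G T (w # \<zeta>) \<in> carrier G"
      by (intro path_prod_closed) (simp_all add: G.is_monoid)
    with 3 show ?case by simp
  qed simp_all
qed

lemma path_prod_mult:
  assumes "comm_group G" "successively (\<lambda>z w. T z w \<in> carrier G \<and> T' z w \<in> carrier G) \<zeta>"
  shows "path_prod G (\<lambda>z w. T z w \<otimes>\<^bsub>G\<^esub> T' z w) \<zeta> = path_prod G T \<zeta> \<otimes>\<^bsub>G\<^esub> path_prod G T' \<zeta>"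
proof -
  interpret comm_group G by fact
  show ?thesis using assms(2)
  proof (induction \<zeta> rule: induct_list012)
    case (3 z w \<zeta>)
    have "successively (\<lambda>z w. T z w \<in> carrier G) (w # \<zeta>)"
      "successively (\<lambda>z w. T' z w \<in> carrier G) (w # \<zeta>)"
      using "3.prems" by (auto intro: successively_mono)
    then have "path_prod G T (w # \<zeta>) \<in> carrier G" "path_prod G T' (w # \<zeta>) \<in> carrier G"
      by (simp_all add: path_prod_closed is_monoid)
    with 3 show ?case by (simp add: m_ac)
  qed simp_all
qed

section \<open>Values of cocycles along trails\<close>

lemma rule_value_eq_path_prod:
  "rule_value G r c \<zeta> x = path_prod G (\<lambda>z w. c (w - z) (pattern x z r)) \<zeta>"
  by (induction G r c \<zeta> x rule: rule_value.induct) simp_all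

lemma successively_trail:
  assumes "trail \<zeta>" "\<And>z w. z \<in> set \<zeta> \<Longrightarrow> w \<in> set \<zeta> \<Longrightarrow> w - z \<in> steps \<Longrightarrow> P z w"
  shows "successively P \<zeta>"
  using assms unfolding trail_def by (blast intro: successively_mono)

lemma closed_trail_in_mono: "closed_trail_in S \<zeta> \<Longrightarrow> S \<subseteq> T \<Longrightarrow> closed_trail_in T \<zeta>"
  by (auto simp: closed_trail_in_def)

lemma closed_trail_in_good_mono:
  "closed_trail_in (good_set A a s) \<zeta> \<Longrightarrow> r \<le> s \<Longrightarrow> closed_trail_in (good_set A a r) \<zeta>"
  by (rule closed_trail_in_mono [OF _ good_set_mono])

text \<open>An arbitrary choice at each point, with no coherence between points; agreement of
  neighbours has to come from \<open>matches_shift\<close> and a window bound.\<close>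

definition match_at :: "(int ^ 'd \<Rightarrow> 'a) set \<Rightarrow> (int ^ 'd \<Rightarrow> 'a) \<Rightarrow> nat \<Rightarrow> int ^ 'd \<Rightarrow> int ^ 'd \<Rightarrow> 'a" where
  "match_at A a s z = (SOME x. matches A a s z x)"

lemma matches_match_at: "0 < s \<Longrightarrow> z \<in> good_set A a s \<Longrightarrow> matches A a s z (match_at A a s z)"
  using someI_ex [of "matches A a s z"] by (simp add: good_set_iff match_at_def)

text \<open>The freedom in \<open>X\<close> is the point: the same value can be computed from
  \<open>match_at\<close>, from images of witnesses under \<open>\<Phi>\<close>, or from the shifts
  of \<open>a\<close> when \<open>a \<in> A\<close>.\<close>

lemma trail_value_matches:
  assumes "locally_determined A r C" "trail \<zeta>" "\<And>z. z \<in> set \<zeta> \<Longrightarrow> matches A a r z (X z)"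
  shows "trail_value G A r C \<zeta> a = path_prod G (\<lambda>z w. C (w - z) (X z)) \<zeta>"
  unfolding trail_value_def rule_value_eq_path_prod
proof (intro path_prod_cong successively_trail [OF assms(2)])
  fix z w assume zw: "z \<in> set \<zeta>" "w - z \<in> steps"
  have "is_local_rule A r C (local_rule A r C)"
    using assms(1) unfolding locally_determined_def local_rule_def by (rule someI_ex)
  moreover have "X z \<in> A" "pattern a z r = pattern (X z) 0 r"
    using assms(3) [OF zw(1)] by (simp_all add: matches_pattern)
  ultimately show "local_rule A r C (w - z) (pattern a z r) = C (w - z) (X z)"
    using zw(2) by (simp add: is_local_rule_def)
qed

lemma trail_value_match_at:
  assumes "locally_determined A r C" "trail \<zeta>" "set \<zeta> \<subseteq> good_set A a s" "r \<le> s" "0 < s"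
  shows "trail_value G A r C \<zeta> a = path_prod G (\<lambda>z w. C (w - z) (match_at A a s z)) \<zeta>"
proof (rule trail_value_matches [OF assms(1,2)])
  fix z assume "z \<in> set \<zeta>"
  then show "matches A a r z (match_at A a s z)"
    using assms(3-5) matches_match_at matches_mono by blast
qed

lemma trail_value_radius:
  assumes "locally_determined A r C" "locally_determined A r' C" "trail \<zeta>"
    "set \<zeta> \<subseteq> good_set A a s" "r \<le> s" "r' \<le> s" "0 < s"
  shows "trail_value G A r C \<zeta> a = trail_value G A r' C \<zeta> a"
  using assms by (simp add: trail_value_match_at)

lemma cocycle_in_carrier:
  fixes A :: "(int ^ 'd \<Rightarrow> 'a::finite) set"
  shows "subshift A \<Longrightarrow> cocycle G A C \<Longrightarrow> x \<in> A \<Longrightarrow> C z x \<in> carrier G"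
  by (simp add: cocycle_iff)

lemma successively_cocycle:
  fixes A :: "(int ^ 'd \<Rightarrow> 'a::finite) set"
  assumes "subshift A" "cocycle G A C" "trail \<zeta>" "\<And>z. z \<in> set \<zeta> \<Longrightarrow> X z \<in> A"
  shows "successively (\<lambda>z w. C (w - z) (X z) \<in> carrier G) \<zeta>"
  using assms by (intro successively_trail [OF assms(3)]) (simp add: cocycle_in_carrier)

lemma match_at_in:
  assumes "set \<zeta> \<subseteq> good_set A a s" "0 < s" "z \<in> set \<zeta>"
  shows "match_at A a s z \<in> A"
  using assms by (intro matches_in [OF matches_match_at]) auto

lemma trail_value_closed:
  fixes A :: "(int ^ 'd \<Rightarrow> 'a::finite) set"
  assumes "subshift A" "group G" "cocycle G A C" "locally_determined A r C" "trail \<zeta>"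
    "set \<zeta> \<subseteq> good_set A a s" "r \<le> s" "0 < s"
  shows "trail_value G A r C \<zeta> a \<in> carrier G"
  unfolding trail_value_match_at [OF assms(4-8)]
  by (rule path_prod_closed [OF group.is_monoid [OF assms(2)]
        successively_cocycle [OF assms(1,3,5) match_at_in [OF assms(6,8)]]])

lemma cocycle_shift:
  fixes A :: "(int ^ 'd \<Rightarrow> 'a::finite) set"
  assumes "subshift A" "cocycle G A C" "x \<in> A"
  shows "C (u + v) x = C u (shift v x) \<otimes>\<^bsub>G\<^esub> C v x"
  using assms by (simp add: cocycle_iff)

text \<open>The gauge at \<open>z\<close> is \<open>b\<close> of the witness there. At the far end
  of an edge the formula for \<open>C'\<close> produces \<open>b\<close> of the shifted witness of
  \<open>z\<close>, which equals \<open>b\<close> of the witness of \<open>w\<close> because both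
  match \<open>a\<close> around \<open>w\<close>. The threshold depends on neither \<open>a\<close>
  nor the trail.\<close>

lemma trail_value_cohomologous:
  fixes A :: "(int ^ 'd \<Rightarrow> 'a::finite) set"
  assumes "subshift A" "group G" "cocycle G A C" "cohomologous G A C C'"
    "locally_determined A r C" "locally_determined A r' C'"
  shows "\<exists>s0>0. \<forall>a \<zeta>. closed_trail_in (good_set A a s0) \<zeta> \<longrightarrow>
    (\<exists>g\<in>carrier G. trail_value G A r' C' \<zeta> a = g \<otimes>\<^bsub>G\<^esub> trail_value G A r C \<zeta> a \<otimes>\<^bsub>G\<^esub> inv\<^bsub>G\<^esub> g)"
proof -
  obtain b n where bc: "\<And>x. x \<in> A \<Longrightarrow> b x \<in> carrier G" and bw: "window A n b"
    and b: "\<And>z x. x \<in> A \<Longrightarrow> C' z x = b (shift z x) \<otimes>\<^bsub>G\<^esub> C z x \<otimes>\<^bsub>G\<^esub> inv\<^bsub>G\<^esub> (b x)"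
    using assms(4) unfolding cohomologous_iff [OF assms(1)] by blast
  \<comment> \<open>\<open>n\<close> is the window of \<open>b\<close>, \<open>1\<close> pays for
    one step, and \<open>r\<close> and \<open>r'\<close> let both local rules be evaluated at the
    same witnesses.\<close>
  define s where "s = n + r + r' + 1"
  have "\<exists>g\<in>carrier G. trail_value G A r' C' \<zeta> a = g \<otimes>\<^bsub>G\<^esub> trail_value G A r C \<zeta> a \<otimes>\<^bsub>G\<^esub> inv\<^bsub>G\<^esub> g"
    if closed: "closed_trail_in (good_set A a s) \<zeta>" for a \<zeta>
  proof -
    have tr: "trail \<zeta>" and sub: "set \<zeta> \<subseteq> good_set A a s" and hl: "last \<zeta> = hd \<zeta>" and ne: "\<zeta> \<noteq> []"
      using closed by (auto simp: closed_trail_in_def trail_def)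
    let ?X = "match_at A a s"
    have X: "matches A a s z (?X z)" if "z \<in> set \<zeta>" for z
      using that sub by (intro matches_match_at) (auto simp: s_def)
    have XA: "?X z \<in> A" if "z \<in> set \<zeta>" for z
      using X [OF that] by (rule matches_in)
    have bshift: "b (shift (w - z) (?X z)) = b (?X w)"
      if "z \<in> set \<zeta>" "w \<in> set \<zeta>" "w - z \<in> steps" for z w
    proof (rule window_matches [OF bw])
      have "matches A a (n + 1) z (?X z)" by (rule matches_mono [OF X [OF that(1)]]) (simp add: s_def)
      from matches_shift [OF assms(1) this, of "w - z"] that(3) steps_subset_box_ball
      show "matches A a n w (shift (w - z) (?X z))" by auto
      show "matches A a n w (?X w)" by (rule matches_mono [OF X [OF that(2)]]) (simp add: s_def)
    qed
    have "path_prod G (\<lambda>z w. C' (w - z) (?X z)) \<zeta> =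
       b (?X (last \<zeta>)) \<otimes>\<^bsub>G\<^esub> path_prod G (\<lambda>z w. C (w - z) (?X z)) \<zeta> \<otimes>\<^bsub>G\<^esub> inv\<^bsub>G\<^esub> (b (?X (hd \<zeta>)))"
    proof (rule path_prod_gauge [OF assms(2) ne])
      show "b (?X z) \<in> carrier G" if "z \<in> set \<zeta>" for z
        using bc XA [OF that] .
      show "successively (\<lambda>z w. C (w - z) (?X z) \<in> carrier G \<and> C' (w - z) (?X z) =
          b (?X w) \<otimes>\<^bsub>G\<^esub> C (w - z) (?X z) \<otimes>\<^bsub>G\<^esub> inv\<^bsub>G\<^esub> (b (?X z))) \<zeta>"
        by (rule successively_trail [OF tr])
           (simp add: b XA bshift cocycle_in_carrier [OF assms(1,3)])
    qed
    moreover have "trail_value G A r' C' \<zeta> a = path_prod G (\<lambda>z w. C' (w - z) (?X z)) \<zeta>"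
      by (rule trail_value_match_at [OF assms(6) tr sub]) (simp_all add: s_def)
    moreover have "trail_value G A r C \<zeta> a = path_prod G (\<lambda>z w. C (w - z) (?X z)) \<zeta>"
      by (rule trail_value_match_at [OF assms(5) tr sub]) (simp_all add: s_def)
    moreover have "b (?X (hd \<zeta>)) \<in> carrier G" using ne by (simp add: bc XA)
    ultimately show ?thesis using hl by auto
  qed
  then show ?thesis by (intro exI [of _ s]) (simp add: s_def)
qed

lemma trail_value_hom:
  fixes A :: "(int ^ 'd \<Rightarrow> 'a::finite) set"
  assumes "subshift A" "group G" "group H" "cocycle G A C" "\<phi> \<in> hom G H"
    "locally_determined A r C" "trail \<zeta>" "set \<zeta> \<subseteq> good_set A a s" "r \<le> s" "0 < s"
  shows "trail_value H A r (\<lambda>z x. \<phi> (C z x)) \<zeta> a = \<phi> (trail_value G A r C \<zeta> a)"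
proof -
  have "locally_determined A r (\<lambda>z x. \<phi> (C z x))"
    using assms(6) unfolding locally_determined_iff_window window_def by metis
  then have "trail_value H A r (\<lambda>z x. \<phi> (C z x)) \<zeta> a =
      path_prod H (\<lambda>z w. \<phi> (C (w - z) (match_at A a s z))) \<zeta>"
    by (rule trail_value_match_at [OF _ assms(7-10)])
  also have "\<dots> = \<phi> (path_prod G (\<lambda>z w. C (w - z) (match_at A a s z)) \<zeta>)"
    by (rule path_prod_hom [OF assms(2,3,5)
        successively_cocycle [OF assms(1,4,7) match_at_in [OF assms(8,10)]]])
  finally show ?thesis by (simp only: trail_value_match_at [OF assms(6-10)])
qed

lemma window_image:
  assumes "cellular_automaton \<Phi>" "has_radius \<Phi> R" "\<Phi> ` A \<subseteq> A" "window A s f"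
  shows "window A (R + s) (\<lambda>x. f (\<Phi> x))"
  unfolding window_def
proof (intro ballI impI)
  fix x y assume "x \<in> A" "y \<in> A" "\<forall>v\<in>box_ball (R + s). x v = y v"
  then have "matches A y (R + s) 0 x" "matches A y (R + s) 0 y"
    by (simp_all add: matches_def)
  then show "f (\<Phi> x) = f (\<Phi> y)"
    using window_matches [OF assms(4)] matches_image [OF assms(1-3)] by blast
qed

lemma window_cong: "(\<And>x. x \<in> A \<Longrightarrow> f x = g x) \<Longrightarrow> window A s f \<Longrightarrow> window A s g"
  unfolding window_def by metis

lemma locally_determined_pull:
  fixes A :: "(int ^ 'd \<Rightarrow> 'a) set"
  assumes "cellular_automaton \<Phi>" "has_radius \<Phi> R" "\<Phi> ` A \<subseteq> A" "locally_determined A r C"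
  shows "locally_determined A (R + r) (pull A \<Phi> C)"
  unfolding locally_determined_iff_window
proof
  fix e :: "int ^ 'd" assume "e \<in> steps"
  with assms(4) have "window A r (C e)" by (simp add: locally_determined_iff_window)
  from window_image [OF assms(1-3) this] show "window A (R + r) (pull A \<Phi> C e)"
    by (rule window_cong [rotated]) (simp add: pull_def)
qed

lemma trail_value_pull:
  assumes "cellular_automaton \<Phi>" "has_radius \<Phi> R" "\<Phi> ` A \<subseteq> A" "locally_determined A r C"
    "trail \<zeta>" "set \<zeta> \<subseteq> good_set A a (R + r)" "0 < r"
  shows "trail_value G A r C \<zeta> (\<Phi> a) = trail_value G A (R + r) (pull A \<Phi> C) \<zeta> a"
proof -
  let ?X = "match_at A a (R + r)"
  have X: "matches A a (R + r) z (?X z)" if "z \<in> set \<zeta>" for z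
    using that assms(6,7) by (intro matches_match_at) auto
  have "trail_value G A r C \<zeta> (\<Phi> a) = path_prod G (\<lambda>z w. C (w - z) (\<Phi> (?X z))) \<zeta>"
    by (rule trail_value_matches [OF assms(4,5)]) (rule matches_image [OF assms(1-3) X])
  also have "\<dots> = path_prod G (\<lambda>z w. pull A \<Phi> C (w - z) (?X z)) \<zeta>"
    by (intro path_prod_cong successively_trail [OF assms(5)])
       (simp add: pull_def matches_in [OF X])
  also have "\<dots> = trail_value G A (R + r) (pull A \<Phi> C) \<zeta> a"
    by (rule trail_value_matches [OF locally_determined_pull [OF assms(1-4)] assms(5) X, symmetric])
  finally show ?thesis .
qed

text \<open>When \<open>a \<in> A\<close>, the map \<open>z \<mapsto> C z a\<close> is a global
  potential: by the cocycle identity each factor is the quotient of its values at the ends of the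
  edge.\<close>

lemma trail_value_in_subshift:
  fixes A :: "(int ^ 'd \<Rightarrow> 'a::finite) set"
  assumes "subshift A" "group G" "cocycle G A C" "locally_determined A r C"
    "trail \<zeta>" "last \<zeta> = hd \<zeta>" "a \<in> A"
  shows "trail_value G A r C \<zeta> a = \<one>\<^bsub>G\<^esub>"
proof -
  interpret group G by fact
  have ne: "\<zeta> \<noteq> []" using assms(5) by (simp add: trail_def)
  have c: "C z a \<in> carrier G" for z by (rule cocycle_in_carrier [OF assms(1,3,7)])
  have "C (w - z) (shift z a) = C w a \<otimes>\<^bsub>G\<^esub> \<one>\<^bsub>G\<^esub> \<otimes>\<^bsub>G\<^esub> inv\<^bsub>G\<^esub> (C z a)" for z w
  proof -
    have "C w a = C (w - z) (shift z a) \<otimes>\<^bsub>G\<^esub> C z a"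
      using cocycle_shift [OF assms(1,3,7), of "w - z" z] by simp
    then show ?thesis
      using c cocycle_in_carrier [OF assms(1,3) shift_in [OF assms(1,7)]]
      by (simp add: m_assoc)
  qed
  then have "successively (\<lambda>z w. \<one>\<^bsub>G\<^esub> \<in> carrier G \<and>
      C (w - z) (shift z a) = C w a \<otimes>\<^bsub>G\<^esub> \<one>\<^bsub>G\<^esub> \<otimes>\<^bsub>G\<^esub> inv\<^bsub>G\<^esub> (C z a)) \<zeta>"
    by (intro successively_trail [OF assms(5)]) simp
  from path_prod_gauge [OF assms(2) ne c this]
  have "path_prod G (\<lambda>z w. C (w - z) (shift z a)) \<zeta> =
      C (last \<zeta>) a \<otimes>\<^bsub>G\<^esub> path_prod G (\<lambda>z w. \<one>\<^bsub>G\<^esub>) \<zeta> \<otimes>\<^bsub>G\<^esub> inv\<^bsub>G\<^esub> (C (hd \<zeta>) a)" .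
  moreover have "path_prod G (\<lambda>z w. \<one>\<^bsub>G\<^esub>) \<zeta> = \<one>\<^bsub>G\<^esub>"
    by (induction \<zeta> rule: induct_list012) simp_all
  ultimately have "path_prod G (\<lambda>z w. C (w - z) (shift z a)) \<zeta> = \<one>\<^bsub>G\<^esub>"
    using c by (simp add: assms(6))
  with trail_value_matches [OF assms(4,5) matches_self [OF assms(1,7)], of G] show ?thesis
    by simp
qed

text \<open>Here \<open>h\<close> itself is the potential. This is why passing to the quotient by
  trivial cocycles loses no residues.\<close>

lemma trail_value_hom_lattice:
  assumes "group G" "h \<in> hom lattice_group G" "locally_determined A r (\<lambda>z a. h z)"
    "trail \<zeta>" "last \<zeta> = hd \<zeta>" "set \<zeta> \<subseteq> good_set A a s" "r \<le> s" "0 < s"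
  shows "trail_value G A r (\<lambda>z a. h z) \<zeta> a = \<one>\<^bsub>G\<^esub>"
proof -
  interpret group G by fact
  have ne: "\<zeta> \<noteq> []" using assms(4) by (simp add: trail_def)
  have c: "h z \<in> carrier G" for z
    using assms(2) by (auto simp: hom_def lattice_group_def)
  have "h (w - z) = h w \<otimes>\<^bsub>G\<^esub> \<one>\<^bsub>G\<^esub> \<otimes>\<^bsub>G\<^esub> inv\<^bsub>G\<^esub> (h z)" for z w
  proof -
    have "h w = h (w - z) \<otimes>\<^bsub>G\<^esub> h z"
      using hom_mult [OF assms(2), of "w - z" z] by (simp add: lattice_group_def)
    then show ?thesis using c by (simp add: m_assoc)
  qed
  then have "successively (\<lambda>z w. \<one>\<^bsub>G\<^esub> \<in> carrier G \<and>
      h (w - z) = h w \<otimes>\<^bsub>G\<^esub> \<one>\<^bsub>G\<^esub> \<otimes>\<^bsub>G\<^esub> inv\<^bsub>G\<^esub> (h z)) \<zeta>"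
    by (intro successively_trail [OF assms(4)]) simp
  from path_prod_gauge [OF assms(1) ne c this]
  have "path_prod G (\<lambda>z w. h (w - z)) \<zeta> =
      h (last \<zeta>) \<otimes>\<^bsub>G\<^esub> path_prod G (\<lambda>z w. \<one>\<^bsub>G\<^esub>) \<zeta> \<otimes>\<^bsub>G\<^esub> inv\<^bsub>G\<^esub> (h (hd \<zeta>))" .
  moreover have "path_prod G (\<lambda>z w. \<one>\<^bsub>G\<^esub>) \<zeta> = \<one>\<^bsub>G\<^esub>"
    by (induction \<zeta> rule: induct_list012) simp_all
  ultimately show ?thesis
    using c by (simp add: assms(5) trail_value_match_at [OF assms(3,4,6-8)])
qed

lemma cocycle_radius:
  fixes A :: "(int ^ 'd \<Rightarrow> 'a::finite) set"
  assumes "subshift A" "cocycle G A C"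
  obtains r where "locally_determined A r C"
  using cocycle_locally_determined [OF assms, of 1] steps_subset_box_ball
  unfolding locally_determined_iff_window by blast

lemma locally_determined_mono: "locally_determined A r C \<Longrightarrow> r \<le> s \<Longrightarrow> locally_determined A s C"
  unfolding locally_determined_iff_window using window_mono by blast


section \<open>Cocycles without residues\<close>

text \<open>Quantifying over all closed trails of the good set, and not only over representatives of
  homotopy classes, removes \<open>Y\<close> and \<open>\<omega>\<close>. The condition thus makes
  sense for \<open>\<Phi> a\<close> without assumptions on its components.\<close>

definition eventually_flat ::
    "('g, 'm) monoid_scheme \<Rightarrow> (int ^ 'd \<Rightarrow> 'a) set
      \<Rightarrow> (int ^ 'd \<Rightarrow> (int ^ 'd \<Rightarrow> 'a) \<Rightarrow> 'g) \<Rightarrow> (int ^ 'd \<Rightarrow> 'a) \<Rightarrow> bool" where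
  "eventually_flat G A C a \<longleftrightarrow>
     (\<exists>s>0. locally_determined A s C \<and>
       (\<forall>\<zeta>. closed_trail_in (good_set A a s) \<zeta> \<longrightarrow> trail_value G A s C \<zeta> a = \<one>\<^bsub>G\<^esub>))"

lemma eventually_flatI:
  assumes "locally_determined A r C"
    "\<And>\<zeta>. closed_trail_in (good_set A a s) \<zeta> \<Longrightarrow> trail_value G A r C \<zeta> a = \<one>\<^bsub>G\<^esub>"
  shows "eventually_flat G A C a"
proof -
  \<comment> \<open>\<open>Suc\<close> makes the radius positive, so that points of the good set
    have witnesses.\<close>
  define n where "n = Suc (r + s)"
  have ld: "locally_determined A n C"
    by (rule locally_determined_mono [OF assms(1)]) (simp add: n_def)
  have "trail_value G A n C \<zeta> a = \<one>\<^bsub>G\<^esub>" if \<zeta>: "closed_trail_in (good_set A a n) \<zeta>" for \<zeta>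
  proof -
    have "trail_value G A n C \<zeta> a = trail_value G A r C \<zeta> a"
      using \<zeta> by (intro trail_value_radius [OF ld assms(1), of _ _ n])
        (auto simp: closed_trail_in_def n_def)
    also have "\<dots> = \<one>\<^bsub>G\<^esub>"
      by (rule assms(2) [OF closed_trail_in_good_mono [OF \<zeta>]]) (simp add: n_def)
    finally show ?thesis .
  qed
  with ld show ?thesis unfolding eventually_flat_def by (intro exI [of _ n]) (simp add: n_def)
qed

text \<open>The local rule may have any radius \<open>r\<close> for which \<open>C\<close> is
  locally determined, and the free bound \<open>m\<close> lets one \<open>s\<close> meet several
  thresholds at once.\<close>

lemma eventually_flatD:
  assumes "eventually_flat G A C a" "locally_determined A r C"
  obtains s where "s \<ge> m" "s \<ge> r" "s > 0"
    "\<And>\<zeta>. closed_trail_in (good_set A a s) \<zeta> \<Longrightarrow> trail_value G A r C \<zeta> a = \<one>\<^bsub>G\<^esub>"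
proof -
  obtain n where n: "n > 0" "locally_determined A n C"
    "\<And>\<zeta>. closed_trail_in (good_set A a n) \<zeta> \<Longrightarrow> trail_value G A n C \<zeta> a = \<one>\<^bsub>G\<^esub>"
    using assms(1) unfolding eventually_flat_def by blast
  define s where "s = m + n + r"
  have "trail_value G A r C \<zeta> a = \<one>\<^bsub>G\<^esub>" if \<zeta>: "closed_trail_in (good_set A a s) \<zeta>" for \<zeta>
  proof -
    have "trail_value G A r C \<zeta> a = trail_value G A n C \<zeta> a"
      using \<zeta> n(1) by (intro trail_value_radius [OF assms(2) n(2), of _ _ s])
        (auto simp: closed_trail_in_def s_def)
    also have "\<dots> = \<one>\<^bsub>G\<^esub>"
      by (rule n(3) [OF closed_trail_in_good_mono [OF \<zeta>]]) (simp add: s_def)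
    finally show ?thesis .
  qed
  then show thesis using that [of s] n(1) by (simp add: s_def)
qed

lemma eventually_flat_in_subshift:
  fixes A :: "(int ^ 'd \<Rightarrow> 'a::finite) set"
  assumes "subshift A" "group G" "cocycle G A C" "a \<in> A"
  shows "eventually_flat G A C a"
proof -
  obtain r where r: "locally_determined A r C" by (rule cocycle_radius [OF assms(1,3)])
  show ?thesis
    by (rule eventually_flatI [OF r])
       (auto simp: closed_trail_in_def intro: trail_value_in_subshift [OF assms(1-3) r _ _ assms(4)])
qed

lemma eventually_flat_cohomologous:
  fixes A :: "(int ^ 'd \<Rightarrow> 'a::finite) set"
  assumes "subshift A" "group G" "cocycle G A C" "cocycle G A C'" "cohomologous G A C C'"
    "eventually_flat G A C a"
  shows "eventually_flat G A C' a"
proof -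
  interpret group G by fact
  obtain r where r: "locally_determined A r C" by (rule cocycle_radius [OF assms(1,3)])
  obtain r' where r': "locally_determined A r' C'" by (rule cocycle_radius [OF assms(1,4)])
  obtain m where m: "\<And>a \<zeta>. closed_trail_in (good_set A a m) \<zeta> \<Longrightarrow>
    (\<exists>g\<in>carrier G. trail_value G A r' C' \<zeta> a = g \<otimes>\<^bsub>G\<^esub> trail_value G A r C \<zeta> a \<otimes>\<^bsub>G\<^esub> inv\<^bsub>G\<^esub> g)"
    using trail_value_cohomologous [OF assms(1,2,3,5) r r'] by blast
  obtain s where s: "s \<ge> m" "\<And>\<zeta>. closed_trail_in (good_set A a s) \<zeta> \<Longrightarrow> trail_value G A r C \<zeta> a = \<one>\<^bsub>G\<^esub>"
    by (rule eventually_flatD [OF assms(6) r, of m]) blast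
  show ?thesis
  proof (rule eventually_flatI [OF r'])
    fix \<zeta> assume \<zeta>: "closed_trail_in (good_set A a s) \<zeta>"
    from m [OF closed_trail_in_good_mono [OF \<zeta> s(1)]] s(2) [OF \<zeta>]
    show "trail_value G A r' C' \<zeta> a = \<one>\<^bsub>G\<^esub>" by auto
  qed
qed

lemma lattice_hom_cocycle:
  fixes A :: "(int ^ 'd \<Rightarrow> 'a::finite) set"
  assumes "subshift A" "h \<in> hom lattice_group G"
  shows "cocycle G A (\<lambda>z a. h z)"
  using assms(2) unfolding cocycle_iff [OF assms(1)]
  by (auto simp: hom_def lattice_group_def window_def)

lemma cohomologous_sym:
  fixes A :: "(int ^ 'd \<Rightarrow> 'a::finite) set"
  assumes "subshift A" "group G" "cocycle G A C" "cohomologous G A C C'"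
  shows "cohomologous G A C' C"
proof -
  interpret group G by fact
  obtain b n where bc: "\<forall>x\<in>A. b x \<in> carrier G" and bw: "window A n b"
    and b: "\<And>z x. x \<in> A \<Longrightarrow> C' z x = b (shift z x) \<otimes>\<^bsub>G\<^esub> C z x \<otimes>\<^bsub>G\<^esub> inv\<^bsub>G\<^esub> (b x)"
    using assms(4) unfolding cohomologous_iff [OF assms(1)] by blast
  show ?thesis
    unfolding cohomologous_iff [OF assms(1)]
  proof (intro exI conjI allI ballI)
    show "window A n (\<lambda>x. inv\<^bsub>G\<^esub> (b x))"
      using window_combine [OF bw bw, where h = "\<lambda>g _. inv\<^bsub>G\<^esub> g"] by simp
    fix z x assume x: "x \<in> A"
    show "inv\<^bsub>G\<^esub> (b x) \<in> carrier G" using bc x by simp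
    have c: "b x \<in> carrier G" "b (shift z x) \<in> carrier G" "C z x \<in> carrier G"
      using bc x shift_in [OF assms(1)] cocycle_in_carrier [OF assms(1,3)] by auto
    then have "inv\<^bsub>G\<^esub> (b (shift z x)) \<otimes>\<^bsub>G\<^esub> (b (shift z x) \<otimes>\<^bsub>G\<^esub> C z x) = C z x"
      by (simp add: m_assoc [symmetric])
    with c show "C z x = inv\<^bsub>G\<^esub> (b (shift z x)) \<otimes>\<^bsub>G\<^esub> C' z x \<otimes>\<^bsub>G\<^esub> inv\<^bsub>G\<^esub> (inv\<^bsub>G\<^esub> (b x))"
      by (simp add: b [OF x] m_assoc)
  qed
qed

text \<open>Agreement on \<open>A\<close> is enough, which also identifies a cocycle with its
  normalised restriction.\<close>

lemma cohomologous_refl: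
  fixes A :: "(int ^ 'd \<Rightarrow> 'a::finite) set"
  assumes "subshift A" "group G" "cocycle G A C" "\<And>z x. x \<in> A \<Longrightarrow> C' z x = C z x"
  shows "cohomologous G A C C'"
proof -
  interpret group G by fact
  show ?thesis unfolding cohomologous_iff [OF assms(1)]
    by (intro exI [of _ "\<lambda>_. \<one>\<^bsub>G\<^esub>"] exI [of _ 0])
       (simp add: window_def assms(4) cocycle_in_carrier [OF assms(1,3)])
qed

lemma cohomologous_trans:
  fixes A :: "(int ^ 'd \<Rightarrow> 'a::finite) set"
  assumes "subshift A" "group G" "cocycle G A C" "cohomologous G A C C'" "cohomologous G A C' C''"
  shows "cohomologous G A C C''"
proof -
  interpret group G by fact
  obtain b n where bc: "\<forall>x\<in>A. b x \<in> carrier G" and bw: "window A n b"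
    and b: "\<And>z x. x \<in> A \<Longrightarrow> C' z x = b (shift z x) \<otimes>\<^bsub>G\<^esub> C z x \<otimes>\<^bsub>G\<^esub> inv\<^bsub>G\<^esub> (b x)"
    using assms(4) unfolding cohomologous_iff [OF assms(1)] by blast
  obtain b' n' where bc': "\<forall>x\<in>A. b' x \<in> carrier G" and bw': "window A n' b'"
    and b': "\<And>z x. x \<in> A \<Longrightarrow> C'' z x = b' (shift z x) \<otimes>\<^bsub>G\<^esub> C' z x \<otimes>\<^bsub>G\<^esub> inv\<^bsub>G\<^esub> (b' x)"
    using assms(5) unfolding cohomologous_iff [OF assms(1)] by blast
  show ?thesis
    unfolding cohomologous_iff [OF assms(1)]
  proof (intro exI conjI allI ballI)
    show "window A (max n' n) (\<lambda>x. b' x \<otimes>\<^bsub>G\<^esub> b x)" by (rule window_combine [OF bw' bw])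
    fix z x assume x: "x \<in> A"
    have c: "b x \<in> carrier G" "b (shift z x) \<in> carrier G" "b' x \<in> carrier G"
      "b' (shift z x) \<in> carrier G" "C z x \<in> carrier G"
      using bc bc' x shift_in [OF assms(1)] cocycle_in_carrier [OF assms(1,3)] by auto
    then show "b' x \<otimes>\<^bsub>G\<^esub> b x \<in> carrier G" by simp
    show "C'' z x = b' (shift z x) \<otimes>\<^bsub>G\<^esub> b (shift z x) \<otimes>\<^bsub>G\<^esub> C z x \<otimes>\<^bsub>G\<^esub> inv\<^bsub>G\<^esub> (b' x \<otimes>\<^bsub>G\<^esub> b x)"
      using c by (simp add: b [OF x] b' [OF x] m_assoc inv_mult_group)
  qed
qed

lemma eventually_flat_trivial:
  fixes A :: "(int ^ 'd \<Rightarrow> 'a::finite) set"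
  assumes "subshift A" "group G" "cocycle G A C" "trivial_cocycle G A C"
  shows "eventually_flat G A C a"
proof -
  obtain h where h: "h \<in> hom lattice_group G" and coh: "cohomologous G A C (\<lambda>z a. h z)"
    using assms(4) unfolding trivial_cocycle_def by blast
  have coc: "cocycle G A (\<lambda>z a. h z)" by (rule lattice_hom_cocycle [OF assms(1) h])
  obtain r where r: "locally_determined A r (\<lambda>z a. h z)" by (rule cocycle_radius [OF assms(1) coc])
  have "eventually_flat G A (\<lambda>z a. h z) a"
    by (rule eventually_flatI [OF r, of _ "Suc r"])
       (auto simp: closed_trail_in_def intro: trail_value_hom_lattice [OF assms(2) h r, of _ _ "Suc r"])
  from eventually_flat_cohomologous [OF assms(1,2) coc assms(3)
      cohomologous_sym [OF assms(1-3) coh] this]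
  show ?thesis .
qed

lemma cocycle_mult:
  fixes A :: "(int ^ 'd \<Rightarrow> 'a::finite) set"
  assumes "subshift A" "comm_group G" "cocycle G A C" "cocycle G A C'"
  shows "cocycle G A (\<lambda>z x. C z x \<otimes>\<^bsub>G\<^esub> C' z x)"
proof -
  interpret comm_group G by fact
  have w: "\<exists>s. window A s (\<lambda>x. C z x \<otimes>\<^bsub>G\<^esub> C' z x)" for z
    using assms(3,4) window_combine unfolding cocycle_iff [OF assms(1)] by blast
  show ?thesis
    unfolding cocycle_iff [OF assms(1)]
  proof (intro conjI allI ballI w)
    fix z y x assume x: "x \<in> A"
    note c = cocycle_in_carrier [OF assms(1,3)] cocycle_in_carrier [OF assms(1,4)]
    show "C z x \<otimes>\<^bsub>G\<^esub> C' z x \<in> carrier G" using c x by simp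
    show "C (y + z) x \<otimes>\<^bsub>G\<^esub> C' (y + z) x =
       C y (shift z x) \<otimes>\<^bsub>G\<^esub> C' y (shift z x) \<otimes>\<^bsub>G\<^esub> (C z x \<otimes>\<^bsub>G\<^esub> C' z x)"
      using c x shift_in [OF assms(1) x]
      by (simp add: cocycle_shift [OF assms(1,3) x] cocycle_shift [OF assms(1,4) x] m_ac)
  qed
qed

lemma eventually_flat_mult:
  fixes A :: "(int ^ 'd \<Rightarrow> 'a::finite) set"
  assumes "subshift A" "comm_group G" "cocycle G A C" "cocycle G A C'"
    "eventually_flat G A C a" "eventually_flat G A C' a"
  shows "eventually_flat G A (\<lambda>z x. C z x \<otimes>\<^bsub>G\<^esub> C' z x) a"
proof -
  interpret comm_group G by fact
  obtain r where r: "locally_determined A r C" by (rule cocycle_radius [OF assms(1,3)])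
  obtain r' where r': "locally_determined A r' C'" by (rule cocycle_radius [OF assms(1,4)])
  let ?D = "\<lambda>z x. C z x \<otimes>\<^bsub>G\<^esub> C' z x"
  obtain q where q: "locally_determined A q ?D"
    by (rule cocycle_radius [OF assms(1) cocycle_mult [OF assms(1-4)]])
  obtain s where s: "s \<ge> q" "s \<ge> r" "s > 0"
    "\<And>\<zeta>. closed_trail_in (good_set A a s) \<zeta> \<Longrightarrow> trail_value G A r C \<zeta> a = \<one>\<^bsub>G\<^esub>"
    by (rule eventually_flatD [OF assms(5) r, of q]) blast
  obtain s' where s': "s' \<ge> s" "s' \<ge> r'" "s' > 0"
    "\<And>\<zeta>. closed_trail_in (good_set A a s') \<zeta> \<Longrightarrow> trail_value G A r' C' \<zeta> a = \<one>\<^bsub>G\<^esub>"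
    by (rule eventually_flatD [OF assms(6) r', of s]) blast
  show ?thesis
  proof (rule eventually_flatI [OF q])
    fix \<zeta> assume \<zeta>: "closed_trail_in (good_set A a s') \<zeta>"
    then have tr: "trail \<zeta>" and sub: "set \<zeta> \<subseteq> good_set A a s'"
      by (auto simp: closed_trail_in_def)
    let ?X = "match_at A a s'"
    have X: "?X z \<in> A" if "z \<in> set \<zeta>" for z by (rule match_at_in [OF sub s'(3) that])
    have "trail_value G A q ?D \<zeta> a = path_prod G (\<lambda>z w. C (w - z) (?X z) \<otimes>\<^bsub>G\<^esub> C' (w - z) (?X z)) \<zeta>"
      using s s' by (intro trail_value_match_at [OF q tr sub]) auto
    also have "\<dots> = path_prod G (\<lambda>z w. C (w - z) (?X z)) \<zeta> \<otimes>\<^bsub>G\<^esub> path_prod G (\<lambda>z w. C' (w - z) (?X z)) \<zeta>"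
      by (intro path_prod_mult [OF assms(2)] successively_trail [OF tr])
         (simp add: X cocycle_in_carrier [OF assms(1,3)] cocycle_in_carrier [OF assms(1,4)])
    also have "path_prod G (\<lambda>z w. C (w - z) (?X z)) \<zeta> = trail_value G A r C \<zeta> a"
      using s s' by (intro trail_value_match_at [OF r tr sub, symmetric]) auto
    also have "path_prod G (\<lambda>z w. C' (w - z) (?X z)) \<zeta> = trail_value G A r' C' \<zeta> a"
      using s s' by (intro trail_value_match_at [OF r' tr sub, symmetric]) auto
    finally show "trail_value G A q ?D \<zeta> a = \<one>\<^bsub>G\<^esub>"
      using s(4) [OF closed_trail_in_good_mono [OF \<zeta> s'(1)]] s'(4) [OF \<zeta>] by simp
  qed
qed

text \<open>Flatness moves backwards in time: a closed trail that is good for \<open>a\<close> at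
  radius \<open>R + s\<close> is good for \<open>\<Phi> a\<close> at radius
  \<open>s\<close>.\<close>

lemma eventually_flat_pull:
  fixes A :: "(int ^ 'd \<Rightarrow> 'a::finite) set"
  assumes "cellular_automaton \<Phi>" "has_radius \<Phi> R" "\<Phi> ` A \<subseteq> A" "eventually_flat G A C (\<Phi> a)"
  shows "eventually_flat G A (pull A \<Phi> C) a"
proof -
  obtain s where s: "s > 0" "locally_determined A s C"
    "\<And>\<zeta>. closed_trail_in (good_set A (\<Phi> a) s) \<zeta> \<Longrightarrow> trail_value G A s C \<zeta> (\<Phi> a) = \<one>\<^bsub>G\<^esub>"
    using assms(4) unfolding eventually_flat_def by blast
  show ?thesis
  proof (rule eventually_flatI [OF locally_determined_pull [OF assms(1-3) s(2)]])
    fix \<zeta> assume \<zeta>: "closed_trail_in (good_set A a (R + s)) \<zeta>"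
    then have "trail_value G A (R + s) (pull A \<Phi> C) \<zeta> a = trail_value G A s C \<zeta> (\<Phi> a)"
      by (intro trail_value_pull [OF assms(1-3) s(2), symmetric] s(1)) (auto simp: closed_trail_in_def)
    also have "\<dots> = \<one>\<^bsub>G\<^esub>"
      by (rule s(3)) (rule closed_trail_in_mono [OF \<zeta> good_set_image [OF assms(1-3) s(1)]])
    finally show "trail_value G A (R + s) (pull A \<Phi> C) \<zeta> a = \<one>\<^bsub>G\<^esub>" .
  qed
qed

lemma represents_closed_trail:
  "represents (Y \<inter> good_set A a s) \<omega> g \<zeta> \<Longrightarrow> closed_trail_in (good_set A a s) \<zeta>"
  unfolding represents_def by (blast intro: closed_trail_in_mono)

lemma conjugate_eq_one:
  assumes "group G" "g \<in> carrier G" "v \<in> carrier G" "g \<otimes>\<^bsub>G\<^esub> v \<otimes>\<^bsub>G\<^esub> inv\<^bsub>G\<^esub> g = \<one>\<^bsub>G\<^esub>"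
  shows "v = \<one>\<^bsub>G\<^esub>"
proof -
  interpret group G by fact
  have "g \<otimes>\<^bsub>G\<^esub> v = g" using assms(2-4) by (metis inv_closed inv_inv inv_equality m_closed)
  then show ?thesis using assms(2,3) by simp
qed

text \<open>The clause of \<open>has_residue\<close> that representatives exist is essential here:
  one representative far enough out exhibits a conjugate of \<open>v\<close> that equals
  \<open>\<one>\<close>.\<close>

lemma has_residue_eventually_flat:
  assumes "group G" "eventually_flat G A C a" "has_residue G A a Y \<omega> C \<gamma> a v"
  shows "v = \<one>\<^bsub>G\<^esub>"
proof -
  interpret group G by fact
  obtain r where v: "v \<in> carrier G" and r: "locally_determined A r C"
    and ev: "\<forall>\<^sub>F s in sequentially.
           (\<exists>\<zeta>. represents (Y \<inter> good_set A a s) \<omega> (\<gamma> s) \<zeta>) \<and>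
           (\<forall>\<zeta>. represents (Y \<inter> good_set A a s) \<omega> (\<gamma> s) \<zeta> \<longrightarrow>
              (\<exists>g\<in>carrier G. trail_value G A r C \<zeta> a = g \<otimes>\<^bsub>G\<^esub> v \<otimes>\<^bsub>G\<^esub> inv\<^bsub>G\<^esub> g))"
    using assms(3) unfolding has_residue_def by blast
  obtain s where s: "\<And>\<zeta>. closed_trail_in (good_set A a s) \<zeta> \<Longrightarrow> trail_value G A r C \<zeta> a = \<one>\<^bsub>G\<^esub>"
    by (rule eventually_flatD [OF assms(2) r, of 0]) blast
  obtain n where n: "\<forall>s\<ge>n. (\<exists>\<zeta>. represents (Y \<inter> good_set A a s) \<omega> (\<gamma> s) \<zeta>) \<and>
           (\<forall>\<zeta>. represents (Y \<inter> good_set A a s) \<omega> (\<gamma> s) \<zeta> \<longrightarrow>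
              (\<exists>g\<in>carrier G. trail_value G A r C \<zeta> a = g \<otimes>\<^bsub>G\<^esub> v \<otimes>\<^bsub>G\<^esub> inv\<^bsub>G\<^esub> g))"
    using ev unfolding eventually_sequentially by blast
  obtain \<zeta> where \<zeta>: "represents (Y \<inter> good_set A a (max n s)) \<omega> (\<gamma> (max n s)) \<zeta>"
    using n max.cobounded1 by blast
  then obtain g where g: "g \<in> carrier G" "trail_value G A r C \<zeta> a = g \<otimes>\<^bsub>G\<^esub> v \<otimes>\<^bsub>G\<^esub> inv\<^bsub>G\<^esub> g"
    using n max.cobounded1 by blast
  have "closed_trail_in (good_set A a s) \<zeta>"
    by (rule closed_trail_in_good_mono [OF represents_closed_trail [OF \<zeta>]]) simp
  from s [OF this] g have "g \<otimes>\<^bsub>G\<^esub> v \<otimes>\<^bsub>G\<^esub> inv\<^bsub>G\<^esub> g = \<one>\<^bsub>G\<^esub>" by simp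
  then show ?thesis by (rule conjugate_eq_one [OF assms(1) g(1) v])
qed

section \<open>The induced map on cohomology\<close>

lemma pull_in_cocycles:
  fixes A :: "(int ^ 'd \<Rightarrow> 'a::finite) set"
  assumes "cellular_automaton \<Phi>" "has_radius \<Phi> R" "\<Phi> ` A \<subseteq> A" "subshift A" "cocycle G A C"
  shows "pull A \<Phi> C \<in> cocycles G A"
proof -
  have \<Phi>A: "\<Phi> x \<in> A" if "x \<in> A" for x using assms(3) that by blast
  have w: "\<exists>s. window A s (pull A \<Phi> C z)" for z
  proof -
    obtain s where "window A s (C z)" using assms(5) unfolding cocycle_iff [OF assms(4)] by blast
    from window_image [OF assms(1-3) this] have "window A (R + s) (pull A \<Phi> C z)"
      by (rule window_cong [rotated]) (simp add: pull_def)
    then show ?thesis ..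
  qed
  have "cocycle G A (pull A \<Phi> C)"
    unfolding cocycle_iff [OF assms(4)]
  proof (intro conjI allI ballI w)
    fix y z x assume x: "x \<in> A"
    show "pull A \<Phi> C z x \<in> carrier G"
      using x \<Phi>A cocycle_in_carrier [OF assms(4,5)] by (simp add: pull_def)
    have "\<Phi> (shift z x) = shift z (\<Phi> x)" using assms(1) by (simp add: cellular_automaton_def)
    then show "pull A \<Phi> C (y + z) x = pull A \<Phi> C y (shift z x) \<otimes>\<^bsub>G\<^esub> pull A \<Phi> C z x"
      using x shift_in [OF assms(4) x] cocycle_shift [OF assms(4,5) \<Phi>A [OF x]]
      by (simp add: pull_def)
  qed
  then show ?thesis by (simp add: cocycles_def pull_def)
qed

lemma cohomologous_pull:
  fixes A :: "(int ^ 'd \<Rightarrow> 'a::finite) set"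
  assumes "cellular_automaton \<Phi>" "has_radius \<Phi> R" "\<Phi> ` A \<subseteq> A" "subshift A"
    "cohomologous G A C C'"
  shows "cohomologous G A (pull A \<Phi> C) (pull A \<Phi> C')"
proof -
  have \<Phi>A: "\<Phi> x \<in> A" if "x \<in> A" for x using assms(3) that by blast
  have sh: "\<Phi> (shift z x) = shift z (\<Phi> x)" for z x
    using assms(1) by (simp add: cellular_automaton_def)
  obtain b n where bc: "\<forall>x\<in>A. b x \<in> carrier G" and bw: "window A n b"
    and b: "\<And>z x. x \<in> A \<Longrightarrow> C' z x = b (shift z x) \<otimes>\<^bsub>G\<^esub> C z x \<otimes>\<^bsub>G\<^esub> inv\<^bsub>G\<^esub> (b x)"
    using assms(5) unfolding cohomologous_iff [OF assms(4)] by blast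
  show ?thesis
    unfolding cohomologous_iff [OF assms(4)]
    by (intro exI [of _ "\<lambda>x. b (\<Phi> x)"] exI [of _ "R + n"] conjI window_image [OF assms(1-3) bw])
       (simp_all add: pull_def b \<Phi>A bc sh shift_in [OF assms(4)])
qed

lemma restrict_in_cocycles:
  fixes A :: "(int ^ 'd \<Rightarrow> 'a::finite) set"
  assumes "subshift A" "cocycle G A C"
  shows "(\<lambda>z. restrict (C z) A) \<in> cocycles G A"
proof -
  have w: "\<exists>s. window A s (restrict (C z) A)" for z
  proof -
    obtain s where "window A s (C z)" using assms(2) unfolding cocycle_iff [OF assms(1)] by blast
    then have "window A s (restrict (C z) A)" by (rule window_cong [rotated]) simp
    then show ?thesis ..
  qed
  have "cocycle G A (\<lambda>z. restrict (C z) A)"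
    unfolding cocycle_iff [OF assms(1)]
  proof (intro conjI allI ballI w)
    fix y z x assume x: "x \<in> A"
    show "restrict (C z) A x \<in> carrier G"
      using x cocycle_in_carrier [OF assms] by simp
    show "restrict (C (y + z)) A x = restrict (C y) A (shift z x) \<otimes>\<^bsub>G\<^esub> restrict (C z) A x"
      using x shift_in [OF assms(1) x] cocycle_shift [OF assms x] by simp
  qed
  then show ?thesis by (simp add: cocycles_def)
qed

lemma cocyclesD: "C \<in> cocycles G A \<Longrightarrow> cocycle G A C" "C \<in> cocycles G A \<Longrightarrow> C z \<in> extensional A"
  by (simp_all add: cocycles_def)

text \<open>With the products and inverses treated next, this makes translation by trivial cocycles
  reflexive, transitive and symmetric in \<open>H1_dy_quotient\<close>.\<close>

lemma trivial_cocycle_one: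
  fixes A :: "(int ^ 'd \<Rightarrow> 'a::finite) set"
  assumes "subshift A" "group G"
  shows "(\<lambda>z. \<lambda>x\<in>A. \<one>\<^bsub>G\<^esub>) \<in> cocycles G A" "trivial_cocycle G A (\<lambda>z. \<lambda>x\<in>A. \<one>\<^bsub>G\<^esub>)"
proof -
  interpret group G by fact
  have h: "(\<lambda>_. \<one>\<^bsub>G\<^esub>) \<in> hom lattice_group G" by (simp add: hom_def)
  from restrict_in_cocycles [OF assms(1) lattice_hom_cocycle [OF assms(1) h]]
  show c: "(\<lambda>z. \<lambda>x\<in>A. \<one>\<^bsub>G\<^esub>) \<in> cocycles G A" by simp
  show "trivial_cocycle G A (\<lambda>z. \<lambda>x\<in>A. \<one>\<^bsub>G\<^esub>)"
    unfolding trivial_cocycle_def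
    by (rule bexI [OF _ h], rule cohomologous_refl [OF assms cocyclesD(1) [OF c]]) simp
qed

lemma trivial_cocycle_mult:
  fixes A :: "(int ^ 'd \<Rightarrow> 'a::finite) set"
  assumes "subshift A" "comm_group G" "C \<in> cocycles G A" "C' \<in> cocycles G A"
    "trivial_cocycle G A C" "trivial_cocycle G A C'"
  shows "trivial_cocycle G A (\<lambda>z. \<lambda>x\<in>A. C z x \<otimes>\<^bsub>G\<^esub> C' z x)"
proof -
  interpret comm_group G by fact
  note cc = cocycle_in_carrier [OF assms(1) cocyclesD(1) [OF assms(3)]]
    cocycle_in_carrier [OF assms(1) cocyclesD(1) [OF assms(4)]]
  obtain h b n where h: "h \<in> hom lattice_group G" and bc: "\<forall>x\<in>A. b x \<in> carrier G"
    and bw: "window A n b"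
    and b: "\<And>z x. x \<in> A \<Longrightarrow> h z = b (shift z x) \<otimes>\<^bsub>G\<^esub> C z x \<otimes>\<^bsub>G\<^esub> inv\<^bsub>G\<^esub> (b x)"
    using assms(5) unfolding trivial_cocycle_def cohomologous_iff [OF assms(1)] by blast
  obtain h' b' n' where h': "h' \<in> hom lattice_group G" and bc': "\<forall>x\<in>A. b' x \<in> carrier G"
    and bw': "window A n' b'"
    and b': "\<And>z x. x \<in> A \<Longrightarrow> h' z = b' (shift z x) \<otimes>\<^bsub>G\<^esub> C' z x \<otimes>\<^bsub>G\<^esub> inv\<^bsub>G\<^esub> (b' x)"
    using assms(6) unfolding trivial_cocycle_def cohomologous_iff [OF assms(1)] by blast
  have hh: "(\<lambda>z. h z \<otimes>\<^bsub>G\<^esub> h' z) \<in> hom lattice_group G"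
    using h h' by (auto simp: hom_def lattice_group_def Pi_iff m_ac)
  have "cohomologous G A (\<lambda>z. \<lambda>x\<in>A. C z x \<otimes>\<^bsub>G\<^esub> C' z x) (\<lambda>z a. h z \<otimes>\<^bsub>G\<^esub> h' z)"
    unfolding cohomologous_iff [OF assms(1)]
  proof (intro exI conjI allI ballI)
    show "window A (max n n') (\<lambda>x. b x \<otimes>\<^bsub>G\<^esub> b' x)" by (rule window_combine [OF bw bw'])
    fix z x assume x: "x \<in> A"
    have c: "b x \<in> carrier G" "b (shift z x) \<in> carrier G" "b' x \<in> carrier G"
      "b' (shift z x) \<in> carrier G" "C z x \<in> carrier G" "C' z x \<in> carrier G"
      using bc bc' x shift_in [OF assms(1)] cc by auto
    then show "b x \<otimes>\<^bsub>G\<^esub> b' x \<in> carrier G" by simp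
    show "h z \<otimes>\<^bsub>G\<^esub> h' z = b (shift z x) \<otimes>\<^bsub>G\<^esub> b' (shift z x) \<otimes>\<^bsub>G\<^esub> (\<lambda>x\<in>A. C z x \<otimes>\<^bsub>G\<^esub> C' z x) x
        \<otimes>\<^bsub>G\<^esub> inv\<^bsub>G\<^esub> (b x \<otimes>\<^bsub>G\<^esub> b' x)"
      using c x by (simp add: b [OF x] b' [OF x] m_ac inv_mult)
  qed
  then show ?thesis unfolding trivial_cocycle_def
    by - (rule bexI [where x = "\<lambda>z. h z \<otimes>\<^bsub>G\<^esub> h' z"], simp, rule hh)
qed

lemma trivial_cocycle_inv:
  fixes A :: "(int ^ 'd \<Rightarrow> 'a::finite) set"
  assumes "subshift A" "comm_group G" "C \<in> cocycles G A" "trivial_cocycle G A C"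
  shows "(\<lambda>z. \<lambda>x\<in>A. inv\<^bsub>G\<^esub> (C z x)) \<in> cocycles G A"
    and "trivial_cocycle G A (\<lambda>z. \<lambda>x\<in>A. inv\<^bsub>G\<^esub> (C z x))"
proof -
  interpret comm_group G by fact
  note coc = cocyclesD(1) [OF assms(3)]
  note cc = cocycle_in_carrier [OF assms(1) coc]
  have w: "\<exists>s. window A s (\<lambda>x. inv\<^bsub>G\<^esub> (C z x))" for z
  proof -
    obtain s where "window A s (C z)" using coc unfolding cocycle_iff [OF assms(1)] by blast
    from window_combine [OF this this, where h = "\<lambda>g _. inv\<^bsub>G\<^esub> g"] show ?thesis by blast
  qed
  have "cocycle G A (\<lambda>z x. inv\<^bsub>G\<^esub> (C z x))"
    unfolding cocycle_iff [OF assms(1)]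
  proof (intro conjI allI ballI w)
    fix y z x assume x: "x \<in> A"
    show "inv\<^bsub>G\<^esub> (C z x) \<in> carrier G" using x cc by simp
    show "inv\<^bsub>G\<^esub> (C (y + z) x) = inv\<^bsub>G\<^esub> (C y (shift z x)) \<otimes>\<^bsub>G\<^esub> inv\<^bsub>G\<^esub> (C z x)"
      using x shift_in [OF assms(1) x] cc by (simp add: cocycle_shift [OF assms(1) coc x] inv_mult)
  qed
  from restrict_in_cocycles [OF assms(1) this]
  show "(\<lambda>z. \<lambda>x\<in>A. inv\<^bsub>G\<^esub> (C z x)) \<in> cocycles G A" by simp
  obtain h b n where h: "h \<in> hom lattice_group G" and bc: "\<forall>x\<in>A. b x \<in> carrier G"
    and bw: "window A n b"
    and b: "\<And>z x. x \<in> A \<Longrightarrow> h z = b (shift z x) \<otimes>\<^bsub>G\<^esub> C z x \<otimes>\<^bsub>G\<^esub> inv\<^bsub>G\<^esub> (b x)"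
    using assms(4) unfolding trivial_cocycle_def cohomologous_iff [OF assms(1)] by blast
  have hh: "(\<lambda>z. inv\<^bsub>G\<^esub> (h z)) \<in> hom lattice_group G"
    using h by (auto simp: hom_def lattice_group_def Pi_iff inv_mult)
  have "cohomologous G A (\<lambda>z. \<lambda>x\<in>A. inv\<^bsub>G\<^esub> (C z x)) (\<lambda>z a. inv\<^bsub>G\<^esub> (h z))"
    unfolding cohomologous_iff [OF assms(1)]
  proof (intro exI conjI allI ballI)
    show "window A n (\<lambda>x. inv\<^bsub>G\<^esub> (b x))"
      using window_combine [OF bw bw, where h = "\<lambda>g _. inv\<^bsub>G\<^esub> g"] by simp
    fix z x assume x: "x \<in> A"
    have c: "b x \<in> carrier G" "b (shift z x) \<in> carrier G" "C z x \<in> carrier G"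
      using bc x shift_in [OF assms(1)] cc by auto
    then show "inv\<^bsub>G\<^esub> (b x) \<in> carrier G" by simp
    show "inv\<^bsub>G\<^esub> (h z) = inv\<^bsub>G\<^esub> (b (shift z x)) \<otimes>\<^bsub>G\<^esub> (\<lambda>x\<in>A. inv\<^bsub>G\<^esub> (C z x)) x
        \<otimes>\<^bsub>G\<^esub> inv\<^bsub>G\<^esub> (inv\<^bsub>G\<^esub> (b x))"
      using c x by (simp add: b [OF x] m_ac inv_mult)
  qed
  then show "trivial_cocycle G A (\<lambda>z. \<lambda>x\<in>A. inv\<^bsub>G\<^esub> (C z x))"
    unfolding trivial_cocycle_def
    by - (rule bexI [where x = "\<lambda>z. inv\<^bsub>G\<^esub> (h z)"], simp, rule hh)
qed

lemma mult_in_cocycles: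
  fixes A :: "(int ^ 'd \<Rightarrow> 'a::finite) set"
  assumes "subshift A" "comm_group G" "C \<in> cocycles G A" "C' \<in> cocycles G A"
  shows "(\<lambda>z. \<lambda>x\<in>A. C z x \<otimes>\<^bsub>G\<^esub> C' z x) \<in> cocycles G A"
  using restrict_in_cocycles [OF assms(1)
      cocycle_mult [OF assms(1,2) cocyclesD(1) [OF assms(3)] cocyclesD(1) [OF assms(4)]]] by simp

lemma trivial_cocycle_pull:
  fixes A :: "(int ^ 'd \<Rightarrow> 'a::finite) set"
  assumes "cellular_automaton \<Phi>" "has_radius \<Phi> R" "\<Phi> ` A \<subseteq> A" "subshift A" "group G"
    "C \<in> cocycles G A" "trivial_cocycle G A C"
  shows "trivial_cocycle G A (pull A \<Phi> C)"
proof -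
  obtain h where h: "h \<in> hom lattice_group G" and coh: "cohomologous G A C (\<lambda>z a. h z)"
    using assms(7) unfolding trivial_cocycle_def by blast
  \<comment> \<open>\<open>h\<close> ignores the configuration, so on \<open>A\<close> its pullback
    is \<open>h\<close> again.\<close>
  have "cohomologous G A (pull A \<Phi> (\<lambda>z a. h z)) (\<lambda>z a. h z)"
    by (rule cohomologous_refl [OF assms(4,5) cocyclesD(1) [OF pull_in_cocycles
        [OF assms(1-4) lattice_hom_cocycle [OF assms(4) h]]]]) (simp add: pull_def)
  from cohomologous_trans [OF assms(4,5) cocyclesD(1) [OF pull_in_cocycles [OF assms(1-4)
        cocyclesD(1) [OF assms(6)]]] cohomologous_pull [OF assms(1-4) coh] this] h
  show ?thesis unfolding trivial_cocycle_def by blast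
qed

text \<open>Both branches of \<^const>\<open>H1_dy\<close> are the quotient by an equivalence relation that is
  respected by the pullback and by the absence of residues.\<close>

lemma H1_dy_quotient:
  fixes A :: "(int ^ 'd \<Rightarrow> 'a::finite) set" and G :: "('g, 'm) monoid_scheme"
  assumes "cellular_automaton \<Phi>" "has_radius \<Phi> R" "\<Phi> ` A \<subseteq> A" "subshift A" "group G"
  obtains E where "equiv (cocycles G A) E" "H1_dy G A = cocycles G A // E"
    "\<And>C C'. (C, C') \<in> E \<Longrightarrow> (pull A \<Phi> C, pull A \<Phi> C') \<in> E"
    "\<And>C C' a. (C, C') \<in> E \<Longrightarrow> eventually_flat G A C a \<Longrightarrow> eventually_flat G A C' a"
proof (cases "comm_group G")
  case False
  define E where "E = {(C, C'). C \<in> cocycles G A \<and> C' \<in> cocycles G A \<and> cohomologous G A C C'}"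
  note coh = cohomologous_refl [OF assms(4,5)] cohomologous_sym [OF assms(4,5)]
    cohomologous_trans [OF assms(4,5)]
  have "equiv (cocycles G A) E"
  proof (rule equivI)
    show "E \<subseteq> cocycles G A \<times> cocycles G A" by (auto simp: E_def)
    show "refl_on (cocycles G A) E" unfolding E_def
      by (intro refl_onI) (simp add: coh(1) [OF cocyclesD(1)])
    show "sym E" unfolding E_def
      by (intro symI) (auto intro: coh(2) cocyclesD(1))
    show "trans E" unfolding E_def trans_def using coh(3) cocyclesD(1) by blast
  qed
  moreover have "H1_dy G A = cocycles G A // E" using False by (simp add: H1_dy_def E_def)
  moreover have "(pull A \<Phi> C, pull A \<Phi> C') \<in> E" if "(C, C') \<in> E" for C C'
    using that pull_in_cocycles [OF assms(1-4)] cohomologous_pull [OF assms(1-4)] cocyclesD(1)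
    unfolding E_def by blast
  moreover have "eventually_flat G A C' a" if "(C, C') \<in> E" "eventually_flat G A C a" for C C' a
    using that eventually_flat_cohomologous [OF assms(4,5)] cocyclesD(1) unfolding E_def by blast
  ultimately show thesis by (rule that)
next
  case True
  then interpret comm_group G .
  define N where "N = {C \<in> cocycles G A. trivial_cocycle G A C}"
  \<comment> \<open>The classes of this relation are exactly the right cosets of \<open>N\<close>,
    so the carrier of the factor group is literally a quotient by \<open>E\<close>.\<close>
  define E where "E = {(C, C'). C \<in> cocycles G A \<and> (\<exists>D\<in>N. C' = (\<lambda>z. \<lambda>x\<in>A. D z x \<otimes>\<^bsub>G\<^esub> C z x))}"
  have NI: "D \<in> N" if "D \<in> cocycles G A" "trivial_cocycle G A D" for D using that by (simp add: N_def)
  have ND: "D \<in> cocycles G A" "trivial_cocycle G A D" if "D \<in> N" for D using that by (simp_all add: N_def)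
  note cc = cocycle_in_carrier [OF assms(4) cocyclesD(1)]
  have E_cocycles: "C' \<in> cocycles G A" if "(C, C') \<in> E" for C C'
    using that mult_in_cocycles [OF assms(4) True] ND(1) unfolding E_def by blast
  have "equiv (cocycles G A) E"
  proof (rule equivI)
    show "E \<subseteq> cocycles G A \<times> cocycles G A" using E_cocycles by (auto simp: E_def)
    show "refl_on (cocycles G A) E"
    proof (rule refl_onI)
      fix C assume C: "C \<in> cocycles G A"
      define I :: "int ^ 'd \<Rightarrow> (int ^ 'd \<Rightarrow> 'a) \<Rightarrow> 'g" where "I = (\<lambda>z. \<lambda>x\<in>A. \<one>\<^bsub>G\<^esub>)"
      have "I \<in> N" unfolding I_def by (rule NI [OF trivial_cocycle_one [OF assms(4,5)]])
      \<comment> \<open>Off \<open>A\<close> both sides are \<open>undefined\<close>, because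
        members of \<open>cocycles\<close> are extensional; without that normalisation the coset
        relation would not be reflexive.\<close>
      moreover have "C = (\<lambda>z. \<lambda>x\<in>A. I z x \<otimes>\<^bsub>G\<^esub> C z x)"
      proof (intro ext)
        fix z x show "C z x = (\<lambda>x\<in>A. I z x \<otimes>\<^bsub>G\<^esub> C z x) x"
          using cc [OF C] extensional_arb [OF cocyclesD(2) [OF C]] by (cases "x \<in> A") (simp_all add: I_def)
      qed
      ultimately show "(C, C) \<in> E" using C unfolding E_def by blast
    qed
    show "sym E"
    proof (rule symI)
      fix C C' assume CC': "(C, C') \<in> E"
      then obtain D where C: "C \<in> cocycles G A" and D: "D \<in> N"
        and C': "C' = (\<lambda>z. \<lambda>x\<in>A. D z x \<otimes>\<^bsub>G\<^esub> C z x)" unfolding E_def by blast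
      define D' where "D' = (\<lambda>z. \<lambda>x\<in>A. inv\<^bsub>G\<^esub> (D z x))"
      have "D' \<in> N" unfolding D'_def
        using trivial_cocycle_inv [OF assms(4) True ND [OF D]] by (rule NI)
      moreover have "C = (\<lambda>z. \<lambda>x\<in>A. D' z x \<otimes>\<^bsub>G\<^esub> C' z x)"
      proof (intro ext)
        fix z x show "C z x = (\<lambda>x\<in>A. D' z x \<otimes>\<^bsub>G\<^esub> C' z x) x"
          using cc [OF C] cc [OF ND(1) [OF D]] extensional_arb [OF cocyclesD(2) [OF C]]
          by (cases "x \<in> A") (simp_all add: C' D'_def m_assoc [symmetric])
      qed
      ultimately show "(C', C) \<in> E" using E_cocycles [OF CC'] unfolding E_def by blast
    qed
    show "trans E"
    proof (rule transI)
      fix C C' C'' assume CC': "(C, C') \<in> E" and CC'': "(C', C'') \<in> E"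
      from CC' obtain D where C: "C \<in> cocycles G A" and D: "D \<in> N"
        and C': "C' = (\<lambda>z. \<lambda>x\<in>A. D z x \<otimes>\<^bsub>G\<^esub> C z x)" unfolding E_def by blast
      from CC'' obtain D' where D': "D' \<in> N"
        and C'': "C'' = (\<lambda>z. \<lambda>x\<in>A. D' z x \<otimes>\<^bsub>G\<^esub> C' z x)" unfolding E_def by blast
      define F where "F = (\<lambda>z. \<lambda>x\<in>A. D' z x \<otimes>\<^bsub>G\<^esub> D z x)"
      have "F \<in> N" unfolding F_def
        by (rule NI [OF mult_in_cocycles [OF assms(4) True ND(1) [OF D'] ND(1) [OF D]]
            trivial_cocycle_mult [OF assms(4) True ND(1) [OF D'] ND(1) [OF D] ND(2) [OF D'] ND(2) [OF D]]])
      moreover have "C'' = (\<lambda>z. \<lambda>x\<in>A. F z x \<otimes>\<^bsub>G\<^esub> C z x)"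
      proof (intro ext)
        fix z x show "C'' z x = (\<lambda>x\<in>A. F z x \<otimes>\<^bsub>G\<^esub> C z x) x"
          using cc [OF C] cc [OF ND(1) [OF D]] cc [OF ND(1) [OF D']]
          by (cases "x \<in> A") (simp_all add: C'' C' F_def m_assoc)
      qed
      ultimately show "(C, C'') \<in> E" using C unfolding E_def by blast
    qed
  qed
  moreover have "H1_dy G A = cocycles G A // E"
  proof -
    have "N #>\<^bsub>cocycle_group G A\<^esub> C = E `` {C}" if "C \<in> cocycles G A" for C
      using that by (auto simp: r_coset_def cocycle_group_def E_def)
    then have "(\<Union>C\<in>cocycles G A. {N #>\<^bsub>cocycle_group G A\<^esub> C}) = (\<Union>C\<in>cocycles G A. {E `` {C}})"
      by auto
    then show ?thesis
      using True by (simp add: H1_dy_def FactGroup_def RCOSETS_def quotient_def N_def cocycle_group_def)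
  qed
  moreover have "(pull A \<Phi> C, pull A \<Phi> C') \<in> E" if CC': "(C, C') \<in> E" for C C'
  proof -
    from CC' obtain D where C: "C \<in> cocycles G A" and D: "D \<in> N"
      and C': "C' = (\<lambda>z. \<lambda>x\<in>A. D z x \<otimes>\<^bsub>G\<^esub> C z x)" unfolding E_def by blast
    have "pull A \<Phi> D \<in> N"
      using ND [OF D] by (intro NI pull_in_cocycles [OF assms(1-4)] trivial_cocycle_pull [OF assms] cocyclesD(1))
    moreover have "pull A \<Phi> C' = (\<lambda>z. \<lambda>x\<in>A. pull A \<Phi> D z x \<otimes>\<^bsub>G\<^esub> pull A \<Phi> C z x)"
      using assms(3) by (auto simp: pull_def C' fun_eq_iff)
    ultimately show ?thesis
      using pull_in_cocycles [OF assms(1-4) cocyclesD(1) [OF C]] unfolding E_def by blast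
  qed
  moreover have "eventually_flat G A C' a" if CC': "(C, C') \<in> E" "eventually_flat G A C a" for C C' a
  proof -
    from CC'(1) obtain D where C: "C \<in> cocycles G A" and D: "D \<in> N"
      and C': "C' = (\<lambda>z. \<lambda>x\<in>A. D z x \<otimes>\<^bsub>G\<^esub> C z x)" unfolding E_def by blast
    note cD = cocyclesD(1) [OF ND(1) [OF D]] and cC = cocyclesD(1) [OF C]
    have "eventually_flat G A (\<lambda>z x. D z x \<otimes>\<^bsub>G\<^esub> C z x) a"
      by (rule eventually_flat_mult [OF assms(4) True cD cC
          eventually_flat_trivial [OF assms(4,5) cD ND(2) [OF D]] CC'(2)])
    moreover note dc = cocycle_mult [OF assms(4) True cD cC]
    moreover have "cohomologous G A (\<lambda>z x. D z x \<otimes>\<^bsub>G\<^esub> C z x) C'"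
      by (rule cohomologous_refl [OF assms(4,5) dc]) (simp add: C')
    ultimately show ?thesis
      using eventually_flat_cohomologous [OF assms(4,5) dc cocyclesD(1) [OF E_cocycles [OF CC'(1)]]]
      by blast
  qed
  ultimately show thesis by (rule that)
qed

text \<open>Surjectivity makes \<open>C\<close> equivalent to a pullback. Only the consequence for
  flatness is exported, so that its use does not depend on which relation defines
  \<open>H1_dy\<close>.\<close>

lemma H1_pull_surjective:
  fixes A :: "(int ^ 'd \<Rightarrow> 'a::finite) set"
  assumes "cellular_automaton \<Phi>" "has_radius \<Phi> R" "\<Phi> ` A \<subseteq> A" "subshift A" "group G"
    "H1_pull G A \<Phi> ` H1_dy G A = H1_dy G A" "C \<in> cocycles G A"
  obtains C' where "C' \<in> cocycles G A"
    "\<And>a. eventually_flat G A (pull A \<Phi> C') a \<Longrightarrow> eventually_flat G A C a"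
proof -
  obtain E where E: "equiv (cocycles G A) E" "H1_dy G A = cocycles G A // E"
    and Ep: "\<And>C C'. (C, C') \<in> E \<Longrightarrow> (pull A \<Phi> C, pull A \<Phi> C') \<in> E"
    and Ef: "\<And>C C' a. (C, C') \<in> E \<Longrightarrow> eventually_flat G A C a \<Longrightarrow> eventually_flat G A C' a"
    by (rule H1_dy_quotient [OF assms(1-5)]) blast
  have "E `` {C} \<in> H1_dy G A" unfolding E(2) using assms(7) by (rule quotientI)
  then obtain K where K: "K \<in> H1_dy G A" "E `` {C} = H1_pull G A \<Phi> K"
    using assms(6) by (metis imageE)
  then obtain C' where C': "C' \<in> cocycles G A" "K = E `` {C'}"
    unfolding E(2) by (blast elim: quotientE)
  have pC': "pull A \<Phi> C' \<in> cocycles G A"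
    by (rule pull_in_cocycles [OF assms(1-4) cocyclesD(1) [OF C'(1)]])
  have "H1_pull G A \<Phi> K = E `` {pull A \<Phi> C'}"
    unfolding H1_pull_def
  proof (rule the_equality)
    show "E `` {pull A \<Phi> C'} \<in> H1_dy G A \<and> pull A \<Phi> ` K \<subseteq> E `` {pull A \<Phi> C'}"
      unfolding E(2) using pC' Ep by (auto simp: C'(2) quotientI)
    \<comment> \<open>Uniqueness for \<open>THE\<close>: two classes that share
      \<open>pull A \<Phi> C'\<close> coincide.\<close>
    fix L assume L: "L \<in> H1_dy G A \<and> pull A \<Phi> ` K \<subseteq> L"
    then have "pull A \<Phi> C' \<in> L" using C' equiv_class_self [OF E(1)] by blast
    moreover have "pull A \<Phi> C' \<in> E `` {pull A \<Phi> C'}" by (rule equiv_class_self [OF E(1) pC'])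
    ultimately show "L = E `` {pull A \<Phi> C'}"
      using quotient_disj [OF E(1)] L quotientI [OF pC'] unfolding E(2) by blast
  qed
  with K(2) have "(pull A \<Phi> C', C) \<in> E" using equiv_class_self [OF E(1) assms(7)] by blast
  with C'(1) Ef that show thesis by blast
qed

lemma persistentI:
  assumes "cellular_automaton \<Phi>" "has_radius \<Phi> R" "\<Phi> ` A \<subseteq> A" "a \<in> tilde A"
    "\<And>t. (\<Phi> ^^ t) a \<notin> A"
  shows "persistent A \<Phi> a"
  using assms(5) tilde_funpow [OF assms(1-4)] by (simp add: persistent_def defective_def)

text \<open>If \<open>(\<Phi> ^^ t) a\<close> were in \<open>A\<close>, every cocycle would be flat
  at \<open>a\<close>. The induction on \<open>t\<close> must generalise the cocycle too, since each
  step back in time replaces \<open>C\<close> by a preimage under the induced map.\<close>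

lemma surjective_poles_persistent:
  fixes A :: "(int ^ 'd \<Rightarrow> 'a::finite) set"
  assumes "cellular_automaton \<Phi>" "has_radius \<Phi> R" "\<Phi> ` A \<subseteq> A" "subshift A" "group G"
    "H1_pull G A \<Phi> ` H1_dy G A = H1_dy G A"
  shows "poles_persistent G A \<Phi>"
proof -
  have flat: "eventually_flat G A C a" if "C \<in> cocycles G A" "(\<Phi> ^^ t) a \<in> A" for C a t
    using that
  proof (induction t arbitrary: a C)
    case 0
    then show ?case using eventually_flat_in_subshift [OF assms(4,5) cocyclesD(1)] by simp
  next
    case (Suc t)
    obtain C' where C': "C' \<in> cocycles G A"
      "\<And>a. eventually_flat G A (pull A \<Phi> C') a \<Longrightarrow> eventually_flat G A C a"
      using H1_pull_surjective [OF assms Suc.prems(1)] by blast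
    have "(\<Phi> ^^ t) (\<Phi> a) \<in> A" using Suc.prems(2) by (simp add: funpow_swap1)
    then have "eventually_flat G A C' (\<Phi> a)" by (rule Suc.IH [OF C'(1)])
    then show ?case by (intro C'(2) eventually_flat_pull [OF assms(1-3)])
  qed
  show ?thesis
    unfolding poles_persistent_def
  proof (intro ballI allI impI)
    fix a r0 Y \<omega> assume a: "a \<in> tilde A" and "proper_base A a r0 Y \<omega> \<and> has_pole G A a r0 Y \<omega>"
    then obtain C \<gamma> v where C: "cocycle G A C" and res: "has_residue G A a Y \<omega> C \<gamma> a v" "v \<noteq> \<one>\<^bsub>G\<^esub>"
      unfolding has_pole_def by blast
    show "persistent A \<Phi> a"
    proof (rule persistentI [OF assms(1-3) a])
      fix t
      show "(\<Phi> ^^ t) a \<notin> A"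
      proof
        assume "(\<Phi> ^^ t) a \<in> A"
        \<comment> \<open>\<open>H1_dy\<close> contains only normalised cocycles, whereas the
          cocycle that exhibits the pole is arbitrary off \<open>A\<close>.\<close>
        let ?C = "\<lambda>z. restrict (C z) A"
        note rC = restrict_in_cocycles [OF assms(4) C]
        have "eventually_flat G A ?C a" by (rule flat [OF rC \<open>(\<Phi> ^^ t) a \<in> A\<close>])
        then have "eventually_flat G A C a"
          by (intro eventually_flat_cohomologous [OF assms(4,5) cocyclesD(1) [OF rC] C]
              cohomologous_refl [OF assms(4,5) cocyclesD(1) [OF rC]]) simp_all
        from has_residue_eventually_flat [OF assms(5) this res(1)] res(2) show False by simp
      qed
    qed
  qed
qed

section \<open>Fundamental cocycles\<close>

lemma comm_group_conjugate:
  assumes "comm_group G" "g \<in> carrier G" "v \<in> carrier G"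
  shows "g \<otimes>\<^bsub>G\<^esub> v \<otimes>\<^bsub>G\<^esub> inv\<^bsub>G\<^esub> g = v"
proof -
  interpret comm_group G by fact
  show ?thesis using assms(2,3) by (simp add: m_comm [of g v] m_assoc)
qed

lemma trail_value_cohomologous_comm:
  fixes A :: "(int ^ 'd \<Rightarrow> 'a::finite) set"
  assumes "subshift A" "comm_group G" "cocycle G A C" "cohomologous G A C C'"
    "locally_determined A r C" "locally_determined A r' C'"
  shows "\<exists>s0>0. \<forall>a \<zeta>. closed_trail_in (good_set A a s0) \<zeta> \<longrightarrow>
    trail_value G A r' C' \<zeta> a = trail_value G A r C \<zeta> a"
proof -
  interpret comm_group G by fact
  obtain m where m: "m > 0" "\<And>a \<zeta>. closed_trail_in (good_set A a m) \<zeta> \<Longrightarrow>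
    (\<exists>g\<in>carrier G. trail_value G A r' C' \<zeta> a = g \<otimes>\<^bsub>G\<^esub> trail_value G A r C \<zeta> a \<otimes>\<^bsub>G\<^esub> inv\<^bsub>G\<^esub> g)"
    using trail_value_cohomologous [OF assms(1) is_group assms(3-6)] by blast
  have "trail_value G A r' C' \<zeta> a = trail_value G A r C \<zeta> a"
    \<comment> \<open>The summand \<open>r\<close> puts the value of \<open>C\<close> in the
      carrier, which is needed to cancel the conjugation.\<close>
    if \<zeta>: "closed_trail_in (good_set A a (m + r)) \<zeta>" for a \<zeta>
  proof -
    have "trail_value G A r C \<zeta> a \<in> carrier G"
      using \<zeta> m(1) by (intro trail_value_closed [OF assms(1) is_group assms(3,5), of _ _ "m + r"])
        (auto simp: closed_trail_in_def)
    moreover have "closed_trail_in (good_set A a m) \<zeta>"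
      by (rule closed_trail_in_good_mono [OF \<zeta>]) simp
    ultimately show ?thesis using m(2) [of a \<zeta>] by (auto simp: comm_group_conjugate [OF assms(2)])
  qed
  then show ?thesis using m(1) by (intro exI [of _ "m + r"]) simp
qed

text \<open>The value at \<open>\<Phi> a\<close> is the value of the pullback at \<open>a\<close>;
  the pullback is cohomologous to \<open>\<phi> \<circ> C\<close>, and over an abelian group
  cohomologous cocycles have equal values on closed trails. The threshold is uniform in
  \<open>a\<close>, which the iteration needs.\<close>

lemma trail_value_endomorphism:
  fixes A :: "(int ^ 'd \<Rightarrow> 'a::finite) set"
  assumes "cellular_automaton \<Phi>" "has_radius \<Phi> R" "\<Phi> ` A \<subseteq> A" "subshift A" "comm_group G"
    "cocycle G A C" "\<phi> \<in> hom G G" "cohomologous G A (pull A \<Phi> C) (\<lambda>z x. \<phi> (C z x))"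
    "locally_determined A r C"
  shows "\<exists>s>0. r \<le> s \<and> (\<forall>a \<zeta>. closed_trail_in (good_set A a s) \<zeta> \<longrightarrow>
    trail_value G A r C \<zeta> (\<Phi> a) = \<phi> (trail_value G A r C \<zeta> a))"
proof -
  interpret comm_group G by fact
  \<comment> \<open>\<open>trail_value_pull\<close> requires a positive radius, and \<open>r\<close>
    may be 0.\<close>
  define q where "q = Suc r"
  have q: "locally_determined A q C"
    by (rule locally_determined_mono [OF assms(9)]) (simp add: q_def)
  have \<phi>q: "locally_determined A q (\<lambda>z x. \<phi> (C z x))"
    using q unfolding locally_determined_iff_window window_def by metis
  obtain m where m: "m > 0" "\<And>a \<zeta>. closed_trail_in (good_set A a m) \<zeta> \<Longrightarrow>
    trail_value G A q (\<lambda>z x. \<phi> (C z x)) \<zeta> a = trail_value G A (R + q) (pull A \<Phi> C) \<zeta> a"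
    using trail_value_cohomologous_comm [OF assms(4,5) cocyclesD(1) [OF pull_in_cocycles [OF assms(1-4,6)]]
        assms(8) locally_determined_pull [OF assms(1-3) q] \<phi>q] by blast
  define s where "s = m + R + q"
  have "trail_value G A r C \<zeta> (\<Phi> a) = \<phi> (trail_value G A r C \<zeta> a)"
    if \<zeta>: "closed_trail_in (good_set A a s) \<zeta>" for a \<zeta>
  proof -
    have tr: "trail \<zeta>" and sub: "set \<zeta> \<subseteq> good_set A a s" using \<zeta> by (auto simp: closed_trail_in_def)
    have sub': "set \<zeta> \<subseteq> good_set A a (R + q)"
      using sub good_set_mono [of "R + q" s A a] by (simp add: s_def)
    then have sub'': "set \<zeta> \<subseteq> good_set A (\<Phi> a) q"
      using good_set_image [OF assms(1-3), of q a] by (simp add: q_def)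
    have "trail_value G A r C \<zeta> (\<Phi> a) = trail_value G A q C \<zeta> (\<Phi> a)"
      by (rule trail_value_radius [OF assms(9) q tr sub'']) (simp_all add: q_def)
    also have "\<dots> = trail_value G A (R + q) (pull A \<Phi> C) \<zeta> a"
      by (rule trail_value_pull [OF assms(1-3) q tr sub']) (simp add: q_def)
    also have "\<dots> = trail_value G A q (\<lambda>z x. \<phi> (C z x)) \<zeta> a"
      by (rule m(2) [symmetric], rule closed_trail_in_good_mono [OF \<zeta>]) (simp add: s_def)
    also have "\<dots> = \<phi> (trail_value G A q C \<zeta> a)"
      by (rule trail_value_hom [OF assms(4) is_group is_group assms(6,7) q tr sub])
         (simp_all add: s_def q_def)
    also have "trail_value G A q C \<zeta> a = trail_value G A r C \<zeta> a"
      by (rule trail_value_radius [OF q assms(9) tr sub]) (simp_all add: q_def s_def)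
    finally show ?thesis .
  qed
  then show ?thesis by (intro exI [of _ s]) (simp add: s_def q_def)
qed

text \<open>The induction hypothesis is applied to \<open>\<Phi> a\<close>, so the new threshold
  must allow for the loss \<open>R\<close> before the old one is reached.\<close>

lemma trail_value_endomorphism_funpow:
  fixes A :: "(int ^ 'd \<Rightarrow> 'a::finite) set"
  assumes "cellular_automaton \<Phi>" "has_radius \<Phi> R" "\<Phi> ` A \<subseteq> A" "subshift A" "comm_group G"
    "cocycle G A C" "\<phi> \<in> hom G G" "cohomologous G A (pull A \<Phi> C) (\<lambda>z x. \<phi> (C z x))"
    "locally_determined A r C"
  shows "\<exists>s>0. r \<le> s \<and> (\<forall>a \<zeta>. closed_trail_in (good_set A a s) \<zeta> \<longrightarrow>
    trail_value G A r C \<zeta> ((\<Phi> ^^ t) a) = (\<phi> ^^ t) (trail_value G A r C \<zeta> a))"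
proof (induction t)
  case 0
  show ?case by (intro exI [of _ "Suc r"]) simp
next
  case (Suc t)
  obtain s where s: "s > 0" "r \<le> s" "\<And>a \<zeta>. closed_trail_in (good_set A a s) \<zeta> \<Longrightarrow>
    trail_value G A r C \<zeta> ((\<Phi> ^^ t) a) = (\<phi> ^^ t) (trail_value G A r C \<zeta> a)"
    using Suc.IH by blast
  obtain m where m: "m > 0" "r \<le> m" "\<And>a \<zeta>. closed_trail_in (good_set A a m) \<zeta> \<Longrightarrow>
    trail_value G A r C \<zeta> (\<Phi> a) = \<phi> (trail_value G A r C \<zeta> a)"
    using trail_value_endomorphism [OF assms] by blast
  have "trail_value G A r C \<zeta> ((\<Phi> ^^ Suc t) a) = (\<phi> ^^ Suc t) (trail_value G A r C \<zeta> a)"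
    if \<zeta>: "closed_trail_in (good_set A a (m + (R + s))) \<zeta>" for a \<zeta>
  proof -
    have \<zeta>': "closed_trail_in (good_set A a (R + s)) \<zeta>" "closed_trail_in (good_set A a m) \<zeta>"
      by (rule closed_trail_in_good_mono [OF \<zeta>]; simp)+
    have "closed_trail_in (good_set A (\<Phi> a) s) \<zeta>"
      by (rule closed_trail_in_mono [OF \<zeta>'(1) good_set_image [OF assms(1-3) s(1)]])
    from s(3) [OF this] show ?thesis by (simp add: funpow_swap1 m(3) [OF \<zeta>'(2)])
  qed
  then show ?case using m(1,2) by (intro exI [of _ "m + (R + s)"]) simp
qed

section \<open>Homotopy invariance\<close>

text \<open>\<open>g\<close> is a flat connection given only between nearby points.\<close>

locale local_transport = group G for G (structure) +
  fixes S :: "'p::metric_space set" and g :: "'p \<Rightarrow> 'p \<Rightarrow> 'g"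
  assumes g_closed: "p \<in> S \<Longrightarrow> q \<in> S \<Longrightarrow> dist p q \<le> 1 \<Longrightarrow> g p q \<in> carrier G"
    and g_comp: "p \<in> S \<Longrightarrow> q \<in> S \<Longrightarrow> o' \<in> S \<Longrightarrow> dist p q \<le> 1 \<Longrightarrow> dist q o' \<le> 1 \<Longrightarrow>
      g q o' \<otimes> g p q = g p o'"
begin

lemma g_refl: "p \<in> S \<Longrightarrow> g p p = \<one>"
  using g_comp [of p p p] g_closed [of p p] by (simp add: r_cancel_one')

text \<open>A parallel section of the connection pulled back along \<open>h\<close>. The uniform
  scale \<open>d\<close> takes the place of a cover of \<open>K\<close> by small pieces.\<close>

definition parallel :: "('t::metric_space \<Rightarrow> 'p) \<Rightarrow> 't set \<Rightarrow> ('t \<Rightarrow> 'g) \<Rightarrow> bool" where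
  "parallel h K F \<longleftrightarrow> F ` K \<subseteq> carrier G \<and>
     (\<exists>d>0. \<forall>x\<in>K. \<forall>y\<in>K. dist x y < d \<longrightarrow> F y = g (h x) (h y) \<otimes> F x)"

lemma parallel_closed: "parallel h K F \<Longrightarrow> t \<in> K \<Longrightarrow> F t \<in> carrier G"
  unfolding parallel_def by blast

text \<open>Transport along the segment from a base point \<open>x0\<close>, cut into \<open>N\<close> short steps \<open>pt i x\<close>.\<close>

lemma parallel_exists:
  fixes K :: "'t::real_normed_vector set"
  assumes "convex K" "compact K" "K \<noteq> {}" "continuous_on K h" "h ` K \<subseteq> S"
  shows "\<exists>F. parallel h K F"
proof -
  obtain x0 where x0: "x0 \<in> K" using assms(3) by blast
  have "uniformly_continuous_on K h" using assms(2,4) compact_uniformly_continuous by blast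
  then obtain d where d: "d > 0" "\<And>x y. x \<in> K \<Longrightarrow> y \<in> K \<Longrightarrow> dist x y < d \<Longrightarrow> dist (h x) (h y) < 1"
    unfolding uniformly_continuous_on_def by (metis zero_less_one)
  obtain B where B: "\<And>x. x \<in> K \<Longrightarrow> dist x0 x \<le> B"
    using compact_imp_bounded [OF assms(2)] bounded_any_center [of K x0] by blast
  \<comment> \<open>Chosen so that steps of length at most \<open>B / N\<close>, which is less than
    \<open>d\<close>, lead from \<open>x0\<close> to any point of \<open>K\<close>.\<close>
  obtain N where N: "real N > B / d" using reals_Archimedean2 by blast
  have "B \<ge> 0" using B [OF x0] by simp
  then have Npos: "N > 0" using N d(1) by (cases N) (auto simp: divide_less_0_iff)
  then have BN: "B / real N < d" using N d(1) by (simp add: field_simps)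
  define pt where "pt i x = x0 + (real i / real N) *\<^sub>R (x - x0)" for i x
  have pt_in: "pt i x \<in> K" if "x \<in> K" "i \<le> N" for i x
  proof -
    have "pt i x = (1 - real i / real N) *\<^sub>R x0 + (real i / real N) *\<^sub>R x"
      by (simp add: pt_def algebra_simps)
    then show ?thesis using convexD [OF assms(1) x0 that(1)] that(2) Npos by simp
  qed
  have hpt: "h (pt i x) \<in> S" if "x \<in> K" "i \<le> N" for i x
    using pt_in [OF that] assms(5) by blast
  have vert: "dist (h (pt i x)) (h (pt i y)) \<le> 1" if "x \<in> K" "y \<in> K" "i \<le> N" "dist x y < d" for i x y
  proof -
    have "dist (pt i x) (pt i y) = (real i / real N) * dist x y"
      by (simp add: pt_def dist_norm flip: scaleR_right_diff_distrib)
    also have "\<dots> \<le> 1 * dist x y"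
      using that(3) Npos by (intro mult_right_mono) simp_all
    finally have "dist (pt i x) (pt i y) < d" using that(4) by simp
    then show ?thesis using d(2) pt_in that less_imp_le by blast
  qed
  have horiz: "dist (h (pt i x)) (h (pt (Suc i) x)) \<le> 1" if "x \<in> K" "Suc i \<le> N" for i x
  proof -
    have "pt i x - pt (Suc i) x = (- 1 / real N) *\<^sub>R (x - x0)"
      using Npos by (simp add: pt_def add_divide_distrib algebra_simps)
    then have "dist (pt i x) (pt (Suc i) x) = dist x0 x / real N"
      by (simp add: dist_norm norm_minus_commute)
    also have "\<dots> \<le> B / real N" using B [OF that(1)] by (simp add: divide_right_mono)
    finally have "dist (pt i x) (pt (Suc i) x) < d" using BN by simp
    then show ?thesis using d(2) pt_in that less_imp_le by (meson Suc_leD)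
  qed
  define Fs where "Fs x = rec_nat \<one> (\<lambda>i u. g (h (pt i x)) (h (pt (Suc i) x)) \<otimes> u)" for x
  have Fs0: "Fs x 0 = \<one>" and FsS: "Fs x (Suc i) = g (h (pt i x)) (h (pt (Suc i) x)) \<otimes> Fs x i" for x i
    by (simp_all add: Fs_def)
  have closed: "i \<le> N \<Longrightarrow> Fs x i \<in> carrier G" if "x \<in> K" for x i
    by (induction i) (simp_all add: Fs0 FsS g_closed hpt horiz that)
  \<comment> \<open>The segments to \<open>x\<close> and \<open>y\<close> are followed
    simultaneously. They cut out thin quadrilaterals, and both ways around one equal transport along
    its diagonal. The diagonal may be longer than 1, which \<open>g_comp\<close> permits.\<close>
  have step: "i \<le> N \<Longrightarrow> Fs y i = g (h (pt i x)) (h (pt i y)) \<otimes> Fs x i"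
    if xy: "x \<in> K" "y \<in> K" "dist x y < d" for x y i
  proof (induction i)
    case 0
    have "pt 0 x = x0" "pt 0 y = x0" by (simp_all add: pt_def)
    then show ?case using g_refl [of "h x0"] x0 assms(5) by (auto simp: Fs0)
  next
    case (Suc i)
    then have i: "i \<le> N" by simp
    let ?x = "h (pt i x)" and ?y = "h (pt i y)" and ?x' = "h (pt (Suc i) x)" and ?y' = "h (pt (Suc i) y)"
    note S = hpt [OF xy(1) i] hpt [OF xy(2) i] hpt [OF xy(1) Suc.prems] hpt [OF xy(2) Suc.prems]
    note D = vert [OF xy(1,2) i xy(3)] vert [OF xy(1,2) Suc.prems xy(3)]
      horiz [OF xy(1) Suc.prems] horiz [OF xy(2) Suc.prems]
    note c = g_closed [OF S(1,2) D(1)] g_closed [OF S(3,4) D(2)] g_closed [OF S(1,3) D(3)]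
      g_closed [OF S(2,4) D(4)] closed [OF xy(1) i]
    have "Fs y (Suc i) = g ?y ?y' \<otimes> (g ?x ?y \<otimes> Fs x i)" using Suc.IH [OF i] by (simp add: FsS)
    also have "\<dots> = g ?x ?y' \<otimes> Fs x i"
      using c g_comp [OF S(1,2,4) D(1,4)] by (simp add: m_assoc [symmetric])
    also have "\<dots> = g ?x' ?y' \<otimes> (g ?x ?x' \<otimes> Fs x i)"
      using c g_comp [OF S(1,3,4) D(3,2)] by (simp add: m_assoc [symmetric])
    finally show ?case by (simp add: FsS)
  qed
  have ptN: "pt N x = x" for x using Npos by (simp add: pt_def)
  have "parallel h K (\<lambda>x. Fs x N)"
    unfolding parallel_def
  proof (intro conjI exI [of _ d] ballI impI d(1))
    show "(\<lambda>x. Fs x N) ` K \<subseteq> carrier G" using closed by blast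
    fix x y assume "x \<in> K" "y \<in> K" "dist x y < d"
    from step [OF this order_refl] show "Fs y N = g (h x) (h y) \<otimes> Fs x N" by (simp only: ptN)
  qed
  then show ?thesis by (intro exI)
qed

text \<open>One parallel section over the whole homotopy square restricts to a section on each row,
  where \<open>F 1 \<otimes> inv (F 0)\<close> is the holonomy. Holonomies of nearby rows are
  conjugate, and the Bolzano principle chains these conjugations from row 0 to row 1.\<close>

lemma homotopic_loops_parallel:
  assumes "homotopic_loops S p q"
  shows "\<exists>F F' k. parallel p {0..1} F \<and> parallel q {0..1} F' \<and> k \<in> carrier G \<and>
    F' 1 \<otimes> inv (F' 0) = k \<otimes> (F 1 \<otimes> inv (F 0)) \<otimes> inv k"
proof -
  let ?K = "{0..1::real} \<times> {0..1::real}"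
  obtain h where h: "continuous_on ?K h" "h \<in> ?K \<rightarrow> S"
    and hp: "\<And>x. x \<in> {0..1} \<Longrightarrow> h (0, x) = p x" and hq: "\<And>x. x \<in> {0..1} \<Longrightarrow> h (1, x) = q x"
    and loop: "\<forall>t \<in> {0..1}. pathfinish (h \<circ> Pair t) = pathstart (h \<circ> Pair t)"
    using assms unfolding homotopic_loops by blast
  have hS: "h ` ?K \<subseteq> S" using h(2) by blast
  obtain F where "parallel h ?K F"
    using parallel_exists [OF _ _ _ h(1) hS] by (auto simp: convex_Times compact_Times)
  then obtain d where d: "d > 0" and FK: "F ` ?K \<subseteq> carrier G"
    and F: "\<And>x y. x \<in> ?K \<Longrightarrow> y \<in> ?K \<Longrightarrow> dist x y < d \<Longrightarrow> F y = g (h x) (h y) \<otimes> F x"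
    unfolding parallel_def by blast
  have Fc: "F (s, x) \<in> carrier G" if "s \<in> {0..1}" "x \<in> {0..1}" for s x
    using FK that by auto
  have row: "parallel r {0..1} (\<lambda>x. F (s, x))" if "s \<in> {0..1}" "\<And>x. x \<in> {0..1} \<Longrightarrow> h (s, x) = r x" for s r
    unfolding parallel_def
  proof (intro conjI exI [of _ d] ballI impI d)
    show "(\<lambda>x. F (s, x)) ` {0..1} \<subseteq> carrier G" using Fc that(1) by blast
    fix x y :: real assume xy: "x \<in> {0..1}" "y \<in> {0..1}" "dist x y < d"
    then show "F (s, y) = g (r x) (r y) \<otimes> F (s, x)"
      using F [of "(s, x)" "(s, y)"] that by (simp add: dist_Pair_Pair)
  qed
  have unif: "uniformly_continuous_on ?K h"
    by (rule compact_uniformly_continuous [OF h(1)]) (simp add: compact_Times)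
  \<comment> \<open>A second scale: \<open>d\<close> makes the transport formula valid but does not
    bound distances of image points, and the conjugator must lie in the carrier.\<close>
  then obtain e where e: "e > 0" "\<And>x y. x \<in> ?K \<Longrightarrow> y \<in> ?K \<Longrightarrow> dist x y < e \<Longrightarrow> dist (h x) (h y) < 1"
    unfolding uniformly_continuous_on_def by (metis zero_less_one)
  define hol where "hol s = F (s, 1) \<otimes> inv (F (s, 0))" for s
  have holc: "hol s \<in> carrier G" if "s \<in> {0..1}" for s using Fc that by (simp add: hol_def)
  have "0 \<le> (0::real) \<and> 1 \<le> (1::real) \<longrightarrow> (\<exists>k\<in>carrier G. hol 1 = k \<otimes> hol 0 \<otimes> inv k)"
  proof (rule Bolzano [of 0 1 "\<lambda>a b. 0 \<le> a \<and> b \<le> 1 \<longrightarrow> (\<exists>k\<in>carrier G. hol b = k \<otimes> hol a \<otimes> inv k)"])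
    fix a b c :: real
    assume ab: "0 \<le> a \<and> b \<le> 1 \<longrightarrow> (\<exists>k\<in>carrier G. hol b = k \<otimes> hol a \<otimes> inv k)"
      and bc: "0 \<le> b \<and> c \<le> 1 \<longrightarrow> (\<exists>k\<in>carrier G. hol c = k \<otimes> hol b \<otimes> inv k)"
      and le: "a \<le> b" "b \<le> c"
    show "0 \<le> a \<and> c \<le> 1 \<longrightarrow> (\<exists>k\<in>carrier G. hol c = k \<otimes> hol a \<otimes> inv k)"
    proof
      assume ac: "0 \<le> a \<and> c \<le> 1"
      then obtain k l where k: "k \<in> carrier G" "hol b = k \<otimes> hol a \<otimes> inv k"
        and l: "l \<in> carrier G" "hol c = l \<otimes> hol b \<otimes> inv l"
        using ab bc le by force
      have "hol a \<in> carrier G" using ac le by (intro holc) auto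
      then have "hol c = (l \<otimes> k) \<otimes> hol a \<otimes> inv (l \<otimes> k)"
        using k l by (simp add: m_assoc inv_mult_group)
      then show "\<exists>k\<in>carrier G. hol c = k \<otimes> hol a \<otimes> inv k" using k l by blast
    qed
  next
    fix x :: real
    have "0 \<le> a \<and> b \<le> 1 \<longrightarrow> (\<exists>k\<in>carrier G. hol b = k \<otimes> hol a \<otimes> inv k)"
      if "a \<le> x \<and> x \<le> b \<and> b - a < min d e" for a b
    proof
      assume "0 \<le> a \<and> b \<le> 1"
      then have ab: "a \<in> {0..1}" "b \<in> {0..1}" using that by auto
      have dist: "dist (a, y) (b, y) < min d e" for y :: real
        using that by (simp add: dist_Pair_Pair dist_real_def)
      have F1: "F (b, y) = g (h (a, y)) (h (b, y)) \<otimes> F (a, y)" if "y \<in> {0..1}" for y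
        using F [of "(a, y)" "(b, y)"] ab that dist [of y] by simp
      \<comment> \<open>Since every row is a loop, passing to the next row multiplies
        \<open>F\<close> by the same factor \<open>?k\<close> at both ends; in the holonomy this
        becomes a conjugation.\<close>
      have eq: "h (t, 1) = h (t, 0)" if "t \<in> {0..1}" for t
        using loop that by (auto simp: pathfinish_def pathstart_def)
      let ?k = "g (h (a, 0)) (h (b, 0))"
      have k: "?k \<in> carrier G"
        using hS ab dist [of 0] e(2) [of "(a, 0)" "(b, 0)"] by (intro g_closed) auto
      have "hol b = (?k \<otimes> F (a, 1)) \<otimes> inv (?k \<otimes> F (a, 0))"
        unfolding hol_def using F1 [of 1] F1 [of 0] eq ab by simp
      also have "\<dots> = ?k \<otimes> hol a \<otimes> inv ?k"
        using k Fc ab by (simp add: hol_def inv_mult_group m_assoc)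
      finally show "\<exists>k\<in>carrier G. hol b = k \<otimes> hol a \<otimes> inv k" using k by blast
    qed
    then show "\<exists>d>0. \<forall>a b. a \<le> x \<and> x \<le> b \<and> b - a < d \<longrightarrow>
        0 \<le> a \<and> b \<le> 1 \<longrightarrow> (\<exists>k\<in>carrier G. hol b = k \<otimes> hol a \<otimes> inv k)"
      using d e(1) by (intro exI [of _ "min d e"]) auto
  qed simp
  then obtain k where "k \<in> carrier G" "hol 1 = k \<otimes> hol 0 \<otimes> inv k" by auto
  then show ?thesis
    using row [of 0 p] row [of 1 q] hp hq unfolding hol_def
    by (intro exI [of _ "\<lambda>x. F (0, x)"] exI [of _ "\<lambda>x. F (1, x)"] exI [of _ k]) auto
qed

text \<open>All points of the path are within distance 1 of each other, so the factors of any
  subdivision merge by \<open>g_comp\<close> into the one between the endpoints.\<close>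

lemma parallel_short:
  assumes "parallel p {0..1::real} F" "p ` {0..1} \<subseteq> S"
    "\<And>x y. x \<in> {0..1} \<Longrightarrow> y \<in> {0..1} \<Longrightarrow> dist (p x) (p y) \<le> 1"
  shows "F 1 = g (p 0) (p 1) \<otimes> F 0"
proof -
  obtain d where d: "d > 0" and FK: "F ` {0..1} \<subseteq> carrier G"
    and F: "\<And>x y. x \<in> {0..1} \<Longrightarrow> y \<in> {0..1} \<Longrightarrow> dist x y < d \<Longrightarrow> F y = g (p x) (p y) \<otimes> F x"
    using assms(1) unfolding parallel_def by blast
  have "0 \<le> (0::real) \<and> 1 \<le> (1::real) \<longrightarrow> F 1 = g (p 0) (p 1) \<otimes> F 0"
  proof (rule Bolzano [of 0 1 "\<lambda>a b. 0 \<le> a \<and> b \<le> 1 \<longrightarrow> F b = g (p a) (p b) \<otimes> F a"])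
    fix a b c :: real
    assume ab: "0 \<le> a \<and> b \<le> 1 \<longrightarrow> F b = g (p a) (p b) \<otimes> F a"
      and bc: "0 \<le> b \<and> c \<le> 1 \<longrightarrow> F c = g (p b) (p c) \<otimes> F b" and le: "a \<le> b" "b \<le> c"
    show "0 \<le> a \<and> c \<le> 1 \<longrightarrow> F c = g (p a) (p c) \<otimes> F a"
    proof
      assume ac: "0 \<le> a \<and> c \<le> 1"
      then have I: "a \<in> {0..1}" "b \<in> {0..1}" "c \<in> {0..1}" using le by auto
      then have S: "p a \<in> S" "p b \<in> S" "p c \<in> S" using assms(2) by auto
      note D = assms(3) [OF I(1,2)] assms(3) [OF I(2,3)]
      have "F c = g (p b) (p c) \<otimes> (g (p a) (p b) \<otimes> F a)" using ab bc le ac by simp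
      also have "\<dots> = g (p a) (p c) \<otimes> F a"
        using g_closed [OF S(1,2) D(1)] g_closed [OF S(2,3) D(2)] FK I(1) g_comp [OF S D]
        by (simp add: m_assoc [symmetric] image_subset_iff)
      finally show "F c = g (p a) (p c) \<otimes> F a" .
    qed
  next
    fix x :: real
    show "\<exists>d>0. \<forall>a b. a \<le> x \<and> x \<le> b \<and> b - a < d \<longrightarrow>
        0 \<le> a \<and> b \<le> 1 \<longrightarrow> F b = g (p a) (p b) \<otimes> F a"
      using d by (intro exI [of _ d]) (auto simp: dist_real_def intro!: F)
  qed simp
  then show ?thesis by simp
qed

lemma parallel_join:
  assumes "parallel (p +++ q) {0..1} F" "pathfinish p = pathstart q"
  shows "parallel p {0..1} (\<lambda>t. F (t / 2))" "parallel q {0..1} (\<lambda>t. F ((t + 1) / 2))"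
proof -
  obtain d where d: "d > 0" and FK: "F ` {0..1} \<subseteq> carrier G"
    and F: "\<And>x y. x \<in> {0..1} \<Longrightarrow> y \<in> {0..1} \<Longrightarrow> dist x y < d \<Longrightarrow>
      F y = g ((p +++ q) x) ((p +++ q) y) \<otimes> F x"
    using assms(1) unfolding parallel_def by blast
  have p: "(p +++ q) (t / 2) = p t" if "t \<in> {0..1}" for t
    using that by (simp add: joinpaths_def)
  have q: "(p +++ q) ((t + 1) / 2) = q t" if "t \<in> {0..1}" for t
    using that assms(2)
    by (cases "t = 0") (auto simp: joinpaths_def pathfinish_def pathstart_def add_divide_distrib)
  have "F (y / 2) = g (p x) (p y) \<otimes> F (x / 2)" if "x \<in> {0..1}" "y \<in> {0..1}" "dist x y < d" for x y
    using F [of "x / 2" "y / 2"] that p by (simp add: dist_real_def)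
  moreover have "F ((y + 1) / 2) = g (q x) (q y) \<otimes> F ((x + 1) / 2)"
    if "x \<in> {0..1}" "y \<in> {0..1}" "dist x y < d" for x y
    using F [of "(x + 1) / 2" "(y + 1) / 2"] that q
    by (simp add: dist_real_def flip: diff_divide_distrib)
  moreover have "(\<lambda>t. F (t / 2)) ` {0..1} \<subseteq> carrier G" "(\<lambda>t. F ((t + 1) / 2)) ` {0..1} \<subseteq> carrier G"
    using FK by (auto simp: image_subset_iff)
  ultimately show "parallel p {0..1} (\<lambda>t. F (t / 2))" "parallel q {0..1} (\<lambda>t. F ((t + 1) / 2))"
    using d unfolding parallel_def by blast+
qed

end

section \<open>Trails as piecewise linear paths\<close>

lemma path_trail_path [simp]: "path (trail_path \<zeta>)"
  and pathstart_trail_path: "\<zeta> \<noteq> [] \<Longrightarrow> pathstart (trail_path \<zeta>) = real_point (hd \<zeta>)"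
  by (induction \<zeta> rule: trail_path.induct) (simp_all add: path_join_imp)

lemma pathfinish_trail_path: "\<zeta> \<noteq> [] \<Longrightarrow> pathfinish (trail_path \<zeta>) = real_point (last \<zeta>)"
  by (induction \<zeta> rule: trail_path.induct) simp_all

lemma real_point_in_trail_path: "z \<in> set \<zeta> \<Longrightarrow> real_point z \<in> path_image (trail_path \<zeta>)"
  by (induction \<zeta> rule: trail_path.induct) (auto simp: path_image_join pathstart_trail_path)

lemma dist_real_point_steps: "w - z \<in> steps \<Longrightarrow> dist (real_point z) (real_point w) = 1"
proof -
  assume "w - z \<in> steps"
  then obtain i where i: "w - z = axis i 1 \<or> w - z = - axis i 1" by (auto simp: steps_def)
  have *: "real_point (axis i 1) = axis i 1" "real_point (- axis i 1) = - axis i 1"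
    by (simp_all add: real_point_def vec_eq_iff axis_def)
  have "real_point w - real_point z = real_point (w - z)"
    by (simp add: real_point_def vec_eq_iff)
  then have "norm (real_point w - real_point z) = 1" using i by (auto simp: norm_axis_1 *)
  then show ?thesis by (simp add: dist_norm norm_minus_commute)
qed

context
  fixes G (structure) and S :: "(real ^ 'd) set" and g
  assumes transport: "local_transport G S g"
begin

interpretation local_transport G S g by (rule transport)

lemma path_prod_edges_closed:
  assumes "trail \<zeta>" "path_image (trail_path \<zeta>) \<subseteq> S"
  shows "path_prod G (\<lambda>z w. g (real_point z) (real_point w)) \<zeta> \<in> carrier G"
proof (intro path_prod_closed is_monoid successively_trail [OF assms(1)])
  fix u v assume "u \<in> set \<zeta>" "v \<in> set \<zeta>" "v - u \<in> steps"
  then show "g (real_point u) (real_point v) \<in> carrier G"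
    using assms(2) real_point_in_trail_path by (intro g_closed) (auto simp: dist_real_point_steps)
qed

text \<open>Each edge has length 1 and is therefore short in the sense of
  \<open>parallel_short\<close>, which turns the transport along it into a single factor.\<close>

lemma parallel_trail_path:
  assumes "trail \<zeta>" "path_image (trail_path \<zeta>) \<subseteq> S" "parallel (trail_path \<zeta>) {0..1} F"
  shows "F 1 = path_prod G (\<lambda>z w. g (real_point z) (real_point w)) \<zeta> \<otimes> F 0"
  using assms
proof (induction \<zeta> arbitrary: F rule: induct_list012)
  case 1
  then show ?case by (simp add: trail_def)
next
  case (2 z)
  have "real_point z \<in> S" using 2 by simp
  then have "F 1 = g (real_point z) (real_point z) \<otimes> F 0"
    using parallel_short [OF 2(3)] by (simp add: image_subset_iff)
  then show ?case using \<open>real_point z \<in> S\<close> by (simp add: g_refl)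
next
  case (3 z w \<zeta>)
  let ?l = "linepath (real_point z) (real_point w)" and ?t = "trail_path (w # \<zeta>)"
  have tr: "trail (w # \<zeta>)" and st: "w - z \<in> steps" using "3.prems"(1) by (auto simp: trail_def)
  have fs: "pathfinish ?l = pathstart ?t" by (simp add: pathstart_trail_path)
  have img: "path_image ?l \<subseteq> S" "path_image ?t \<subseteq> S"
    using "3.prems"(2) fs by (simp_all add: path_image_join)
  have par: "parallel (?l +++ ?t) {0..1} F" using "3.prems"(3) by simp
  note par = parallel_join [OF par fs]
  have Fc: "F t \<in> carrier G" if "t \<in> {0..1}" for t using "3.prems"(3) that by (rule parallel_closed)
  have ends: "real_point z \<in> S" "real_point w \<in> S" using img(1) by auto
  have d: "dist (real_point z) (real_point w) = 1" by (rule dist_real_point_steps [OF st])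
  have "dist (?l x) (?l y) \<le> 1" if "x \<in> {0..1}" "y \<in> {0..1}" for x y
  proof -
    have "?l x - ?l y = (x - y) *\<^sub>R (real_point w - real_point z)"
      by (simp add: linepath_def algebra_simps)
    then have "dist (?l x) (?l y) = \<bar>x - y\<bar>" using d by (simp add: dist_norm norm_minus_commute)
    then show ?thesis using that by auto
  qed
  from parallel_short [OF par(1) _ this] img(1)
  have F1: "F (1 / 2) = g (real_point z) (real_point w) \<otimes> F 0"
    by (simp add: path_image_def linepath_0' linepath_1')
  have "F 1 = path_prod G (\<lambda>z w. g (real_point z) (real_point w)) (w # \<zeta>) \<otimes> F (1 / 2)"
    using "3.IH"(2) [OF tr img(2) par(2)] by simp
  moreover note path_prod_edges_closed [OF tr img(2)]
  ultimately show ?case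
    using F1 g_closed [OF ends] d Fc [of 0] by (simp add: m_assoc)
qed

lemma homotopic_trails_conjugate:
  assumes "trail \<zeta>" "trail \<zeta>'" "homotopic_loops S (trail_path \<zeta>) (trail_path \<zeta>')"
  shows "\<exists>k\<in>carrier G. path_prod G (\<lambda>z w. g (real_point z) (real_point w)) \<zeta>' =
    k \<otimes> path_prod G (\<lambda>z w. g (real_point z) (real_point w)) \<zeta> \<otimes> inv k"
proof -
  obtain F F' k where F: "parallel (trail_path \<zeta>) {0..1} F" "parallel (trail_path \<zeta>') {0..1} F'"
    and k: "k \<in> carrier G" "F' 1 \<otimes> inv (F' 0) = k \<otimes> (F 1 \<otimes> inv (F 0)) \<otimes> inv k"
    using homotopic_loops_parallel [OF assms(3)] by blast
  note img = homotopic_loops_imp_subset [OF assms(3)]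
  have c: "F 0 \<in> carrier G" "F' 0 \<in> carrier G" by (simp_all add: parallel_closed [OF F(1)] parallel_closed [OF F(2)])
  note pc = path_prod_edges_closed
  have "F 1 \<otimes> inv (F 0) = path_prod G (\<lambda>z w. g (real_point z) (real_point w)) \<zeta>"
    using parallel_trail_path [OF assms(1) _ F(1)] img pc [OF assms(1)] c by (simp add: m_assoc)
  moreover have "F' 1 \<otimes> inv (F' 0) = path_prod G (\<lambda>z w. g (real_point z) (real_point w)) \<zeta>'"
    using parallel_trail_path [OF assms(2) _ F(2)] img pc [OF assms(2)] c by (simp add: m_assoc)
  ultimately show ?thesis using k by metis
qed

end

section \<open>Cocycles as flat connections on unions of cubes\<close>

definition floor_point :: "real ^ 'd \<Rightarrow> int ^ 'd" where
  "floor_point p = (\<chi> i. \<lfloor>p $ i\<rfloor>)"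

lemma floor_point_real_point [simp]: "floor_point (real_point z) = z"
  by (simp add: floor_point_def real_point_def)

text \<open>On an upper face of the cube the floor is the upper corner, so rounding down never
  leaves a closed cube.\<close>

lemma floor_point_corner:
  assumes "p \<in> cbox (real_point z) (real_point z + (\<chi> i. 1))"
  shows "(floor_point p - z) $ i \<in> {0, 1}"
proof -
  have "real_of_int (z $ i) \<le> p $ i" "p $ i \<le> real_of_int (z $ i) + 1"
    using assms by (auto simp: mem_box_cart real_point_def)
  then show ?thesis unfolding floor_point_def by simp linarith
qed

lemma floor_point_in:
  assumes "p \<in> cubes Y"
  shows "floor_point p \<in> Y"
proof -
  obtain z where z: "\<And>e. (\<forall>i. e $ i \<in> {0, 1}) \<Longrightarrow> z + e \<in> Y"
    and p: "p \<in> cbox (real_point z) (real_point z + (\<chi> i. 1))"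
    using assms unfolding cubes_def by blast
  have "z + (floor_point p - z) \<in> Y" by (rule z) (use floor_point_corner [OF p] in blast)
  then show ?thesis by simp
qed

lemma floor_point_near:
  assumes "dist p q \<le> 1"
  shows "floor_point q - floor_point p \<in> box_ball 1"
  unfolding box_ball_iff
proof
  fix i
  have "\<bar>(q - p) $ i\<bar> \<le> norm (q - p)" by (rule component_le_norm_cart)
  then have "\<bar>q $ i - p $ i\<bar> \<le> 1" using assms by (simp add: dist_norm norm_minus_commute)
  then show "\<bar>(floor_point q - floor_point p) $ i\<bar> \<le> int 1"
    unfolding floor_point_def by simp linarith
qed

text \<open>The threshold depends only on \<open>C\<close> and \<open>r\<close>. The trails need not
  be assumed closed or inside \<open>Y\<close>: the free homotopy in \<open>cubes Y\<close> already
  forces both.\<close>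

lemma trail_value_homotopic:
  fixes A :: "(int ^ 'd \<Rightarrow> 'a::finite) set"
  assumes "subshift A" "group G" "cocycle G A C" "locally_determined A r C"
  shows "\<exists>s0>0. r \<le> s0 \<and> (\<forall>s\<ge>s0. \<forall>a Y \<zeta> \<zeta>'. Y \<subseteq> good_set A a s \<longrightarrow> trail \<zeta> \<longrightarrow> trail \<zeta>' \<longrightarrow>
    homotopic_loops (cubes Y) (trail_path \<zeta>) (trail_path \<zeta>') \<longrightarrow>
    (\<exists>k\<in>carrier G. trail_value G A r C \<zeta>' a = k \<otimes>\<^bsub>G\<^esub> trail_value G A r C \<zeta> a \<otimes>\<^bsub>G\<^esub> inv\<^bsub>G\<^esub> k))"
proof -
  obtain m where m: "\<And>z. z \<in> box_ball 1 \<Longrightarrow> window A m (C z)"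
    using cocycle_locally_determined [OF assms(1,3)] by blast
  \<comment> \<open>In the threshold \<open>m + r + 1\<close>, \<open>m\<close> is the window of
    \<open>C\<close> for displacements in \<open>box_ball 1\<close>, \<open>1\<close> pays for
    moving the witness by one such displacement, and \<open>r\<close> is for the local rule.\<close>
  have "\<exists>k\<in>carrier G. trail_value G A r C \<zeta>' a = k \<otimes>\<^bsub>G\<^esub> trail_value G A r C \<zeta> a \<otimes>\<^bsub>G\<^esub> inv\<^bsub>G\<^esub> k"
    if s: "s \<ge> m + r + 1" and Y: "Y \<subseteq> good_set A a s" and tr: "trail \<zeta>" "trail \<zeta>'"
      and hom: "homotopic_loops (cubes Y) (trail_path \<zeta>) (trail_path \<zeta>')" for s a Y \<zeta> \<zeta>'
  proof -
    let ?X = "match_at A a s"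
    have X: "matches A a s (floor_point p) (?X (floor_point p))" if "p \<in> cubes Y" for p
      using Y floor_point_in [OF that] s by (intro matches_match_at) auto
    \<comment> \<open>\<open>g\<close> uses the witness at the rounded point and jumps as a point
      crosses a lattice hyperplane; the locale asks for no continuity.\<close>
    define g where "g p q = C (floor_point q - floor_point p) (?X (floor_point p))" for p q
    interpret local_transport G "cubes Y" g
    proof (intro local_transport.intro assms(2) local_transport_axioms.intro)
      fix p q assume "p \<in> cubes Y"
      then show "g p q \<in> carrier G"
        unfolding g_def by (intro cocycle_in_carrier [OF assms(1,3)] matches_in [OF X])
    next
      fix p q o' assume S: "p \<in> cubes Y" "q \<in> cubes Y" "o' \<in> cubes Y"
        and D: "dist p q \<le> 1" "dist q o' \<le> 1"
      let ?u = "floor_point q - floor_point p" and ?v = "floor_point o' - floor_point q"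
      \<comment> \<open>Once the witness at \<open>q\<close> is replaced by the shifted witness at
        \<open>p\<close>, the composition law is the cocycle identity.\<close>
      have "C ?v (?X (floor_point q)) = C ?v (shift ?u (?X (floor_point p)))"
      proof (rule window_matches [OF m [OF floor_point_near [OF D(2)]]])
        show "matches A a m (floor_point q) (?X (floor_point q))"
          by (rule matches_mono [OF X [OF S(2)]]) (use s in simp)
        have "matches A a (m + 1) (floor_point p) (?X (floor_point p))"
          by (rule matches_mono [OF X [OF S(1)]]) (use s in simp)
        from matches_shift [OF assms(1) this floor_point_near [OF D(1)]]
        show "matches A a m (floor_point q) (shift ?u (?X (floor_point p)))" by simp
      qed
      then show "g q o' \<otimes>\<^bsub>G\<^esub> g p q = g p o'"
        using cocycle_shift [OF assms(1,3) matches_in [OF X [OF S(1)]], of ?v ?u]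
        by (simp add: g_def)
    qed
    have val: "trail_value G A r C \<eta> a = path_prod G (\<lambda>z w. g (real_point z) (real_point w)) \<eta>"
      if "trail \<eta>" "path_image (trail_path \<eta>) \<subseteq> cubes Y" for \<eta>
    proof -
      \<comment> \<open>The vertices lie on the path, hence in \<open>cubes Y\<close>, and are their
        own floors.\<close>
      have "set \<eta> \<subseteq> Y"
        using that(2) real_point_in_trail_path floor_point_in floor_point_real_point by (metis subset_iff)
      then show ?thesis
        using Y s by (simp add: g_def) (intro trail_value_match_at [OF assms(4) that(1)]; auto)
    qed
    show ?thesis
      using homotopic_trails_conjugate [OF local_transport_axioms tr hom] homotopic_loops_imp_subset [OF hom]
      by (simp add: val tr)
  qed
  then show ?thesis by (intro exI [of _ "m + r + 1"]) auto
qed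

section \<open>Loops are homotopic to trails\<close>

definition lattice_cube :: "int ^ 'd \<Rightarrow> (real ^ 'd) set" where
  "lattice_cube z = cbox (real_point z) (real_point z + (\<chi> i. 1))"

definition full_cubes :: "(int ^ 'd) set \<Rightarrow> (int ^ 'd) set" where
  "full_cubes Y = {z. \<forall>e. (\<forall>i. e $ i \<in> {0, 1}) \<longrightarrow> z + e \<in> Y}"

lemma cubes_eq: "cubes Y = (\<Union>z\<in>full_cubes Y. lattice_cube z)"
  by (simp add: cubes_def full_cubes_def lattice_cube_def)

lemma cubes_mono: "Y \<subseteq> Z \<Longrightarrow> cubes Y \<subseteq> cubes Z"
  unfolding cubes_def by blast

lemma in_lattice_cube: "p \<in> lattice_cube z \<longleftrightarrow> (\<forall>i. of_int (z $ i) \<le> p $ i \<and> p $ i \<le> of_int (z $ i) + 1)"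
  by (simp add: lattice_cube_def mem_box_cart real_point_def)

lemma convex_lattice_cube: "convex (lattice_cube z)"
  by (simp add: lattice_cube_def)

lemma real_point_in_lattice_cube:
  "real_point w \<in> lattice_cube z \<longleftrightarrow> (\<forall>i. (w - z) $ i \<in> {0, 1})"
proof -
  have "real_of_int m \<le> real_of_int n \<and> real_of_int n \<le> real_of_int m + 1 \<longleftrightarrow> n - m \<in> {0, 1}" for m n
    by auto
  then show ?thesis by (simp add: in_lattice_cube real_point_def)
qed

lemma corner_in:
  assumes "z \<in> full_cubes Y" "real_point w \<in> lattice_cube z"
  shows "w \<in> Y"
proof -
  have "z + (w - z) \<in> Y" using assms unfolding full_cubes_def real_point_in_lattice_cube by blast
  then show ?thesis by simp
qed

lemma floor_point_in_lattice_cube: "p \<in> lattice_cube z \<Longrightarrow> real_point (floor_point p) \<in> lattice_cube z"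
  unfolding real_point_in_lattice_cube unfolding lattice_cube_def using floor_point_corner by blast

lemma path_image_trail_path_convex:
  assumes "convex K" "\<zeta> \<noteq> []" "real_point ` set \<zeta> \<subseteq> K"
  shows "path_image (trail_path \<zeta>) \<subseteq> K"
  using assms(2,3)
proof (induction \<zeta> rule: induct_list012)
  case (3 z w \<zeta>)
  then have "path_image (trail_path (w # \<zeta>)) \<subseteq> K" by simp
  moreover have "closed_segment (real_point z) (real_point w) \<subseteq> K"
    using 3 assms(1) by (simp add: closed_segment_subset)
  ultimately show ?case by (simp add: path_image_join pathstart_trail_path)
qed simp_all

text \<open>Correct one differing coordinate at a time. Within a cube such a correction is a unit
  step, and every intermediate vertex takes each coordinate from \<open>u\<close> or from
  \<open>w\<close>, so it is again a corner.\<close>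

lemma trail_in_lattice_cube:
  assumes "real_point u \<in> lattice_cube z" "real_point w \<in> lattice_cube z"
  shows "\<exists>\<zeta>. trail \<zeta> \<and> hd \<zeta> = u \<and> last \<zeta> = w \<and> real_point ` set \<zeta> \<subseteq> lattice_cube z"
  using assms(1)
proof (induction "card {i. u $ i \<noteq> w $ i}" arbitrary: u)
  case 0
  then have "u = w" by (simp add: vec_eq_iff)
  then show ?case using 0 by (intro exI [of _ "[w]"]) (simp add: trail_def)
next
  case (Suc n)
  then obtain i where i: "u $ i \<noteq> w $ i"
    by (metis (mono_tags, lifting) card.empty empty_Collect_eq nat.distinct(1))
  define u' where "u' = (\<chi> j. if j = i then w $ i else u $ j)"
  have "{j. u $ j \<noteq> w $ j} = insert i {j. u' $ j \<noteq> w $ j}" "i \<notin> {j. u' $ j \<noteq> w $ j}"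
    using i by (auto simp: u'_def)
  then have n: "n = card {j. u' $ j \<noteq> w $ j}" using Suc.hyps(2) by simp
  have u': "real_point u' \<in> lattice_cube z"
    using Suc.prems assms(2) by (auto simp: real_point_in_lattice_cube u'_def)
  have "(u - z) $ i \<in> {0, 1}" "(w - z) $ i \<in> {0, 1}"
    using Suc.prems assms(2) by (auto simp only: real_point_in_lattice_cube)
  then have "w $ i - u $ i = 1 \<or> w $ i - u $ i = -1" using i by auto
  then have "u' - u = axis i 1 \<or> u' - u = - axis i 1"
    by (auto simp: u'_def vec_eq_iff axis_def)
  then have step: "u' - u \<in> steps" by (auto simp: steps_def)
  obtain \<zeta> where \<zeta>: "trail \<zeta>" "hd \<zeta> = u'" "last \<zeta> = w" "real_point ` set \<zeta> \<subseteq> lattice_cube z"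
    using Suc.hyps(1) [OF n u'] by blast
  have "trail (u # \<zeta>)" using \<zeta>(1,2) step by (cases \<zeta>) (auto simp: trail_def)
  then show ?case using \<zeta> Suc.prems by (intro exI [of _ "u # \<zeta>"]) (auto simp: trail_def)
qed

text \<open>Used both for a single convex cube and for the star-shaped neighbourhoods in
  \<open>edge_homotopic_path\<close>, which need not be convex.\<close>

lemma starlike_homotopic_paths:
  fixes U :: "'v::real_normed_vector set"
  assumes "starlike U" "U \<subseteq> S" "path p" "path_image p \<subseteq> U" "path q" "path_image q \<subseteq> U"
    "pathstart p = pathstart q" "pathfinish p = pathfinish q"
  shows "homotopic_paths S p q"
proof -
  have "simply_connected U" by (rule starlike_imp_simply_connected [OF assms(1)])
  then have "homotopic_paths U p q"
    using assms(3-8) unfolding simply_connected_eq_homotopic_paths by simp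
  then show ?thesis by (rule homotopic_paths_subset [OF _ assms(2)])
qed

lemma trail_append:
  assumes "trail \<zeta>" "trail \<eta>" "last \<zeta> = hd \<eta>"
  shows "trail (\<zeta> @ tl \<eta>)" "hd (\<zeta> @ tl \<eta>) = hd \<zeta>" "last (\<zeta> @ tl \<eta>) = last \<eta>"
    "set (\<zeta> @ tl \<eta>) = set \<zeta> \<union> set \<eta>"
proof -
  obtain w \<eta>' where \<eta>: "\<eta> = w # \<eta>'" using assms(2) by (cases \<eta>) (auto simp: trail_def)
  have ne: "\<zeta> \<noteq> []" using assms(1) by (simp add: trail_def)
  show "trail (\<zeta> @ tl \<eta>)"
    using assms unfolding trail_def \<eta>
    by (cases \<eta>') (auto simp: successively_append_iff)
  show "hd (\<zeta> @ tl \<eta>) = hd \<zeta>" using ne by simp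
  show "last (\<zeta> @ tl \<eta>) = last \<eta>" using assms(3) by (simp add: \<eta>)
  have "w \<in> set \<zeta>" using assms(3) ne by (auto simp: \<eta>)
  then show "set (\<zeta> @ tl \<eta>) = set \<zeta> \<union> set \<eta>" by (auto simp: \<eta>)
qed

text \<open>\<open>trail_path\<close> nests its joins to the right, so concatenation holds only up
  to reassociation; \<open>tl\<close> drops the repeated vertex.\<close>

lemma homotopic_paths_trail_append:
  assumes "\<zeta> \<noteq> []" "\<eta> \<noteq> []" "last \<zeta> = hd \<eta>"
    "path_image (trail_path \<zeta>) \<subseteq> S" "path_image (trail_path \<eta>) \<subseteq> S"
  shows "homotopic_paths S (trail_path \<zeta> +++ trail_path \<eta>) (trail_path (\<zeta> @ tl \<eta>))"
  using assms
proof (induction \<zeta> rule: induct_list012)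
  case (2 z)
  have "[z] @ tl \<eta> = \<eta>" using 2 by (cases \<eta>) auto
  moreover have "homotopic_paths S (linepath (real_point z) (real_point z) +++ trail_path \<eta>) (trail_path \<eta>)"
    using 2 by (intro homotopic_paths_lid') (simp_all add: pathstart_trail_path)
  ultimately show ?case by (simp only: trail_path.simps)
next
  case (3 z w \<zeta>)
  let ?l = "linepath (real_point z) (real_point w)" and ?t = "trail_path (w # \<zeta>)"
  have fs: "pathfinish ?l = pathstart ?t" "pathfinish ?t = pathstart (trail_path \<eta>)"
    using "3.prems" by (simp_all add: pathstart_trail_path pathfinish_trail_path)
  have img: "path_image ?l \<subseteq> S" "path_image ?t \<subseteq> S"
    using "3.prems"(4) fs(1) by (simp_all add: path_image_join)
  have IH: "homotopic_paths S (?t +++ trail_path \<eta>) (trail_path ((w # \<zeta>) @ tl \<eta>))"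
    using "3.IH"(2) "3.prems" img(2) by simp
  have "homotopic_paths S ((?l +++ ?t) +++ trail_path \<eta>) (?l +++ (?t +++ trail_path \<eta>))"
    by (rule homotopic_paths_sym, rule homotopic_paths_assoc)
       (use img fs "3.prems"(5) in \<open>simp_all del: trail_path.simps\<close>)
  also have "homotopic_paths S (?l +++ (?t +++ trail_path \<eta>)) (?l +++ trail_path ((w # \<zeta>) @ tl \<eta>))"
    by (rule homotopic_paths_join [OF _ IH]) (use img(1) fs(1) in simp_all)
  finally show ?case by simp
qed simp

text \<open>A homotopy-commutative square with \<open>p\<close> and a trail as parallel sides and
  the two rounding segments as the others. Prescribing the floors as ends of the trail lets squares
  of consecutive paths be pasted.\<close>

definition edge_homotopic :: "(int ^ 'd) set \<Rightarrow> (real \<Rightarrow> real ^ 'd) \<Rightarrow> bool" where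
  "edge_homotopic Y p \<longleftrightarrow> (\<exists>\<zeta>. trail \<zeta> \<and> set \<zeta> \<subseteq> Y \<and> path_image (trail_path \<zeta>) \<subseteq> cubes Y \<and>
     hd \<zeta> = floor_point (pathstart p) \<and> last \<zeta> = floor_point (pathfinish p) \<and>
     homotopic_paths (cubes Y)
       (p +++ linepath (pathfinish p) (real_point (last \<zeta>)))
       (linepath (pathstart p) (real_point (hd \<zeta>)) +++ trail_path \<zeta>))"

lemma floor_segment_in_cubes:
  assumes "p \<in> cubes Y"
  shows "closed_segment p (real_point (floor_point p)) \<subseteq> cubes Y"
proof -
  obtain z where z: "z \<in> full_cubes Y" "p \<in> lattice_cube z" using assms by (auto simp: cubes_eq)
  have "closed_segment p (real_point (floor_point p)) \<subseteq> lattice_cube z"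
    by (rule closed_segment_subset [OF z(2) floor_point_in_lattice_cube [OF z(2)] convex_lattice_cube])
  with z(1) show ?thesis by (auto simp: cubes_eq)
qed

lemma edge_homotopic_cong:
  assumes "homotopic_paths (cubes Y) p q" "edge_homotopic Y q"
  shows "edge_homotopic Y p"
proof -
  note ends = homotopic_paths_imp_pathstart [OF assms(1)] homotopic_paths_imp_pathfinish [OF assms(1)]
  obtain \<zeta> where \<zeta>: "trail \<zeta>" "set \<zeta> \<subseteq> Y" "path_image (trail_path \<zeta>) \<subseteq> cubes Y"
     "hd \<zeta> = floor_point (pathstart q)" "last \<zeta> = floor_point (pathfinish q)"
     and hom: "homotopic_paths (cubes Y) (q +++ linepath (pathfinish q) (real_point (last \<zeta>)))
       (linepath (pathstart q) (real_point (hd \<zeta>)) +++ trail_path \<zeta>)"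
    using assms(2) unfolding edge_homotopic_def by blast
  have "pathfinish q \<in> cubes Y"
    using homotopic_paths_imp_subset [OF assms(1)] pathfinish_in_path_image by blast
  then have "homotopic_paths (cubes Y) (p +++ linepath (pathfinish q) (real_point (last \<zeta>)))
      (q +++ linepath (pathfinish q) (real_point (last \<zeta>)))"
    by (intro homotopic_paths_join assms(1)) (simp_all add: ends \<zeta>(5) floor_segment_in_cubes)
  from homotopic_paths_trans [OF this hom] \<zeta> show ?thesis
    unfolding edge_homotopic_def ends by blast
qed

text \<open>Pasting of squares along the rounding segment \<open>lb\<close> at the common point: it
  closes the square of \<open>p\<close> and opens that of \<open>q\<close>. The rest is
  reassociation.\<close>

lemma edge_homotopic_join:
  assumes "edge_homotopic Y p" "edge_homotopic Y q" "pathfinish p = pathstart q"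
    "path p" "path q" "path_image p \<subseteq> cubes Y" "path_image q \<subseteq> cubes Y"
  shows "edge_homotopic Y (p +++ q)"
proof -
  let ?S = "cubes Y"
  obtain \<zeta> where \<zeta>: "trail \<zeta>" "set \<zeta> \<subseteq> Y" "path_image (trail_path \<zeta>) \<subseteq> ?S"
     "hd \<zeta> = floor_point (pathstart p)" "last \<zeta> = floor_point (pathfinish p)"
     and homp: "homotopic_paths ?S (p +++ linepath (pathfinish p) (real_point (last \<zeta>)))
       (linepath (pathstart p) (real_point (hd \<zeta>)) +++ trail_path \<zeta>)"
    using assms(1) unfolding edge_homotopic_def by blast
  obtain \<eta> where \<eta>: "trail \<eta>" "set \<eta> \<subseteq> Y" "path_image (trail_path \<eta>) \<subseteq> ?S"
     "hd \<eta> = floor_point (pathstart q)" "last \<eta> = floor_point (pathfinish q)"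
     and homq: "homotopic_paths ?S (q +++ linepath (pathfinish q) (real_point (last \<eta>)))
       (linepath (pathstart q) (real_point (hd \<eta>)) +++ trail_path \<eta>)"
    using assms(2) unfolding edge_homotopic_def by blast
  have mid: "last \<zeta> = hd \<eta>" by (simp add: \<zeta>(5) \<eta>(4) assms(3))
  have ne: "\<zeta> \<noteq> []" "\<eta> \<noteq> []" using \<zeta>(1) \<eta>(1) by (simp_all add: trail_def)
  define la lb lc where "la = linepath (pathstart p) (real_point (hd \<zeta>))"
    and "lb = linepath (pathfinish p) (real_point (last \<zeta>))"
    and "lc = linepath (pathfinish q) (real_point (last \<eta>))"
  note l_defs = la_def lb_def lc_def
  have pts: "pathstart p \<in> ?S" "pathfinish p \<in> ?S" "pathfinish q \<in> ?S"
    using assms(6,7) pathstart_in_path_image pathfinish_in_path_image by blast+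
  have l: "path la" "path lb" "path lc" "path_image la \<subseteq> ?S" "path_image lb \<subseteq> ?S" "path_image lc \<subseteq> ?S"
    using floor_segment_in_cubes [OF pts(1)] floor_segment_in_cubes [OF pts(2)]
      floor_segment_in_cubes [OF pts(3)] by (simp_all add: l_defs \<zeta>(4,5) \<eta>(5))
  have ends: "pathfinish la = pathstart (trail_path \<zeta>)" "pathstart lb = pathfinish p"
    "pathfinish lb = pathstart (trail_path \<eta>)" "pathstart lc = pathfinish q"
    "pathfinish (trail_path \<zeta>) = pathstart (trail_path \<eta>)"
    using ne mid by (simp_all add: l_defs pathstart_trail_path pathfinish_trail_path)
  have homp: "homotopic_paths ?S (p +++ lb) (la +++ trail_path \<zeta>)"
    using homp by (simp add: l_defs)
  have homq: "homotopic_paths ?S (q +++ lc) (lb +++ trail_path \<eta>)"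
    using homq by (simp add: l_defs mid assms(3))
  note img = assms(6,7) \<zeta>(3) \<eta>(3) l
  have "homotopic_paths ?S ((p +++ q) +++ lc) (p +++ (q +++ lc))"
    by (rule homotopic_paths_sym, rule homotopic_paths_assoc) (simp_all add: img assms ends)
  also have "homotopic_paths ?S (p +++ (q +++ lc)) (p +++ (lb +++ trail_path \<eta>))"
    by (rule homotopic_paths_join [OF _ homq]) (simp_all add: img assms)
  also have "homotopic_paths ?S (p +++ (lb +++ trail_path \<eta>)) ((p +++ lb) +++ trail_path \<eta>)"
    by (rule homotopic_paths_assoc) (simp_all add: img assms ends)
  also have "homotopic_paths ?S ((p +++ lb) +++ trail_path \<eta>) ((la +++ trail_path \<zeta>) +++ trail_path \<eta>)"
    by (rule homotopic_paths_join [OF homp]) (simp_all add: img assms ends)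
  also have "homotopic_paths ?S ((la +++ trail_path \<zeta>) +++ trail_path \<eta>) (la +++ (trail_path \<zeta> +++ trail_path \<eta>))"
    by (rule homotopic_paths_sym, rule homotopic_paths_assoc) (simp_all add: img assms ends)
  also have "homotopic_paths ?S (la +++ (trail_path \<zeta> +++ trail_path \<eta>)) (la +++ trail_path (\<zeta> @ tl \<eta>))"
    by (rule homotopic_paths_join [OF _ homotopic_paths_trail_append [OF ne mid \<zeta>(3) \<eta>(3)]])
       (simp_all add: img ends)
  finally have hom: "homotopic_paths ?S ((p +++ q) +++ lc) (la +++ trail_path (\<zeta> @ tl \<eta>))" .
  note app = trail_append [OF \<zeta>(1) \<eta>(1) mid]
  have "path_image (trail_path (\<zeta> @ tl \<eta>)) \<subseteq> ?S"
    using homotopic_paths_imp_subset [OF homotopic_paths_trail_append [OF ne mid \<zeta>(3) \<eta>(3)]] by blast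
  then show ?thesis
    unfolding edge_homotopic_def using app \<zeta>(2,4) \<eta>(2,5) hom
    by (intro exI [of _ "\<zeta> @ tl \<eta>"]) (simp add: l_defs)
qed

text \<open>Both rounding segments and a trail between the floors fit into the same convex cube,
  where all paths with common ends are homotopic.\<close>

lemma edge_homotopic_linepath:
  assumes "z \<in> full_cubes Y" "u \<in> lattice_cube z" "w \<in> lattice_cube z"
  shows "edge_homotopic Y (linepath u w)"
proof -
  let ?Q = "lattice_cube z"
  have QS: "?Q \<subseteq> cubes Y" using assms(1) by (auto simp: cubes_eq)
  note fl = floor_point_in_lattice_cube [OF assms(2)] floor_point_in_lattice_cube [OF assms(3)]
  obtain \<zeta> where \<zeta>: "trail \<zeta>" "hd \<zeta> = floor_point u" "last \<zeta> = floor_point w" "real_point ` set \<zeta> \<subseteq> ?Q"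
    using trail_in_lattice_cube [OF fl] by blast
  have ne: "\<zeta> \<noteq> []" using \<zeta>(1) by (simp add: trail_def)
  have img: "path_image (trail_path \<zeta>) \<subseteq> ?Q"
    by (rule path_image_trail_path_convex [OF convex_lattice_cube ne \<zeta>(4)])
  have seg: "closed_segment a b \<subseteq> ?Q" if "a \<in> ?Q" "b \<in> ?Q" for a b
    using that by (rule closed_segment_subset [OF _ _ convex_lattice_cube])
  have "homotopic_paths (cubes Y) (linepath u w +++ linepath w (real_point (floor_point w)))
      (linepath u (real_point (floor_point u)) +++ trail_path \<zeta>)"
  proof (rule starlike_homotopic_paths [OF _ QS])
    show "starlike ?Q" using assms(2) by (intro convex_imp_starlike convex_lattice_cube) auto
  qed (use img seg fl assms(2,3) \<zeta>(2,3) ne in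
      \<open>simp_all add: path_image_join pathstart_trail_path pathfinish_trail_path\<close>)
  moreover have "set \<zeta> \<subseteq> Y" using \<zeta>(4) corner_in [OF assms(1)] by blast
  ultimately show ?thesis
    unfolding edge_homotopic_def using \<zeta> img QS by (intro exI [of _ \<zeta>]) auto
qed

text \<open>The closed intervals between consecutive integers are locally finite: close to
  \<open>x\<close> only those that contain \<open>x\<close> are met.\<close>

lemma int_interval_near:
  fixes x :: real
  shows "\<exists>e>0. \<forall>y k. \<bar>y - x\<bar> < e \<and> of_int k \<le> y \<and> y \<le> of_int k + 1 \<longrightarrow> of_int k \<le> x \<and> x \<le> of_int k + 1"
proof -
  \<comment> \<open>The distances from \<open>x\<close> to the next integers strictly above and
    strictly below, positive also when \<open>x\<close> is an integer.\<close>
  define e where "e = min (of_int \<lfloor>x\<rfloor> + 1 - x) (x - (of_int \<lceil>x\<rceil> - 1))"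
  have "e > 0" unfolding e_def by simp linarith
  moreover have "of_int k \<le> x \<and> x \<le> of_int k + 1" if "\<bar>y - x\<bar> < e" "of_int k \<le> y" "y \<le> of_int k + 1" for y k
  proof (rule ccontr)
    assume "\<not> ?thesis"
    then consider "x < of_int k" | "of_int (k + 1) < x" by force
    then show False
    proof cases
      case 1
      then have "\<lfloor>x\<rfloor> + 1 \<le> k" by linarith
      then have "real_of_int \<lfloor>x\<rfloor> + 1 \<le> y" using that(2) by linarith
      then show False using that(1) unfolding e_def by linarith
    next
      case 2
      then have "k + 1 \<le> \<lceil>x\<rceil> - 1" by linarith
      then have "y \<le> real_of_int \<lceil>x\<rceil> - 1" using that(3) by linarith
      then show False using that(1) unfolding e_def by linarith
    qed
  qed
  ultimately show ?thesis by blast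
qed

text \<open>Every cube that meets a small ball around \<open>q\<close> contains \<open>q\<close>.
  This is what makes \<open>cubes Y\<close> star-shaped about \<open>q\<close> inside such a
  ball.\<close>

lemma lattice_cube_near:
  fixes q :: "real ^ 'd"
  shows "\<exists>e>0. \<forall>p z. dist q p < e \<and> p \<in> lattice_cube z \<longrightarrow> q \<in> lattice_cube z"
proof -
  have "\<forall>i. \<exists>e>0. \<forall>y k. \<bar>y - q $ i\<bar> < e \<and> of_int k \<le> y \<and> y \<le> of_int k + 1 \<longrightarrow>
      of_int k \<le> q $ i \<and> q $ i \<le> of_int k + 1"
    by (intro allI int_interval_near)
  from choice [OF this] obtain e where e: "\<And>i. e i > 0"
    "\<And>i y k. \<bar>y - q $ i\<bar> < e i \<Longrightarrow> of_int k \<le> y \<Longrightarrow> y \<le> of_int k + 1 \<Longrightarrow>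
      of_int k \<le> q $ i \<and> q $ i \<le> of_int k + 1"
    by blast
  have "q \<in> lattice_cube z" if d: "dist q p < Min (range e)" and p: "p \<in> lattice_cube z" for p z
    unfolding in_lattice_cube
  proof
    fix i
    have "\<bar>(p - q) $ i\<bar> \<le> norm (p - q)" by (rule component_le_norm_cart)
    also have "\<dots> < Min (range e)" using d by (simp add: dist_norm norm_minus_commute)
    also have "\<dots> \<le> e i" by simp
    finally have "\<bar>p $ i - q $ i\<bar> < e i" by simp
    then show "of_int (z $ i) \<le> q $ i \<and> q $ i \<le> of_int (z $ i) + 1"
      using p unfolding in_lattice_cube by (intro e(2) [of "p $ i"]) auto
  qed
  moreover have "Min (range e) > 0" using e(1) by simp
  ultimately show ?thesis by blast
qed

text \<open>By the Bolzano principle only short subpaths matter. A short subpath near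
  \<open>q\<close> stays in the star \<open>U\<close> about \<open>q\<close>, so it can be replaced
  by two segments through \<open>q\<close>.\<close>

lemma edge_homotopic_path:
  assumes "path p" "path_image p \<subseteq> cubes Y"
  shows "edge_homotopic Y p"
proof -
  have in_cubes: "p t \<in> cubes Y" if "t \<in> {0..1}" for t
    using assms(2) that by (auto simp: path_image_def)
  have "0 \<le> (0::real) \<and> 1 \<le> (1::real) \<longrightarrow> edge_homotopic Y (subpath 0 1 p)"
  proof (rule Bolzano [of 0 1 "\<lambda>a b. 0 \<le> a \<and> b \<le> 1 \<longrightarrow> edge_homotopic Y (subpath a b p)"])
    fix a b c :: real
    assume ab: "0 \<le> a \<and> b \<le> 1 \<longrightarrow> edge_homotopic Y (subpath a b p)"
      and bc: "0 \<le> b \<and> c \<le> 1 \<longrightarrow> edge_homotopic Y (subpath b c p)" and le: "a \<le> b" "b \<le> c"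
    show "0 \<le> a \<and> c \<le> 1 \<longrightarrow> edge_homotopic Y (subpath a c p)"
    proof
      assume ac: "0 \<le> a \<and> c \<le> 1"
      then have I: "a \<in> {0..1}" "b \<in> {0..1}" "c \<in> {0..1}" using le by auto
      have img: "path_image (subpath x y p) \<subseteq> cubes Y" if "x \<in> {0..1}" "y \<in> {0..1}" for x y
        using path_image_subpath_subset [OF that] assms(2) by blast
      have "edge_homotopic Y (subpath a b p +++ subpath b c p)"
        using ab bc ac le I img assms(1) by (intro edge_homotopic_join) auto
      moreover have "homotopic_paths (cubes Y) (subpath a c p) (subpath a b p +++ subpath b c p)"
        by (rule homotopic_paths_sym, rule homotopic_join_subpaths [OF assms I])
      ultimately show "edge_homotopic Y (subpath a c p)" by (rule edge_homotopic_cong [rotated])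
    qed
  next
    fix x :: real assume x: "0 \<le> x" "x \<le> 1"
    define q where "q = p x"
    have q: "q \<in> cubes Y" using x by (simp add: q_def in_cubes)
    obtain e where e: "e > 0" "\<And>r z. dist q r < e \<Longrightarrow> r \<in> lattice_cube z \<Longrightarrow> q \<in> lattice_cube z"
      using lattice_cube_near [of q] by blast
    define U where "U = ball q e \<inter> cubes Y"
    have cube: "\<exists>z\<in>full_cubes Y. q \<in> lattice_cube z \<and> r \<in> lattice_cube z" if "r \<in> U" for r
      using that e(2) by (auto simp: U_def cubes_eq)
    have qU: "q \<in> U" using q e(1) by (simp add: U_def)
    have seg: "closed_segment q r \<subseteq> U" if r: "r \<in> U" for r
    proof -
      obtain z where z: "z \<in> full_cubes Y" "q \<in> lattice_cube z" "r \<in> lattice_cube z"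
        using cube [OF r] by blast
      have "closed_segment q r \<subseteq> lattice_cube z"
        by (rule closed_segment_subset [OF z(2,3) convex_lattice_cube])
      moreover have "closed_segment q r \<subseteq> ball q e"
        using r qU by (intro closed_segment_subset) (auto simp: U_def)
      ultimately show ?thesis using z(1) by (auto simp: U_def cubes_eq)
    qed
    have star: "starlike U" using qU seg unfolding starlike_def by blast
    have US: "U \<subseteq> cubes Y" by (simp add: U_def)
    have "continuous_on {0..1} p" using assms(1) by (simp add: path_def)
    then obtain d where d: "d > 0" "\<And>t. t \<in> {0..1} \<Longrightarrow> dist t x < d \<Longrightarrow> dist (p t) q < e"
      using x e(1) unfolding continuous_on_iff q_def by (metis atLeastAtMost_iff)
    have "edge_homotopic Y (subpath a b p)"
      if ab: "a \<le> x" "x \<le> b" "b - a < d" and "0 \<le> a" "b \<le> 1" for a b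
    proof -
      have I: "a \<in> {0..1}" "b \<in> {0..1}" using that by auto
      have pU: "p t \<in> U" if "a \<le> t" "t \<le> b" for t
      proof -
        have "t \<in> {0..1}" using that I by auto
        moreover have "dist t x < d" using that ab by (simp add: dist_real_def)
        ultimately show ?thesis using d(2) in_cubes by (simp add: U_def dist_commute)
      qed
      have ends: "p a \<in> U" "p b \<in> U" using pU ab by auto
      obtain y where y: "y \<in> full_cubes Y" "q \<in> lattice_cube y" "p a \<in> lattice_cube y"
        using cube [OF ends(1)] by blast
      obtain z where z: "z \<in> full_cubes Y" "q \<in> lattice_cube z" "p b \<in> lattice_cube z"
        using cube [OF ends(2)] by blast
      note segs = seg [OF ends(1)] seg [OF ends(2)]
      \<comment> \<open>The ends may lie in different cubes, but each shares a cube with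
        \<open>q\<close>; the detour through \<open>q\<close> makes each segment stay in one
        cube.\<close>
      have "edge_homotopic Y (linepath (p a) q +++ linepath q (p b))"
        using edge_homotopic_linepath [OF y(1,3,2)] edge_homotopic_linepath [OF z] segs US
        by (intro edge_homotopic_join) (auto simp: closed_segment_commute)
      moreover have "homotopic_paths (cubes Y) (subpath a b p) (linepath (p a) q +++ linepath q (p b))"
      proof (rule starlike_homotopic_paths [OF star US])
        have "path_image (subpath a b p) = p ` {a..b}" using ab by (simp add: path_image_subpath)
        then show "path_image (subpath a b p) \<subseteq> U" using pU by auto
        show "path_image (linepath (p a) q +++ linepath q (p b)) \<subseteq> U"
          using segs by (simp add: path_image_join closed_segment_commute)
      qed (use assms(1) I in simp_all)
      ultimately show ?thesis by (rule edge_homotopic_cong [rotated])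
    qed
    then show "\<exists>d>0. \<forall>a b. a \<le> x \<and> x \<le> b \<and> b - a < d \<longrightarrow>
        0 \<le> a \<and> b \<le> 1 \<longrightarrow> edge_homotopic Y (subpath a b p)"
      using d(1) by blast
  qed simp
  then show ?thesis by simp
qed

text \<open>For a loop the two rounding segments coincide, so the square says that \<open>p\<close>
  is the closed trail conjugated by \<open>l\<close>, and free homotopy ignores conjugation.\<close>

lemma loop_homotopic_trail:
  assumes "path p" "path_image p \<subseteq> cubes Y" "pathfinish p = pathstart p"
  obtains \<zeta> where "closed_trail_in Y \<zeta>" "homotopic_loops (cubes Y) (trail_path \<zeta>) p"
proof -
  let ?S = "cubes Y"
  obtain \<zeta> where \<zeta>: "trail \<zeta>" "set \<zeta> \<subseteq> Y" "path_image (trail_path \<zeta>) \<subseteq> ?S"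
     "hd \<zeta> = floor_point (pathstart p)" "last \<zeta> = floor_point (pathfinish p)"
     and hom: "homotopic_paths ?S (p +++ linepath (pathfinish p) (real_point (last \<zeta>)))
       (linepath (pathstart p) (real_point (hd \<zeta>)) +++ trail_path \<zeta>)"
    using edge_homotopic_path [OF assms(1,2)] unfolding edge_homotopic_def by blast
  have ne: "\<zeta> \<noteq> []" using \<zeta>(1) by (simp add: trail_def)
  define l where "l = linepath (pathstart p) (real_point (hd \<zeta>))"
  have "pathstart p \<in> ?S" using assms(2) pathstart_in_path_image by blast
  then have l: "path l" "path_image l \<subseteq> ?S" "pathstart l = pathstart p"
    "pathfinish l = pathstart (trail_path \<zeta>)"
    using floor_segment_in_cubes ne by (simp_all add: l_def \<zeta>(4) pathstart_trail_path)
  have loop: "pathfinish (trail_path \<zeta>) = pathstart (trail_path \<zeta>)" "last \<zeta> = hd \<zeta>"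
    using ne \<zeta>(4,5) assms(3) by (simp_all add: pathstart_trail_path pathfinish_trail_path)
  have hom: "homotopic_paths ?S (p +++ l) (l +++ trail_path \<zeta>)"
    using hom by (simp add: l_def loop(2) assms(3))
  have "homotopic_paths ?S p (p +++ linepath (pathfinish p) (pathfinish p))"
    by (rule homotopic_paths_sym, rule homotopic_paths_rid [OF assms(1,2)])
  also have "homotopic_paths ?S (p +++ linepath (pathfinish p) (pathfinish p)) (p +++ (l +++ reversepath l))"
    using homotopic_paths_sym [OF homotopic_paths_rinv [OF l(1,2)]] l(3) assms
    by (intro homotopic_paths_join) (simp_all add: assms(3))
  also have "homotopic_paths ?S (p +++ (l +++ reversepath l)) ((p +++ l) +++ reversepath l)"
    by (rule homotopic_paths_assoc) (simp_all add: l assms)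
  also have "homotopic_paths ?S ((p +++ l) +++ reversepath l) ((l +++ trail_path \<zeta>) +++ reversepath l)"
    by (rule homotopic_paths_join [OF hom]) (simp_all add: l)
  also have "homotopic_paths ?S ((l +++ trail_path \<zeta>) +++ reversepath l) (l +++ (trail_path \<zeta> +++ reversepath l))"
    by (rule homotopic_paths_sym, rule homotopic_paths_assoc) (simp_all add: l loop \<zeta>(3))
  finally have "homotopic_paths ?S p (l +++ (trail_path \<zeta> +++ reversepath l))" .
  then have "homotopic_loops ?S p (l +++ (trail_path \<zeta> +++ reversepath l))"
    by (rule homotopic_paths_imp_homotopic_loops) (simp_all add: assms(3) l)
  moreover have "homotopic_loops ?S (l +++ (trail_path \<zeta> +++ reversepath l)) (trail_path \<zeta>)"
    by (rule homotopic_loops_conjugate) (simp_all add: l loop \<zeta>(3))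
  ultimately have "homotopic_loops ?S (trail_path \<zeta>) p"
    using homotopic_loops_trans homotopic_loops_sym by blast
  moreover have "closed_trail_in Y \<zeta>" using \<zeta> loop by (simp add: closed_trail_in_def)
  ultimately show thesis by (rule that [rotated])
qed

section \<open>Residues\<close>

lemma pi1_rayD:
  assumes "h \<in> carrier (pi1_ray S \<omega>)" "t \<in> ray_times S \<omega>"
  shows "h t \<in> carrier (pi1 S (\<omega> t))"
    and "t \<le> t' \<Longrightarrow> h t' = pi1_transport S (subpath t t' \<omega>) (h t)"
proof -
  have h: "h \<in> (\<Pi>\<^sub>E t\<in>ray_times S \<omega>. carrier (pi1 S (\<omega> t))) \<and>
      (\<forall>t\<in>ray_times S \<omega>. \<forall>t'\<ge>t. h t' = pi1_transport S (subpath t t' \<omega>) (h t))"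
    using assms(1) unfolding pi1_ray_def partial_object.select_convs mem_Collect_eq .
  show "h t \<in> carrier (pi1 S (\<omega> t))" by (rule PiE_mem [OF conjunct1 [OF h] assms(2)])
  show "t \<le> t' \<Longrightarrow> h t' = pi1_transport S (subpath t t' \<omega>) (h t)"
    using conjunct2 [OF h] assms(2) by blast
qed

lemma pi1_inftyD:
  assumes "\<gamma> \<in> carrier (pi1_infty A a r0 Y \<omega>)" "r0 \<le> s"
  shows "\<gamma> s \<in> carrier (pi1_ray (cubes (Y \<inter> good_set A a s)) \<omega>)"
    and "t \<in> ray_times (cubes (Y \<inter> good_set A a (Suc s))) \<omega> \<Longrightarrow>
      \<gamma> s t = homotopy_saturation (cubes (Y \<inter> good_set A a s)) (\<gamma> (Suc s) t)"
proof -
  have \<gamma>: "\<gamma> \<in> (\<Pi>\<^sub>E r\<in>{r0..}. carrier (pi1_ray (cubes (Y \<inter> good_set A a r)) \<omega>)) \<and>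
      (\<forall>r\<ge>r0. \<forall>t\<in>ray_times (cubes (Y \<inter> good_set A a (Suc r))) \<omega>.
         \<gamma> r t = homotopy_saturation (cubes (Y \<inter> good_set A a r)) (\<gamma> (Suc r) t))"
    using assms(1) unfolding pi1_infty_def Let_def partial_object.select_convs mem_Collect_eq .
  show "\<gamma> s \<in> carrier (pi1_ray (cubes (Y \<inter> good_set A a s)) \<omega>)"
    using PiE_mem [OF conjunct1 [OF \<gamma>], of s] assms(2) by simp
  show "t \<in> ray_times (cubes (Y \<inter> good_set A a (Suc s))) \<omega> \<Longrightarrow>
      \<gamma> s t = homotopy_saturation (cubes (Y \<inter> good_set A a s)) (\<gamma> (Suc s) t)"
    using conjunct2 [OF \<gamma>] assms(2) by blast
qed

lemma pi1_infty_component: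
  assumes "\<gamma> \<in> carrier (pi1_infty A a r0 Y \<omega>)" "r0 \<le> s" "t \<in> ray_times (cubes (Y \<inter> good_set A a s)) \<omega>"
  obtains p where "p \<in> based_loops (cubes (Y \<inter> good_set A a s)) (\<omega> t)"
    "\<gamma> s t = homotopy_saturation (cubes (Y \<inter> good_set A a s)) {p}"
proof -
  have "\<gamma> s t \<in> carrier (pi1 (cubes (Y \<inter> good_set A a s)) (\<omega> t))"
    by (rule pi1_rayD(1) [OF pi1_inftyD(1) [OF assms(1,2)] assms(3)])
  then show thesis using that unfolding pi1_def by auto
qed

lemma ray_times_nonempty:
  assumes "proper_base A a r0 Y \<omega>" "r0 \<le> s"
  shows "ray_times (cubes (Y \<inter> good_set A a s)) \<omega> \<noteq> {}"
proof -
  have "\<forall>\<^sub>F t in at_top. \<omega> t \<in> cubes (Y \<inter> good_set A a s)"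
    using assms by (simp add: proper_base_def)
  then obtain T where T: "\<And>t. t \<ge> T \<Longrightarrow> \<omega> t \<in> cubes (Y \<inter> good_set A a s)"
    unfolding eventually_at_top_linorder by blast
  have "max T 0 \<in> ray_times (cubes (Y \<inter> good_set A a s)) \<omega>"
    using T by (auto simp: ray_times_def)
  then show ?thesis by blast
qed

lemma represents_exists:
  assumes "proper_base A a r0 Y \<omega>" "\<gamma> \<in> carrier (pi1_infty A a r0 Y \<omega>)" "r0 \<le> s"
  shows "\<exists>\<zeta>. represents (Y \<inter> good_set A a s) \<omega> (\<gamma> s) \<zeta>"
proof -
  let ?Y = "Y \<inter> good_set A a s"
  obtain t where t: "t \<in> ray_times (cubes ?Y) \<omega>" using ray_times_nonempty [OF assms(1,3)] by blast
  obtain p where p: "p \<in> based_loops (cubes ?Y) (\<omega> t)" "\<gamma> s t = homotopy_saturation (cubes ?Y) {p}"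
    by (rule pi1_infty_component [OF assms(2,3) t])
  then have pp: "path p" "path_image p \<subseteq> cubes ?Y" "pathfinish p = pathstart p"
    by (auto simp: based_loops_def)
  then have "p \<in> \<gamma> s t" by (simp add: p(2) homotopy_saturation_def)
  moreover obtain \<zeta> where "closed_trail_in ?Y \<zeta>" "homotopic_loops (cubes ?Y) (trail_path \<zeta>) p"
    by (rule loop_homotopic_trail [OF pp])
  ultimately show ?thesis using t unfolding represents_def by blast
qed

text \<open>Representatives at two times differ by conjugation along the ray between them, hence are
  freely homotopic. So the time chosen in \<open>represents\<close> does not matter.\<close>

lemma pi1_infty_homotopic_loops:
  assumes "proper_base A a r0 Y \<omega>" "\<gamma> \<in> carrier (pi1_infty A a r0 Y \<omega>)" "r0 \<le> s"
    and t: "t \<in> ray_times (cubes (Y \<inter> good_set A a s)) \<omega>" "t \<le> t'"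
    and p: "p \<in> \<gamma> s t" and p': "p' \<in> \<gamma> s t'"
  shows "homotopic_loops (cubes (Y \<inter> good_set A a s)) p p'"
proof -
  let ?S = "cubes (Y \<inter> good_set A a s)"
  obtain p0 where p0: "p0 \<in> based_loops ?S (\<omega> t)" "\<gamma> s t = homotopy_saturation ?S {p0}"
    by (rule pi1_infty_component [OF assms(2,3) t(1)])
  then have loop0: "pathstart p0 = \<omega> t" "pathfinish p0 = \<omega> t" by (auto simp: based_loops_def)
  have in_class: "path k \<and> path_image k \<subseteq> ?S \<and> pathstart k = \<omega> t \<and> pathfinish k = \<omega> t \<and> homotopic_loops ?S p0 k"
    if "k \<in> \<gamma> s t" for k
  proof -
    have h: "homotopic_paths ?S p0 k" using that by (simp add: p0(2) homotopy_saturation_def)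
    have ends: "pathstart k = \<omega> t" "pathfinish k = \<omega> t"
      using homotopic_paths_imp_pathstart [OF h] homotopic_paths_imp_pathfinish [OF h] loop0 by simp_all
    then have "homotopic_loops ?S p0 k"
      by (intro homotopic_paths_imp_homotopic_loops [OF h]) (simp_all add: loop0)
    then show ?thesis
      using ends homotopic_paths_imp_path [OF h] homotopic_paths_imp_subset [OF h] by blast
  qed
  define c where "c = subpath t t' \<omega>"
  obtain k where k: "k \<in> \<gamma> s t" and hk: "homotopic_paths ?S (reversepath c +++ (k +++ c)) p'"
    using p' unfolding pi1_rayD(2) [OF pi1_inftyD(1) [OF assms(2,3)] t] pi1_transport_def homotopy_saturation_def
    by (auto simp: c_def)
  have t0: "0 \<le> t" "\<omega> ` {t..} \<subseteq> ?S" using t(1) by (auto simp: ray_times_def)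
  have "continuous_on {0..} \<omega>" using assms(1) by (simp add: proper_base_def)
  then have cont: "continuous_on {t..t'} \<omega>" by (rule continuous_on_subset) (use t0(1) in auto)
  have maps: "(t' - t) * x + t \<in> {t..t'}" if "x \<in> {0..1}" for x
  proof -
    have "(t' - t) * x \<le> (t' - t) * 1" using that t(2) by (intro mult_left_mono) auto
    then show ?thesis using that t(2) by simp
  qed
  have "continuous_on {0..1} (\<lambda>x. (t' - t) * x + t)" by (intro continuous_intros)
  from continuous_on_compose2 [OF cont this] maps
  have "continuous_on {0..1} (\<lambda>x. \<omega> ((t' - t) * x + t))" by blast
  then have c: "path c" by (simp add: c_def path_def subpath_def)
  have cS: "path_image c \<subseteq> ?S"
    using t0(2) t(2) by (auto simp: c_def path_image_subpath)
  have c_start: "pathstart c = \<omega> t" by (simp add: c_def)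
  note kk = in_class [OF k]
  have "homotopic_loops ?S (reversepath c +++ (k +++ c)) p'"
  proof (rule homotopic_paths_imp_homotopic_loops [OF hk])
    show "pathfinish p' = pathstart (reversepath c +++ (k +++ c))"
      using homotopic_paths_imp_pathfinish [OF hk] by simp
  qed simp
  \<comment> \<open>The double reversal gives the loop the shape expected by
    \<open>homotopic_loops_conjugate\<close>, with \<open>reversepath c\<close> as conjugating
    path.\<close>
  moreover have "homotopic_loops ?S (reversepath c +++ (k +++ reversepath (reversepath c))) k"
    by (rule homotopic_loops_conjugate) (use c cS kk c_start in simp_all)
  moreover have "homotopic_loops ?S p0 p" using in_class [OF p] by blast
  moreover have "homotopic_loops ?S p0 k" using kk by blast
  ultimately show ?thesis
    using homotopic_loops_sym homotopic_loops_trans by (metis reversepath_reversepath)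
qed

lemma represents_homotopic_loops:
  assumes "proper_base A a r0 Y \<omega>" "\<gamma> \<in> carrier (pi1_infty A a r0 Y \<omega>)" "r0 \<le> s"
    and \<zeta>: "represents (Y \<inter> good_set A a s) \<omega> (\<gamma> s) \<zeta>" and \<eta>: "represents (Y \<inter> good_set A a s) \<omega> (\<gamma> s) \<eta>"
  shows "homotopic_loops (cubes (Y \<inter> good_set A a s)) (trail_path \<zeta>) (trail_path \<eta>)"
proof -
  let ?S = "cubes (Y \<inter> good_set A a s)"
  obtain t p where t: "t \<in> ray_times ?S \<omega>" and p: "p \<in> \<gamma> s t" "homotopic_loops ?S (trail_path \<zeta>) p"
    using \<zeta> unfolding represents_def by blast
  obtain t' p' where t': "t' \<in> ray_times ?S \<omega>" and p': "p' \<in> \<gamma> s t'" "homotopic_loops ?S (trail_path \<eta>) p'"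
    using \<eta> unfolding represents_def by blast
  have "homotopic_loops ?S p p'"
  proof (cases "t \<le> t'")
    case True
    then show ?thesis by (rule pi1_infty_homotopic_loops [OF assms(1-3) t _ p(1) p'(1)])
  next
    case False
    then have "t' \<le> t" by simp
    from pi1_infty_homotopic_loops [OF assms(1-3) t' this p'(1) p(1)] show ?thesis
      using homotopic_loops_sym by blast
  qed
  then show ?thesis using p(2) p'(2) homotopic_loops_trans homotopic_loops_sym by blast
qed

text \<open>The bonding map of the inverse limit only saturates classes in the larger set, so the
  loop that witnesses the finer representation lies in the coarser class too.\<close>

lemma represents_Suc:
  assumes "\<gamma> \<in> carrier (pi1_infty A a r0 Y \<omega>)" "r0 \<le> s"
    and \<zeta>: "represents (Y \<inter> good_set A a (Suc s)) \<omega> (\<gamma> (Suc s)) \<zeta>"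
  shows "represents (Y \<inter> good_set A a s) \<omega> (\<gamma> s) \<zeta>"
proof -
  let ?Y = "Y \<inter> good_set A a s" and ?Y' = "Y \<inter> good_set A a (Suc s)"
  have YY: "?Y' \<subseteq> ?Y" using good_set_mono [of s "Suc s" A a] by auto
  note SS = cubes_mono [OF YY]
  obtain t p where t: "t \<in> ray_times (cubes ?Y') \<omega>" and p: "p \<in> \<gamma> (Suc s) t"
    and h: "homotopic_loops (cubes ?Y') (trail_path \<zeta>) p" and cl: "closed_trail_in ?Y' \<zeta>"
    using \<zeta> unfolding represents_def by blast
  have h': "homotopic_loops (cubes ?Y) (trail_path \<zeta>) p" by (rule homotopic_loops_subset [OF h SS])
  have "p \<in> \<gamma> s t"
    using p homotopic_loops_imp_path [OF h'] homotopic_loops_imp_subset [OF h']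
    unfolding pi1_inftyD(2) [OF assms(1,2) t] homotopy_saturation_def
    by (intro CollectI bexI [of _ p]) simp_all
  moreover have "t \<in> ray_times (cubes ?Y) \<omega>" using t SS by (auto simp: ray_times_def)
  ultimately show ?thesis
    using h' closed_trail_in_mono [OF cl YY] unfolding represents_def by blast
qed

lemma represents_mono:
  assumes "\<gamma> \<in> carrier (pi1_infty A a r0 Y \<omega>)" "r0 \<le> s" "s \<le> s'"
    and "represents (Y \<inter> good_set A a s') \<omega> (\<gamma> s') \<zeta>"
  shows "represents (Y \<inter> good_set A a s) \<omega> (\<gamma> s) \<zeta>"
  using assms(3,4)
proof (induction s' rule: dec_induct)
  case (step n)
  have "r0 \<le> n" using assms(2) step.hyps(1) by simp
  from step.IH [OF represents_Suc [OF assms(1) this step.prems]] show ?case .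
qed

text \<open>Representatives at any level above \<open>m\<close> also represent the component at
  level \<open>m\<close>. Homotopy invariance at that single level therefore controls all later
  ones.\<close>

lemma has_residue_exists:
  fixes A :: "(int ^ 'd \<Rightarrow> 'a::finite) set"
  assumes "subshift A" "group G" "cocycle G A C" "proper_base A a r0 Y \<omega>"
    "\<gamma> \<in> carrier (pi1_infty A a r0 Y \<omega>)"
  shows "\<exists>v. has_residue G A a Y \<omega> C \<gamma> a v"
proof -
  obtain r where r: "locally_determined A r C" by (rule cocycle_radius [OF assms(1,3)])
  obtain n where n: "n > 0" "r \<le> n" and all: "\<forall>s\<ge>n. \<forall>a Y \<zeta> \<eta>. Y \<subseteq> good_set A a s \<longrightarrow>
    trail \<zeta> \<longrightarrow> trail \<eta> \<longrightarrow> homotopic_loops (cubes Y) (trail_path \<zeta>) (trail_path \<eta>) \<longrightarrow>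
    (\<exists>k\<in>carrier G. trail_value G A r C \<eta> a = k \<otimes>\<^bsub>G\<^esub> trail_value G A r C \<zeta> a \<otimes>\<^bsub>G\<^esub> inv\<^bsub>G\<^esub> k)"
    using trail_value_homotopic [OF assms(1-3) r] by (elim exE conjE)
  have conj: "\<exists>k\<in>carrier G. trail_value G A r C \<eta> a = k \<otimes>\<^bsub>G\<^esub> trail_value G A r C \<zeta> a \<otimes>\<^bsub>G\<^esub> inv\<^bsub>G\<^esub> k"
    if "s \<ge> n" "Y \<subseteq> good_set A a s" "trail \<zeta>" "trail \<eta>"
      "homotopic_loops (cubes Y) (trail_path \<zeta>) (trail_path \<eta>)" for s Y \<zeta> \<eta>
    by (rule all [rule_format, OF that])
  \<comment> \<open>\<open>n\<close> is the threshold of homotopy invariance, and the inverse limit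
    starts at \<open>r0\<close>.\<close>
  define m where "m = max n r0"
  have rm: "r0 \<le> m" "n \<le> m" by (simp_all add: m_def)
  obtain \<zeta> where \<zeta>: "represents (Y \<inter> good_set A a m) \<omega> (\<gamma> m) \<zeta>"
    using represents_exists [OF assms(4,5) rm(1)] by blast
  have tr: "trail \<eta> \<and> set \<eta> \<subseteq> good_set A a s" if "represents (Y \<inter> good_set A a s) \<omega> (\<gamma> s) \<eta>" for s \<eta>
    using represents_closed_trail [OF that] by (simp add: closed_trail_in_def)
  let ?v = "trail_value G A r C \<zeta> a"
  have v: "?v \<in> carrier G"
    using tr [OF \<zeta>] n rm(2) by (intro trail_value_closed [OF assms(1-3) r, of _ _ m]) auto
  have "(\<exists>\<eta>. represents (Y \<inter> good_set A a s) \<omega> (\<gamma> s) \<eta>) \<and>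
      (\<forall>\<eta>. represents (Y \<inter> good_set A a s) \<omega> (\<gamma> s) \<eta> \<longrightarrow>
        (\<exists>g\<in>carrier G. trail_value G A r C \<eta> a = g \<otimes>\<^bsub>G\<^esub> ?v \<otimes>\<^bsub>G\<^esub> inv\<^bsub>G\<^esub> g))" if s: "s \<ge> m" for s
  proof (intro conjI allI impI)
    show "\<exists>\<eta>. represents (Y \<inter> good_set A a s) \<omega> (\<gamma> s) \<eta>"
      using rm(1) s by (intro represents_exists [OF assms(4,5)]) simp
    fix \<eta> assume "represents (Y \<inter> good_set A a s) \<omega> (\<gamma> s) \<eta>"
    then have \<eta>: "represents (Y \<inter> good_set A a m) \<omega> (\<gamma> m) \<eta>"
      by (rule represents_mono [OF assms(5) rm(1) s])
    from represents_homotopic_loops [OF assms(4,5) rm(1) \<zeta> \<eta>]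
    show "\<exists>g\<in>carrier G. trail_value G A r C \<eta> a = g \<otimes>\<^bsub>G\<^esub> ?v \<otimes>\<^bsub>G\<^esub> inv\<^bsub>G\<^esub> g"
      using tr [OF \<zeta>] tr [OF \<eta>] by (intro conj [OF rm(2)]) auto
  qed
  with v r show ?thesis unfolding has_residue_def eventually_sequentially by blast
qed

text \<open>Replaces the radius hidden in \<open>has_residue\<close> by a prescribed one. The trails
  are good for \<open>a\<close> while the values are read from \<open>x\<close>, hence the condition
  that the good sets of \<open>a\<close> are eventually contained in those of
  \<open>x\<close>.\<close>

lemma has_residueD:
  assumes "has_residue G A a Y \<omega> C \<gamma> x v" "locally_determined A r C"
    "\<And>n. \<exists>m. good_set A a m \<subseteq> good_set A x n"
  shows "\<exists>n. \<forall>s\<ge>n. (\<exists>\<zeta>. represents (Y \<inter> good_set A a s) \<omega> (\<gamma> s) \<zeta>) \<and>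
    (\<forall>\<zeta>. represents (Y \<inter> good_set A a s) \<omega> (\<gamma> s) \<zeta> \<longrightarrow>
      (\<exists>g\<in>carrier G. trail_value G A r C \<zeta> x = g \<otimes>\<^bsub>G\<^esub> v \<otimes>\<^bsub>G\<^esub> inv\<^bsub>G\<^esub> g))"
proof -
  obtain q n where q: "locally_determined A q C"
    and n: "\<And>s. s \<ge> n \<Longrightarrow> (\<exists>\<zeta>. represents (Y \<inter> good_set A a s) \<omega> (\<gamma> s) \<zeta>) \<and>
    (\<forall>\<zeta>. represents (Y \<inter> good_set A a s) \<omega> (\<gamma> s) \<zeta> \<longrightarrow>
      (\<exists>g\<in>carrier G. trail_value G A q C \<zeta> x = g \<otimes>\<^bsub>G\<^esub> v \<otimes>\<^bsub>G\<^esub> inv\<^bsub>G\<^esub> g))"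
    using assms(1) unfolding has_residue_def eventually_sequentially by blast
  \<comment> \<open>\<open>Suc (q + r)\<close> is positive and dominates both radii, so both local
    rules compute the same product.\<close>
  obtain m where m: "good_set A a m \<subseteq> good_set A x (Suc (q + r))" using assms(3) by blast
  have eq: "trail_value G A r C \<zeta> x = trail_value G A q C \<zeta> x"
    if "s \<ge> m" "represents (Y \<inter> good_set A a s) \<omega> (\<gamma> s) \<zeta>" for s \<zeta>
  proof -
    have "closed_trail_in (good_set A x (Suc (q + r))) \<zeta>"
      by (rule closed_trail_in_mono [OF closed_trail_in_good_mono [OF represents_closed_trail [OF that(2)] that(1)] m])
    then show ?thesis
      by (intro trail_value_radius [OF assms(2) q, of _ _ "Suc (q + r)"]) (auto simp: closed_trail_in_def)
  qed
  show ?thesis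
  proof (intro exI [of _ "max n m"] allI impI conjI)
    fix s assume "max n m \<le> s"
    then have s: "n \<le> s" "m \<le> s" by simp_all
    show "\<exists>\<zeta>. represents (Y \<inter> good_set A a s) \<omega> (\<gamma> s) \<zeta>" using n [OF s(1)] by blast
    fix \<zeta> assume \<zeta>: "represents (Y \<inter> good_set A a s) \<omega> (\<gamma> s) \<zeta>"
    show "\<exists>g\<in>carrier G. trail_value G A r C \<zeta> x = g \<otimes>\<^bsub>G\<^esub> v \<otimes>\<^bsub>G\<^esub> inv\<^bsub>G\<^esub> g"
      unfolding eq [OF s(2) \<zeta>] using n [OF s(1)] \<zeta> by blast
  qed
qed

lemma good_set_image_cofinal:
  assumes "cellular_automaton \<Phi>" "has_radius \<Phi> R" "\<Phi> ` A \<subseteq> A"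
  shows "\<exists>m. good_set A a m \<subseteq> good_set A (\<Phi> a) n"
proof -
  have "good_set A a (R + Suc n) \<subseteq> good_set A (\<Phi> a) (Suc n)" by (rule good_set_image [OF assms]) simp
  also have "\<dots> \<subseteq> good_set A (\<Phi> a) n" by (rule good_set_mono) simp
  finally show ?thesis ..
qed

text \<open>Two candidates are compared on a common representative: in an abelian group its value
  equals each of them.\<close>

lemma residue_eq:
  fixes A :: "(int ^ 'd \<Rightarrow> 'a::finite) set"
  assumes "subshift A" "comm_group G" "cocycle G A C" "has_residue G A a Y \<omega> C \<gamma> x v"
    "\<And>n. \<exists>m. good_set A a m \<subseteq> good_set A x n"
  shows "residue G A a Y \<omega> C x \<gamma> = v"
  unfolding residue_def
proof (rule the_equality)
  show "has_residue G A a Y \<omega> C \<gamma> x v" by (rule assms(4))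
  fix u assume u: "has_residue G A a Y \<omega> C \<gamma> x u"
  obtain r where r: "locally_determined A r C" by (rule cocycle_radius [OF assms(1,3)])
  have c: "u \<in> carrier G" "v \<in> carrier G" using u assms(4) by (simp_all add: has_residue_def)
  obtain n where n: "\<And>s \<zeta>. s \<ge> n \<Longrightarrow> represents (Y \<inter> good_set A a s) \<omega> (\<gamma> s) \<zeta> \<Longrightarrow>
      \<exists>g\<in>carrier G. trail_value G A r C \<zeta> x = g \<otimes>\<^bsub>G\<^esub> v \<otimes>\<^bsub>G\<^esub> inv\<^bsub>G\<^esub> g"
    using has_residueD [OF assms(4) r assms(5)] by blast
  obtain m where m: "\<And>s. s \<ge> m \<Longrightarrow> \<exists>\<zeta>. represents (Y \<inter> good_set A a s) \<omega> (\<gamma> s) \<zeta>"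
    "\<And>s \<zeta>. s \<ge> m \<Longrightarrow> represents (Y \<inter> good_set A a s) \<omega> (\<gamma> s) \<zeta> \<Longrightarrow>
      \<exists>g\<in>carrier G. trail_value G A r C \<zeta> x = g \<otimes>\<^bsub>G\<^esub> u \<otimes>\<^bsub>G\<^esub> inv\<^bsub>G\<^esub> g"
    using has_residueD [OF u r assms(5)] by blast
  obtain \<zeta> where \<zeta>: "represents (Y \<inter> good_set A a (max n m)) \<omega> (\<gamma> (max n m)) \<zeta>"
    using m(1) [of "max n m"] by auto
  have "trail_value G A r C \<zeta> x = v"
    using n [OF _ \<zeta>] comm_group_conjugate [OF assms(2) _ c(2)] by auto
  moreover have "trail_value G A r C \<zeta> x = u"
    using m(2) [OF _ \<zeta>] comm_group_conjugate [OF assms(2) _ c(1)] by auto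
  ultimately show "u = v" by simp
qed

section \<open>Residues under homomorphisms and fundamental cocycles\<close>

lemma locally_determined_comp:
  "locally_determined A r C \<Longrightarrow> locally_determined A r (\<lambda>z x. \<phi> (C z x))"
  unfolding locally_determined_iff_window window_def by metis

text \<open>In its uses \<open>D\<close> is the fundamental cocycle and \<open>C\<close> the one
  with the pole. Since \<open>H\<close> may be nonabelian, the conjugators are kept until the value
  is known to be conjugate to \<open>\<one>\<close>.\<close>

lemma residue_hom:
  fixes A :: "(int ^ 'd \<Rightarrow> 'a::finite) set"
  assumes "subshift A" "group G" "group H" "cocycle G A D" "cocycle H A C" "\<psi> \<in> hom G H"
    "cohomologous H A C (\<lambda>z x. \<psi> (D z x))" "locally_determined A r D"
    "has_residue H A a Y \<omega> C \<gamma> a v"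
    "\<And>s \<zeta>. s \<ge> m \<Longrightarrow> represents (Y \<inter> good_set A a s) \<omega> (\<gamma> s) \<zeta> \<Longrightarrow> trail_value G A r D \<zeta> a = \<one>\<^bsub>G\<^esub>"
  shows "v = \<one>\<^bsub>H\<^esub>"
proof -
  obtain q where q: "locally_determined A q C" by (rule cocycle_radius [OF assms(1,5)])
  obtain n where n: "\<And>a \<zeta>. closed_trail_in (good_set A a n) \<zeta> \<Longrightarrow> \<exists>g\<in>carrier H.
      trail_value H A r (\<lambda>z x. \<psi> (D z x)) \<zeta> a = g \<otimes>\<^bsub>H\<^esub> trail_value H A q C \<zeta> a \<otimes>\<^bsub>H\<^esub> inv\<^bsub>H\<^esub> g"
    using trail_value_cohomologous [OF assms(1,3,5,7) q locally_determined_comp [OF assms(8)]] by blast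
  obtain l where l: "\<And>s. s \<ge> l \<Longrightarrow> \<exists>\<zeta>. represents (Y \<inter> good_set A a s) \<omega> (\<gamma> s) \<zeta>"
    "\<And>s \<zeta>. s \<ge> l \<Longrightarrow> represents (Y \<inter> good_set A a s) \<omega> (\<gamma> s) \<zeta> \<Longrightarrow>
      \<exists>g\<in>carrier H. trail_value H A q C \<zeta> a = g \<otimes>\<^bsub>H\<^esub> v \<otimes>\<^bsub>H\<^esub> inv\<^bsub>H\<^esub> g"
    using has_residueD [OF assms(9) q] by blast
  define s where "s = l + m + n + Suc (q + r)"
  obtain \<zeta> where \<zeta>: "represents (Y \<inter> good_set A a s) \<omega> (\<gamma> s) \<zeta>" using l(1) [of s] by (auto simp: s_def)
  note cl = represents_closed_trail [OF \<zeta>]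
  have tr: "trail \<zeta>" "set \<zeta> \<subseteq> good_set A a s" using cl by (auto simp: closed_trail_in_def)
  have v: "v \<in> carrier H" using assms(9) by (simp add: has_residue_def)
  have "trail_value H A r (\<lambda>z x. \<psi> (D z x)) \<zeta> a = \<psi> (trail_value G A r D \<zeta> a)"
    by (rule trail_value_hom [OF assms(1-4,6,8) tr]) (simp_all add: s_def)
  also have "trail_value G A r D \<zeta> a = \<one>\<^bsub>G\<^esub>" by (rule assms(10) [OF _ \<zeta>]) (simp add: s_def)
  also have "\<psi> \<one>\<^bsub>G\<^esub> = \<one>\<^bsub>H\<^esub>" by (rule hom_one [OF assms(6,2,3)])
  finally have one: "trail_value H A r (\<lambda>z x. \<psi> (D z x)) \<zeta> a = \<one>\<^bsub>H\<^esub>" .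
  obtain g where g: "g \<in> carrier H" "g \<otimes>\<^bsub>H\<^esub> trail_value H A q C \<zeta> a \<otimes>\<^bsub>H\<^esub> inv\<^bsub>H\<^esub> g = \<one>\<^bsub>H\<^esub>"
    using n [OF closed_trail_in_good_mono [OF cl, of n]] one by (auto simp: s_def)
  have "trail_value H A q C \<zeta> a \<in> carrier H"
    by (rule trail_value_closed [OF assms(1,3,5) q tr]) (simp_all add: s_def)
  from conjugate_eq_one [OF assms(3) g(1) this g(2)]
  have "trail_value H A q C \<zeta> a = \<one>\<^bsub>H\<^esub>" .
  moreover obtain h where "h \<in> carrier H" "trail_value H A q C \<zeta> a = h \<otimes>\<^bsub>H\<^esub> v \<otimes>\<^bsub>H\<^esub> inv\<^bsub>H\<^esub> h"
    using l(2) [OF _ \<zeta>] by (auto simp: s_def)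
  ultimately show ?thesis using conjugate_eq_one [OF assms(3) _ v] by simp
qed

text \<open>The same class \<gamma> works for both cocycles: if the fundamental residue vanished
  there, \<open>residue_hom\<close> would make the pole vanish.\<close>

lemma fundamental_residue_nontrivial:
  fixes A :: "(int ^ 'd \<Rightarrow> 'a::finite) set" and H :: "'h monoid"
  assumes "subshift A" "comm_group G" "fundamental_cocycle TYPE('h) G A C" "group H"
    "proper_base A a r0 Y \<omega>" "has_pole H A a r0 Y \<omega>"
  shows "\<exists>\<gamma>\<in>carrier (pi1_infty A a r0 Y \<omega>). residue G A a Y \<omega> C a \<gamma> \<noteq> \<one>\<^bsub>G\<^esub>"
proof -
  interpret comm_group G by fact
  have C: "cocycle G A C" using assms(3) by (simp add: fundamental_cocycle_def)
  obtain D \<gamma> v where D: "cocycle H A D" and \<gamma>: "\<gamma> \<in> carrier (pi1_infty A a r0 Y \<omega>)"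
    and v: "has_residue H A a Y \<omega> D \<gamma> a v" "v \<noteq> \<one>\<^bsub>H\<^esub>"
    using assms(6) unfolding has_pole_def by blast
  obtain \<psi> where \<psi>: "\<psi> \<in> hom G H" "cohomologous H A D (\<lambda>z x. \<psi> (C z x))"
    using assms(3,4) D unfolding fundamental_cocycle_def by blast
  obtain r where r: "locally_determined A r C" by (rule cocycle_radius [OF assms(1) C])
  obtain u where u: "has_residue G A a Y \<omega> C \<gamma> a u"
    using has_residue_exists [OF assms(1) is_group C assms(5) \<gamma>] by blast
  have uc: "u \<in> carrier G" using u by (simp add: has_residue_def)
  have "u \<noteq> \<one>\<^bsub>G\<^esub>"
  proof
    assume "u = \<one>\<^bsub>G\<^esub>"
    obtain n where n: "\<And>s \<zeta>. s \<ge> n \<Longrightarrow> represents (Y \<inter> good_set A a s) \<omega> (\<gamma> s) \<zeta> \<Longrightarrow>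
        \<exists>g\<in>carrier G. trail_value G A r C \<zeta> a = g \<otimes>\<^bsub>G\<^esub> u \<otimes>\<^bsub>G\<^esub> inv\<^bsub>G\<^esub> g"
      using has_residueD [OF u r] by blast
    have "trail_value G A r C \<zeta> a = \<one>\<^bsub>G\<^esub>"
      if "s \<ge> n" "represents (Y \<inter> good_set A a s) \<omega> (\<gamma> s) \<zeta>" for s \<zeta>
      using n [OF that] comm_group_conjugate [OF assms(2) _ uc] \<open>u = \<one>\<^bsub>G\<^esub>\<close> by auto
    from residue_hom [OF assms(1) is_group assms(4) C D \<psi> r v(1) this] v(2) show False by simp
  qed
  moreover have "residue G A a Y \<omega> C a \<gamma> = u"
    by (rule residue_eq [OF assms(1,2) C u]) blast
  ultimately show ?thesis using \<gamma> by blast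
qed

text \<open>Both residues are taken over the fundamental group of \<open>a\<close>, so the same
  trails represent \<gamma> on either side and only their values have to be compared.\<close>

lemma residue_endomorphism:
  fixes A :: "(int ^ 'd \<Rightarrow> 'a::finite) set"
  assumes "cellular_automaton \<Phi>" "has_radius \<Phi> R" "\<Phi> ` A \<subseteq> A" "subshift A" "comm_group G"
    "cocycle G A C" "\<phi> \<in> hom G G" "cohomologous G A (pull A \<Phi> C) (\<lambda>z x. \<phi> (C z x))"
    "proper_base A a r0 Y \<omega>" "\<gamma> \<in> carrier (pi1_infty A a r0 Y \<omega>)"
  shows "residue G A a Y \<omega> C (\<Phi> a) \<gamma> = \<phi> (residue G A a Y \<omega> C a \<gamma>)"
proof -
  interpret comm_group G by fact
  obtain r where r: "locally_determined A r C" by (rule cocycle_radius [OF assms(4,6)])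
  obtain u where u: "has_residue G A a Y \<omega> C \<gamma> a u"
    using has_residue_exists [OF assms(4) is_group assms(6,9,10)] by blast
  have uc: "u \<in> carrier G" using u by (simp add: has_residue_def)
  then have \<phi>u: "\<phi> u \<in> carrier G" using assms(7) by (rule hom_in_carrier [rotated])
  obtain n where n: "\<And>s. s \<ge> n \<Longrightarrow> \<exists>\<zeta>. represents (Y \<inter> good_set A a s) \<omega> (\<gamma> s) \<zeta>"
    "\<And>s \<zeta>. s \<ge> n \<Longrightarrow> represents (Y \<inter> good_set A a s) \<omega> (\<gamma> s) \<zeta> \<Longrightarrow>
      \<exists>g\<in>carrier G. trail_value G A r C \<zeta> a = g \<otimes>\<^bsub>G\<^esub> u \<otimes>\<^bsub>G\<^esub> inv\<^bsub>G\<^esub> g"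
    using has_residueD [OF u r] by blast
  obtain m where m: "\<And>a \<zeta>. closed_trail_in (good_set A a m) \<zeta> \<Longrightarrow>
    trail_value G A r C \<zeta> (\<Phi> a) = \<phi> (trail_value G A r C \<zeta> a)"
    using trail_value_endomorphism [OF assms(1-8) r] by blast
  have "(\<exists>\<zeta>. represents (Y \<inter> good_set A a s) \<omega> (\<gamma> s) \<zeta>) \<and>
    (\<forall>\<zeta>. represents (Y \<inter> good_set A a s) \<omega> (\<gamma> s) \<zeta> \<longrightarrow>
      (\<exists>g\<in>carrier G. trail_value G A r C \<zeta> (\<Phi> a) = g \<otimes>\<^bsub>G\<^esub> \<phi> u \<otimes>\<^bsub>G\<^esub> inv\<^bsub>G\<^esub> g))"
    if "s \<ge> max n m" for s
  proof (intro conjI allI impI)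
    show "\<exists>\<zeta>. represents (Y \<inter> good_set A a s) \<omega> (\<gamma> s) \<zeta>" using n(1) that by simp
    fix \<zeta> assume \<zeta>: "represents (Y \<inter> good_set A a s) \<omega> (\<gamma> s) \<zeta>"
    have "trail_value G A r C \<zeta> a = u"
      using n(2) [OF _ \<zeta>] that comm_group_conjugate [OF assms(5) _ uc] by auto
    moreover have "closed_trail_in (good_set A a m) \<zeta>"
      by (rule closed_trail_in_good_mono [OF represents_closed_trail [OF \<zeta>]]) (use that in simp)
    ultimately have "trail_value G A r C \<zeta> (\<Phi> a) = \<phi> u" using m by simp
    then show "\<exists>g\<in>carrier G. trail_value G A r C \<zeta> (\<Phi> a) = g \<otimes>\<^bsub>G\<^esub> \<phi> u \<otimes>\<^bsub>G\<^esub> inv\<^bsub>G\<^esub> g"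
      using \<phi>u by (intro bexI [of _ "\<one>\<^bsub>G\<^esub>"]) simp_all
  qed
  then have "has_residue G A a Y \<omega> C \<gamma> (\<Phi> a) (\<phi> u)"
    using r \<phi>u unfolding has_residue_def eventually_sequentially by blast
  from residue_eq [OF assms(4-6) this good_set_image_cofinal [OF assms(1-3)]]
  have "residue G A a Y \<omega> C (\<Phi> a) \<gamma> = \<phi> u" .
  moreover have "residue G A a Y \<omega> C a \<gamma> = u"
    by (rule residue_eq [OF assms(4-6) u]) blast
  ultimately show ?thesis by simp
qed

text \<open>The common core of persistence in (d) and (e): the value at
  \<open>(\<Phi> ^^ t) a\<close> is \<open>\<one>\<close> by telescoping, and it is also the image
  of the value at \<open>a\<close> under \<open>\<phi> ^^ t\<close>.\<close>

lemma trail_value_funpow_eq_one: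
  fixes A :: "(int ^ 'd \<Rightarrow> 'a::finite) set"
  assumes "cellular_automaton \<Phi>" "has_radius \<Phi> R" "\<Phi> ` A \<subseteq> A" "subshift A" "comm_group G"
    "cocycle G A C" "\<phi> \<in> hom G G" "cohomologous G A (pull A \<Phi> C) (\<lambda>z x. \<phi> (C z x))"
    "locally_determined A r C" "(\<Phi> ^^ t) a \<in> A"
  shows "\<exists>n>0. r \<le> n \<and> (\<forall>\<zeta>. closed_trail_in (good_set A a n) \<zeta> \<longrightarrow>
    (\<phi> ^^ t) (trail_value G A r C \<zeta> a) = \<one>\<^bsub>G\<^esub>)"
proof -
  interpret comm_group G by fact
  obtain n where n: "n > 0" "r \<le> n" "\<And>a \<zeta>. closed_trail_in (good_set A a n) \<zeta> \<Longrightarrow>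
    trail_value G A r C \<zeta> ((\<Phi> ^^ t) a) = (\<phi> ^^ t) (trail_value G A r C \<zeta> a)"
    using trail_value_endomorphism_funpow [OF assms(1-9)] by blast
  have "(\<phi> ^^ t) (trail_value G A r C \<zeta> a) = \<one>\<^bsub>G\<^esub>"
    if cl: "closed_trail_in (good_set A a n) \<zeta>" for \<zeta>
  proof -
    have "(\<phi> ^^ t) (trail_value G A r C \<zeta> a) = trail_value G A r C \<zeta> ((\<Phi> ^^ t) a)"
      by (rule n(3) [OF cl, symmetric])
    also have "\<dots> = \<one>\<^bsub>G\<^esub>"
      using cl by (intro trail_value_in_subshift [OF assms(4) is_group assms(6,9) _ _ assms(10)])
        (auto simp: closed_trail_in_def)
    finally show ?thesis .
  qed
  with n(1,2) show ?thesis by blast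
qed

lemma mon_funpow_eq_one:
  assumes "group G" "\<phi> \<in> mon G G" "u \<in> carrier G" "(\<phi> ^^ t) u = \<one>\<^bsub>G\<^esub>"
  shows "u = \<one>\<^bsub>G\<^esub>"
  using assms(4)
proof (induction t)
  case (Suc t)
  interpret group G by fact
  have \<phi>: "\<phi> \<in> hom G G" "inj_on \<phi> (carrier G)" using assms(2) by (simp_all add: mon_def)
  have "(\<phi> ^^ t) u \<in> carrier G"
    using assms(3) by (induction t) (simp_all add: hom_in_carrier [OF \<phi>(1)])
  moreover have "\<phi> ((\<phi> ^^ t) u) = \<phi> \<one>\<^bsub>G\<^esub>"
    using Suc.prems hom_one [OF \<phi>(1) assms(1,1)] by simp
  ultimately have "(\<phi> ^^ t) u = \<one>\<^bsub>G\<^esub>" using inj_onD [OF \<phi>(2)] by blast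
  then show ?case by (rule Suc.IH)
qed simp

lemma persistent_of_nontrivial_residues:
  fixes A :: "(int ^ 'd \<Rightarrow> 'a::finite) set"
  assumes "cellular_automaton \<Phi>" "has_radius \<Phi> R" "\<Phi> ` A \<subseteq> A" "subshift A" "comm_group G"
    "cocycle G A C" "\<phi> \<in> hom G G" "cohomologous G A (pull A \<Phi> C) (\<lambda>z x. \<phi> (C z x))"
    "a \<in> tilde A" "proper_base A a r0 Y \<omega>"
    "\<And>n. \<exists>\<gamma>\<in>carrier (pi1_infty A a r0 Y \<omega>). (\<phi> ^^ n) (residue G A a Y \<omega> C a \<gamma>) \<noteq> \<one>\<^bsub>G\<^esub>"
  shows "persistent A \<Phi> a"
proof (rule persistentI [OF assms(1-3,9)])
  fix t
  interpret comm_group G by fact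
  obtain r where r: "locally_determined A r C" by (rule cocycle_radius [OF assms(4,6)])
  show "(\<Phi> ^^ t) a \<notin> A"
  proof
    assume t: "(\<Phi> ^^ t) a \<in> A"
    obtain \<gamma> where \<gamma>: "\<gamma> \<in> carrier (pi1_infty A a r0 Y \<omega>)"
      "(\<phi> ^^ t) (residue G A a Y \<omega> C a \<gamma>) \<noteq> \<one>\<^bsub>G\<^esub>" using assms(11) by blast
    obtain u where u: "has_residue G A a Y \<omega> C \<gamma> a u"
      using has_residue_exists [OF assms(4) is_group assms(6,10) \<gamma>(1)] by blast
    have uc: "u \<in> carrier G" using u by (simp add: has_residue_def)
    have res: "residue G A a Y \<omega> C a \<gamma> = u" by (rule residue_eq [OF assms(4-6) u]) blast
    obtain n where n: "\<And>s. s \<ge> n \<Longrightarrow> \<exists>\<zeta>. represents (Y \<inter> good_set A a s) \<omega> (\<gamma> s) \<zeta>"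
      "\<And>s \<zeta>. s \<ge> n \<Longrightarrow> represents (Y \<inter> good_set A a s) \<omega> (\<gamma> s) \<zeta> \<Longrightarrow>
        \<exists>g\<in>carrier G. trail_value G A r C \<zeta> a = g \<otimes>\<^bsub>G\<^esub> u \<otimes>\<^bsub>G\<^esub> inv\<^bsub>G\<^esub> g"
      using has_residueD [OF u r] by blast
    obtain m where m: "\<And>\<zeta>. closed_trail_in (good_set A a m) \<zeta> \<Longrightarrow>
        (\<phi> ^^ t) (trail_value G A r C \<zeta> a) = \<one>\<^bsub>G\<^esub>"
      using trail_value_funpow_eq_one [OF assms(1-8) r t] by blast
    obtain \<zeta> where \<zeta>: "represents (Y \<inter> good_set A a (max n m)) \<omega> (\<gamma> (max n m)) \<zeta>"
      using n(1) [of "max n m"] by auto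
    have "trail_value G A r C \<zeta> a = u"
      using n(2) [OF _ \<zeta>] comm_group_conjugate [OF assms(5) _ uc] by auto
    with m [OF closed_trail_in_good_mono [OF represents_closed_trail [OF \<zeta>]]] \<gamma>(2) res
    show False by simp
  qed
qed

text \<open>Since \<open>H\<close> may be nonabelian, the argument uses trail values of the
  fundamental cocycle: injectivity of \<phi> forces those at \<open>a\<close> to be
  \<open>\<one>\<close>, and \<open>residue_hom\<close> transfers this to the cocycle with the
  pole.\<close>

lemma monomorphism_poles_persistent:
  fixes A :: "(int ^ 'd \<Rightarrow> 'a::finite) set" and H :: "'h monoid"
  assumes "cellular_automaton \<Phi>" "has_radius \<Phi> R" "\<Phi> ` A \<subseteq> A" "subshift A" "comm_group G"
    "fundamental_cocycle TYPE('h) G A C" "\<phi> \<in> mon G G"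
    "cohomologous G A (pull A \<Phi> C) (\<lambda>z x. \<phi> (C z x))" "group H"
  shows "poles_persistent H A \<Phi>"
  unfolding poles_persistent_def
proof (intro ballI allI impI)
  interpret comm_group G by fact
  have C: "cocycle G A C" using assms(6) by (simp add: fundamental_cocycle_def)
  have \<phi>: "\<phi> \<in> hom G G" using assms(7) by (simp add: mon_def)
  obtain r where r: "locally_determined A r C" by (rule cocycle_radius [OF assms(4) C])
  fix a r0 Y \<omega> assume a: "a \<in> tilde A" and "proper_base A a r0 Y \<omega> \<and> has_pole H A a r0 Y \<omega>"
  then obtain D \<gamma> v where D: "cocycle H A D" and v: "has_residue H A a Y \<omega> D \<gamma> a v" "v \<noteq> \<one>\<^bsub>H\<^esub>"
    unfolding has_pole_def by blast
  obtain \<psi> where \<psi>: "\<psi> \<in> hom G H" "cohomologous H A D (\<lambda>z x. \<psi> (C z x))"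
    using assms(6,9) D unfolding fundamental_cocycle_def by blast
  show "persistent A \<Phi> a"
  proof (rule persistentI [OF assms(1-3) a])
    fix t
    show "(\<Phi> ^^ t) a \<notin> A"
    proof
      assume t: "(\<Phi> ^^ t) a \<in> A"
      obtain m where m: "m > 0" "r \<le> m"
        "\<And>\<zeta>. closed_trail_in (good_set A a m) \<zeta> \<Longrightarrow>
          (\<phi> ^^ t) (trail_value G A r C \<zeta> a) = \<one>\<^bsub>G\<^esub>"
        using trail_value_funpow_eq_one [OF assms(1-5) C \<phi> assms(8) r t] by blast
      have "trail_value G A r C \<zeta> a = \<one>\<^bsub>G\<^esub>"
        if s: "s \<ge> m" and \<zeta>: "represents (Y \<inter> good_set A a s) \<omega> (\<gamma> s) \<zeta>" for s \<zeta>
      proof (rule mon_funpow_eq_one [OF is_group assms(7) _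
            m(3) [OF closed_trail_in_good_mono [OF represents_closed_trail [OF \<zeta>] s]]])
        show "trail_value G A r C \<zeta> a \<in> carrier G"
          using represents_closed_trail [OF \<zeta>] m(1,2) s
          by (intro trail_value_closed [OF assms(4) is_group C r, of _ _ s]) (auto simp: closed_trail_in_def)
      qed
      from residue_hom [OF assms(4) is_group assms(9) C D \<psi> r v(1) this] v(2) show False by simp
    qed
  qed
qed

theorem proposition2p11:
  fixes \<Phi> :: "(int ^ 'd \<Rightarrow> 'a::finite) \<Rightarrow> int ^ 'd \<Rightarrow> 'a"
    and A :: "(int ^ 'd \<Rightarrow> 'a) set"
    and R :: nat
    and G :: "'g monoid"
    and a b :: "int ^ 'd \<Rightarrow> 'a"
    and Gs :: "'s monoid"
    and Cs :: "int ^ 'd \<Rightarrow> (int ^ 'd \<Rightarrow> 'a) \<Rightarrow> 's"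
  assumes "cellular_automaton \<Phi>" and "has_radius \<Phi> R" and "R > 0"
    and "subshift A" and "\<Phi> ` A \<subseteq> A"
    and "group G"
    and "a \<in> tilde A" and "b = \<Phi> a"
  shows
    \<comment> \<open>(a)\<close>
    "(\<forall>C r. cocycle G A C \<and> r > 0 \<and> locally_determined A r C \<longrightarrow>
        (\<forall>\<zeta>. closed_trail_in (good_set A a (R + r)) \<zeta> \<longrightarrow>
           trail_value G A r C \<zeta> b = trail_value G A (R + r) (pull A \<Phi> C) \<zeta> a))
     \<and>
     \<comment> \<open>(b)\<close>
     (H1_pull G A \<Phi> ` H1_dy G A = H1_dy G A \<longrightarrow> poles_persistent G A \<Phi>)
     \<and>
     (comm_group Gs \<and> fundamental_cocycle TYPE('h) Gs A Cs \<longrightarrow>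
       \<comment> \<open>(c)\<close>
       (\<forall>r0 Y \<omega>. proper_base A a r0 Y \<omega> \<longrightarrow>
          (\<forall>H :: 'h monoid. comm_group H \<and> has_pole H A a r0 Y \<omega> \<longrightarrow>
             (\<exists>\<gamma>\<in>carrier (pi1_infty A a r0 Y \<omega>). residue Gs A a Y \<omega> Cs a \<gamma> \<noteq> \<one>\<^bsub>Gs\<^esub>)))
       \<and>
       (\<forall>\<phi>\<in>hom Gs Gs.
          (\<forall>\<epsilon>\<in>hom Gs Gs.
             cohomologous Gs A (pull A \<Phi> (\<lambda>z x. \<epsilon> (Cs z x))) (\<lambda>z x. \<epsilon> (\<phi> (Cs z x)))) \<longrightarrow>
          \<comment> \<open>(d)\<close>
          (\<forall>r0 Y \<omega>. proper_base A a r0 Y \<omega> \<longrightarrow>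
             (\<forall>\<gamma>\<in>carrier (pi1_infty A a r0 Y \<omega>).
                residue Gs A a Y \<omega> Cs b \<gamma> = \<phi> (residue Gs A a Y \<omega> Cs a \<gamma>))
             \<and>
             ((\<forall>n. \<exists>\<gamma>\<in>carrier (pi1_infty A a r0 Y \<omega>).
                  (\<phi> ^^ n) (residue Gs A a Y \<omega> Cs a \<gamma>) \<noteq> \<one>\<^bsub>Gs\<^esub>) \<longrightarrow>
              persistent A \<Phi> a))
          \<and>
          \<comment> \<open>(e)\<close>
          (\<phi> \<in> mon Gs Gs \<longrightarrow> (\<forall>H :: 'h monoid. group H \<longrightarrow> poles_persistent H A \<Phi>))))"
proof (intro conjI allI impI ballI; (elim conjE)?)
  note \<Phi> = assms(1,2,5)
  fix C :: "int ^ 'd \<Rightarrow> (int ^ 'd \<Rightarrow> 'a) \<Rightarrow> 'g" and r \<zeta>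
  assume "0 < r" "locally_determined A r C" "closed_trail_in (good_set A a (R + r)) \<zeta>"
  then show "trail_value G A r C \<zeta> b = trail_value G A (R + r) (pull A \<Phi> C) \<zeta> a"
    unfolding assms(8) by (intro trail_value_pull [OF \<Phi>]) (auto simp: closed_trail_in_def)
next
  assume "H1_pull G A \<Phi> ` H1_dy G A = H1_dy G A"
  then show "poles_persistent G A \<Phi>"
    by (rule surjective_poles_persistent [OF assms(1,2,5,4,6)])
next
  fix r0 Y \<omega> and H :: "'h monoid"
  assume "comm_group Gs" "fundamental_cocycle TYPE('h) Gs A Cs" "proper_base A a r0 Y \<omega>"
    "comm_group H" "has_pole H A a r0 Y \<omega>"
  then show "\<exists>\<gamma>\<in>carrier (pi1_infty A a r0 Y \<omega>). residue Gs A a Y \<omega> Cs a \<gamma> \<noteq> \<one>\<^bsub>Gs\<^esub>"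
    by (intro fundamental_residue_nontrivial [OF assms(4)] comm_group.axioms(2))
next
  note \<Phi> = assms(1,2,5,4)
  fix \<phi> :: "'s \<Rightarrow> 's"
  assume Gs: "comm_group Gs" and fund: "fundamental_cocycle TYPE('h) Gs A Cs"
    and \<phi>: "\<phi> \<in> hom Gs Gs"
    and coh: "\<forall>\<epsilon>\<in>hom Gs Gs. cohomologous Gs A (pull A \<Phi> (\<lambda>z x. \<epsilon> (Cs z x))) (\<lambda>z x. \<epsilon> (\<phi> (Cs z x)))"
  have Cs: "cocycle Gs A Cs" using fund by (simp add: fundamental_cocycle_def)
  \<comment> \<open>The instance \<epsilon> = identity relates the pullback of the fundamental
    cocycle to its image under \<phi>.\<close>
  have "(\<lambda>g. g) \<in> hom Gs Gs" by (simp add: hom_def)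
  from bspec [OF coh this] have coh: "cohomologous Gs A (pull A \<Phi> Cs) (\<lambda>z x. \<phi> (Cs z x))"
    by simp
  {
    fix r0 Y \<omega> \<gamma> assume "proper_base A a r0 Y \<omega>" "\<gamma> \<in> carrier (pi1_infty A a r0 Y \<omega>)"
    then show "residue Gs A a Y \<omega> Cs b \<gamma> = \<phi> (residue Gs A a Y \<omega> Cs a \<gamma>)"
      unfolding assms(8) by (rule residue_endomorphism [OF \<Phi> Gs Cs \<phi> coh])
  next
    fix r0 Y \<omega> assume "proper_base A a r0 Y \<omega>"
      "\<forall>n. \<exists>\<gamma>\<in>carrier (pi1_infty A a r0 Y \<omega>). (\<phi> ^^ n) (residue Gs A a Y \<omega> Cs a \<gamma>) \<noteq> \<one>\<^bsub>Gs\<^esub>"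
    then show "persistent A \<Phi> a"
      by (intro persistent_of_nontrivial_residues [OF \<Phi> Gs Cs \<phi> coh assms(7)]) blast+
  next
    fix H :: "'h monoid" assume "\<phi> \<in> mon Gs Gs" "group H"
    then show "poles_persistent H A \<Phi>"
      by (intro monomorphism_poles_persistent [OF \<Phi> Gs fund _ coh])
  }
qed

end
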